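(* Let $p$ be a prime number and let $G$ be a non-abelian $p$-group of order $p^3$. Assume that $K$ is any field such that either (i) $\operatorname{char} K = p > 0$, or (ii) $\operatorname{char} K \neq p$ and $K$ contains a primitive $p$-th root of unity. Then $K(G)$ is rational over $K$.
   Context: For a field $K$ and a finite group $G$, let $G$ act on the rational function field $K(x_g : g \in G)$ (in $|G|$ independent variables indexed by $G$) by $K$-automorphisms defined by $g \cdot x_h = x_{gh}$ for all $g, h \in G$. Denote by $K(G) = K(x_g : g \in G)^G$ the fixed field of this action. An extension field of $K$ is called rational over $K$ if it is purely transcendental over $K$. *)

theory Defs
  imports
    "HOL-Library.Poly_Mapping"
    "HOL-Computational_Algebra.Computational_Algebra"
    "HOL-Algebra.Algebra"
    "HOL-Algebra.Algebraic_Closure_Type"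
begin

text \<open>
  Finitely supported functions from monomials to coefficients already form a commutative ring,
  but the library makes them an integral domain only for linearly ordered variables. The copy of
  the type below is an integral domain for variables of an arbitrary type \<open>'v\<close>.
\<close>

typedef (overloaded) ('v, 'k) mpoly = "UNIV :: (('v \<Rightarrow>\<^sub>0 nat) \<Rightarrow>\<^sub>0 'k::zero) set"
  morphisms coeffs MPoly ..

setup_lifting type_definition_mpoly

instantiation mpoly :: (type, comm_ring_1) comm_ring_1
begin

lift_definition zero_mpoly :: "('a, 'b) mpoly" is 0 .
lift_definition one_mpoly :: "('a, 'b) mpoly" is 1 .
lift_definition plus_mpoly :: "('a, 'b) mpoly \<Rightarrow> ('a, 'b) mpoly \<Rightarrow> ('a, 'b) mpoly" is "(+)" .
lift_definition minus_mpoly :: "('a, 'b) mpoly \<Rightarrow> ('a, 'b) mpoly \<Rightarrow> ('a, 'b) mpoly" is "(-)" .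
lift_definition uminus_mpoly :: "('a, 'b) mpoly \<Rightarrow> ('a, 'b) mpoly" is uminus .
lift_definition times_mpoly :: "('a, 'b) mpoly \<Rightarrow> ('a, 'b) mpoly \<Rightarrow> ('a, 'b) mpoly" is "(*)" .

instance
  by (intro_classes; transfer) (auto simp: algebra_simps)

end

lemma poly_mapping_mult_neq_0:
  fixes p q :: "('v \<Rightarrow>\<^sub>0 nat) \<Rightarrow>\<^sub>0 'k::idom"
  assumes "p \<noteq> 0" "q \<noteq> 0"
  shows "p * q \<noteq> 0"
proof -
  let ?K = "Poly_Mapping.keys" and ?L = "Poly_Mapping.lookup"
  define V where "V = (\<Union>m \<in> ?K p \<union> ?K q. ?K m)"
  have finV: "finite V" by (simp add: V_def)
  then obtain e :: "'v \<Rightarrow> nat" where e: "inj_on e V"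
    using finite_imp_inj_to_nat_seg by metis
  define \<phi> :: "('v \<Rightarrow>\<^sub>0 nat) \<Rightarrow> (nat \<Rightarrow>\<^sub>0 nat)"
    where "\<phi> m = (\<Sum>v\<in>V. Poly_Mapping.single (e v) (?L m v))" for m
  have \<phi>_add: "\<phi> (m + n) = \<phi> m + \<phi> n" for m n
    by (simp add: \<phi>_def lookup_add single_add sum.distrib)
  have \<phi>_lookup: "?L (\<phi> m) (e v) = ?L m v" if "v \<in> V" for m v
  proof -
    have "?L (\<phi> m) (e v) = (\<Sum>w\<in>V. if w = v then ?L m v else 0)"
      unfolding \<phi>_def lookup_sum lookup_single
      using e that by (intro sum.cong refl) (auto simp: when_def inj_on_def)
    also have "\<dots> = ?L m v" using that finV by simp
    finally show ?thesis .
  qed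
  have \<phi>_inj: "m = n" if "\<phi> m = \<phi> n" "?K m \<subseteq> V" "?K n \<subseteq> V" for m n
  proof (rule poly_mapping_eqI)
    fix v
    show "?L m v = ?L n v"
      using \<phi>_lookup[of v m] \<phi>_lookup[of v n] that
      by (cases "v \<in> V") (simp, metis not_in_keys_iff_lookup_eq_zero subsetD)
  qed
  have KV: "?K m \<subseteq> V" if "m \<in> ?K p \<or> m \<in> ?K q" for m
    using that by (auto simp: V_def)
  have ne: "?K p \<noteq> {}" "?K q \<noteq> {}"
    using assms by (metis poly_mapping_eqI lookup_zero in_keys_iff empty_iff)+
  obtain a where a: "a \<in> ?K p" "\<And>m. m \<in> ?K p \<Longrightarrow> \<phi> m \<le> \<phi> a"
    using ne(1) finite_keys[of p] Max_in[of "\<phi> ` ?K p"] Max_ge[of "\<phi> ` ?K p"]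
    by (metis (no_types, lifting) finite_imageI image_iff image_is_empty)
  obtain b where b: "b \<in> ?K q" "\<And>m. m \<in> ?K q \<Longrightarrow> \<phi> m \<le> \<phi> b"
    using ne(2) finite_keys[of q] Max_in[of "\<phi> ` ?K q"] Max_ge[of "\<phi> ` ?K q"]
    by (metis (no_types, lifting) finite_imageI image_iff image_is_empty)
  have top: "m = a \<and> n = b" if "m \<in> ?K p" "n \<in> ?K q" "a + b = m + n" for m n
  proof -
    have eq: "\<phi> a + \<phi> b = \<phi> m + \<phi> n" using that(3) \<phi>_add by metis
    have "\<phi> m = \<phi> a" "\<phi> n = \<phi> b"
      using a(2)[OF that(1)] b(2)[OF that(2)] eq add_strict_mono[of "\<phi> m" "\<phi> a" "\<phi> n" "\<phi> b"]
      by (metis add_le_less_mono add_less_le_mono order.strict_iff_order less_irrefl)+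
    then show ?thesis
      using \<phi>_inj KV that a(1) b(1) by metis
  qed
  have "?L (p * q) (a + b) = (\<Sum>(m, n). ?L p m * ?L q n when a + b = m + n)"
    by (simp add: times_poly_mapping.rep_eq prod_fun_unfold_prod)
  also have "\<dots> = (\<Sum>mn. (case mn of (m, n) \<Rightarrow> ?L p m * ?L q n) when (a, b) = mn)"
  proof (rule Sum_any.cong)
    fix mn :: "('v \<Rightarrow>\<^sub>0 nat) \<times> ('v \<Rightarrow>\<^sub>0 nat)"
    obtain m n where mn: "mn = (m, n)" by (cases mn)
    show "(case mn of (m, n) \<Rightarrow> ?L p m * ?L q n when a + b = m + n) =
      ((case mn of (m, n) \<Rightarrow> ?L p m * ?L q n) when (a, b) = mn)"
      using top[of m n] by (auto simp: mn when_def in_keys_iff)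
  qed
  also have "\<dots> = ?L p a * ?L q b" by simp
  finally have "?L (p * q) (a + b) \<noteq> 0"
    using a(1) b(1) by (simp add: in_keys_iff)
  then show ?thesis by auto
qed

instance mpoly :: (type, idom) idom
  by (intro_classes; transfer) (rule poly_mapping_mult_neq_0)

lift_definition Const :: "'k::zero \<Rightarrow> ('v, 'k) mpoly" is "Poly_Mapping.single 0" .

lift_definition Var :: "'v \<Rightarrow> ('v, 'k::zero_neq_one) mpoly"
  is "\<lambda>v. Poly_Mapping.single (Poly_Mapping.single v 1) 1" .

lift_definition vars :: "('v, 'k::zero) mpoly \<Rightarrow> 'v set"
  is "\<lambda>p. \<Union>m \<in> Poly_Mapping.keys p. Poly_Mapping.keys m" .

text \<open>
  \<open>meval h f p\<close> is the value of \<open>p\<close> when the coefficients are mapped along \<open>h\<close> and each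
  variable \<open>v\<close> is replaced by \<open>f v\<close>.
\<close>

lift_definition meval ::
    "('k::zero \<Rightarrow> 'l::comm_semiring_1) \<Rightarrow> ('v \<Rightarrow> 'l) \<Rightarrow> ('v, 'k) mpoly \<Rightarrow> 'l"
  is "\<lambda>h f p. \<Sum>m \<in> Poly_Mapping.keys p.
        h (Poly_Mapping.lookup p m) *
        (\<Prod>v \<in> Poly_Mapping.keys m. f v ^ Poly_Mapping.lookup m v)" .

definition ring_hom_fun :: "('a::comm_ring_1 \<Rightarrow> 'b::comm_ring_1) \<Rightarrow> bool" where
  "ring_hom_fun h \<longleftrightarrow>
     h 1 = 1 \<and> (\<forall>x y. h (x + y) = h x + h y) \<and> (\<forall>x y. h (x * y) = h x * h y)"

lemma ring_hom_funD:
  assumes "ring_hom_fun h"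
  shows "h 1 = 1" "h (x + y) = h x + h y" "h (x * y) = h x * h y" "h 0 = 0"
    "h (x ^ n) = h x ^ n" "h (sum f A) = (\<Sum>a\<in>A. h (f a))" "h (prod f A) = (\<Prod>a\<in>A. h (f a))"
proof -
  show 1: "h 1 = 1" and a: "h (x + y) = h x + h y" and m: "h (x * y) = h x * h y" for x y
    using assms by (auto simp: ring_hom_fun_def)
  show 0: "h 0 = 0" using a[of 0 0] by simp
  show "h (x ^ n) = h x ^ n" by (induction n) (auto simp: 1 m)
  show "h (sum f A) = (\<Sum>a\<in>A. h (f a))"
    by (induction A rule: infinite_finite_induct) (auto simp: 0 a)
  show "h (prod f A) = (\<Prod>a\<in>A. h (f a))"
    by (induction A rule: infinite_finite_induct) (auto simp: 1 m)
qed

lemma ring_hom_fun_Const: "ring_hom_fun (Const :: 'k::comm_ring_1 \<Rightarrow> ('v, 'k) mpoly)"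
  unfolding ring_hom_fun_def by (auto; transfer; simp add: single_add mult_single)

lemma meval_hom_comp:
  assumes "ring_hom_fun \<psi>"
  shows "\<psi> (meval h f p) = meval (\<lambda>c. \<psi> (h c)) (\<lambda>v. \<psi> (f v)) p"
  by (simp add: meval.rep_eq ring_hom_funD[OF assms])

lemma meval_cong:
  assumes "\<And>v. v \<in> vars p \<Longrightarrow> f v = g v"
  shows "meval h f p = meval h g p"
  unfolding meval.rep_eq
  by (intro sum.cong refl arg_cong2[where f = "(*)"] prod.cong arg_cong2[where f = "(^)"] assms)
    (auto simp: vars.rep_eq)

lemma meval_superset:
  assumes "h 0 = 0" "finite A" "Poly_Mapping.keys (coeffs p) \<subseteq> A"
  shows "meval h f p = (\<Sum>m\<in>A. h (Poly_Mapping.lookup (coeffs p) m) *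
     (\<Prod>v\<in>Poly_Mapping.keys m. f v ^ Poly_Mapping.lookup m v))"
  unfolding meval.rep_eq using assms
  by (intro sum.mono_neutral_left) (auto simp: in_keys_iff)

lemma meval_monomial_add:
  fixes f :: "'v \<Rightarrow> 'l::comm_semiring_1"
  shows "(\<Prod>v\<in>Poly_Mapping.keys (m + n). f v ^ Poly_Mapping.lookup (m + n) v) =
   (\<Prod>v\<in>Poly_Mapping.keys m. f v ^ Poly_Mapping.lookup m v) *
   (\<Prod>v\<in>Poly_Mapping.keys n. f v ^ Poly_Mapping.lookup n v)"
proof -
  let ?A = "Poly_Mapping.keys m \<union> Poly_Mapping.keys n"
  have *: "(\<Prod>v\<in>Poly_Mapping.keys k. f v ^ Poly_Mapping.lookup k v) =
      (\<Prod>v\<in>?A. f v ^ Poly_Mapping.lookup k v)" if "Poly_Mapping.keys k \<subseteq> ?A" for k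
    using that by (intro prod.mono_neutral_left) (auto simp: in_keys_iff)
  show ?thesis
    unfolding *[OF Un_upper1] *[OF Un_upper2] *[OF keys_add]
    by (simp add: lookup_add power_add prod.distrib)
qed

lemma coeffs_sum_single:
  "p = (\<Sum>m\<in>Poly_Mapping.keys p. Poly_Mapping.single m (Poly_Mapping.lookup p m))"
  by (rule poly_mapping_eqI)
    (simp add: lookup_sum lookup_single when_def in_keys_iff)

lemma ring_hom_fun_meval:
  assumes h: "ring_hom_fun h"
  shows "ring_hom_fun (meval h f)"
proof -
  note hD = ring_hom_funD[OF h]
  define E where "E p = meval h f (MPoly p)" for p
  define M where "M m = (\<Prod>v\<in>Poly_Mapping.keys m. f v ^ Poly_Mapping.lookup m v)" for m
  note co = MPoly_inverse[OF UNIV_I]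
  have add: "E (p + q) = E p + E q" for p q
  proof -
    let ?A = "Poly_Mapping.keys p \<union> Poly_Mapping.keys q"
    show ?thesis
      unfolding E_def
      using meval_superset[where h = h and f = f and A = ?A and p = "MPoly p", OF hD(4)]
        meval_superset[where h = h and f = f and A = ?A and p = "MPoly q", OF hD(4)]
        meval_superset[where h = h and f = f and A = ?A and p = "MPoly (p + q)", OF hD(4)]
        keys_add[of p q]
      by (simp add: co lookup_add hD distrib_right sum.distrib)
  qed
  have zero: "E 0 = 0" by (simp add: E_def meval.rep_eq co)
  have sum: "E (sum g A) = (\<Sum>a\<in>A. E (g a))" for g :: "'z \<Rightarrow> _" and A
    by (induction A rule: infinite_finite_induct) (auto simp: zero add)
  have sgl: "E (Poly_Mapping.single m c) = h c * M m" for m c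
    using meval_superset[of h "{m}" "MPoly (Poly_Mapping.single m c)" f]
    by (simp add: E_def M_def co hD)
  have mult: "E (p * q) = E p * E q" for p q
  proof -
    let ?s = "\<lambda>p m. Poly_Mapping.single m (Poly_Mapping.lookup p m)"
    have Ep: "E p = (\<Sum>m\<in>Poly_Mapping.keys p. E (?s p m))" for p
      unfolding sum[symmetric] by (rule arg_cong[OF coeffs_sum_single])
    have "p * q = (\<Sum>m\<in>Poly_Mapping.keys p. \<Sum>n\<in>Poly_Mapping.keys q. ?s p m * ?s q n)"
      unfolding sum_product[symmetric] by (simp only: coeffs_sum_single[symmetric])
    then have "E (p * q) =
        (\<Sum>m\<in>Poly_Mapping.keys p. \<Sum>n\<in>Poly_Mapping.keys q. E (?s p m * ?s q n))"
      by (simp add: sum)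
    also have "\<dots> =
        (\<Sum>m\<in>Poly_Mapping.keys p. \<Sum>n\<in>Poly_Mapping.keys q. E (?s p m) * E (?s q n))"
      by (simp add: mult_single sgl hD M_def meval_monomial_add algebra_simps)
    also have "\<dots> = E p * E q"
      by (simp only: Ep[symmetric] sum_product[symmetric])
    finally show ?thesis .
  qed
  have one: "E 1 = 1"
    using sgl[of 0 1] by (simp add: M_def hD)
  have E: "meval h f P = E (coeffs P)" for P by (simp add: E_def coeffs_inverse)
  show ?thesis
    unfolding ring_hom_fun_def E
    by (simp add: one_mpoly.rep_eq plus_mpoly.rep_eq times_mpoly.rep_eq one add mult)
qed

lemma meval_Var [simp]: "h 0 = 0 \<Longrightarrow> h 1 = 1 \<Longrightarrow> meval h f (Var v) = f v"
  by transfer simp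

lemma meval_Const [simp]: "h 0 = 0 \<Longrightarrow> meval h f (Const c) = h c"
  by transfer simp

lemma meval_Const_Var [simp]:
  fixes p :: "('v, 'k::comm_ring_1) mpoly"
  shows "meval Const Var p = p"
proof -
  have pow: "Var v ^ n = (MPoly (Poly_Mapping.single (Poly_Mapping.single v n) 1) :: ('v, 'k) mpoly)"
    for v n
    by (induction n; simp add: coeffs_inject[symmetric] Var.rep_eq times_mpoly.rep_eq
        one_mpoly.rep_eq MPoly_inverse mult_single single_add[symmetric])
  have coprod: "coeffs (prod g A) = prod (\<lambda>a. coeffs (g a)) A" for g :: "'z \<Rightarrow> ('v, 'k) mpoly" and A
    by (induction A rule: infinite_finite_induct) (auto simp: one_mpoly.rep_eq times_mpoly.rep_eq)
  have cosum: "coeffs (sum g A) = sum (\<lambda>a. coeffs (g a)) A" for g :: "'z \<Rightarrow> ('v, 'k) mpoly" and A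
    by (induction A rule: infinite_finite_induct) (auto simp: zero_mpoly.rep_eq plus_mpoly.rep_eq)
  have prods: "(\<Prod>v\<in>A. Poly_Mapping.single (g v) (1::'k)) = Poly_Mapping.single (\<Sum>v\<in>A. g v) 1"
    for g :: "'v \<Rightarrow> 'v \<Rightarrow>\<^sub>0 nat" and A
    by (induction A rule: infinite_finite_induct) (auto simp: mult_single)
  have "coeffs (meval Const Var p) = coeffs p"
    unfolding meval.rep_eq cosum times_mpoly.rep_eq coprod pow Const.rep_eq
    by (simp add: MPoly_inverse prods mult_single coeffs_sum_single[symmetric])
  then show ?thesis by (simp add: coeffs_inject)
qed

definition rename :: "('v \<Rightarrow> 'w) \<Rightarrow> ('v, 'k::comm_ring_1) mpoly \<Rightarrow> ('w, 'k) mpoly" where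
  "rename \<pi> = meval Const (\<lambda>v. Var (\<pi> v))"

lemma ring_hom_fun_rename: "ring_hom_fun (rename \<pi>)"
  unfolding rename_def by (intro ring_hom_fun_meval ring_hom_fun_Const)

lemma rename_Var [simp]: "rename \<pi> (Var v) = Var (\<pi> v)"
  by (simp add: rename_def ring_hom_funD[OF ring_hom_fun_Const])

lemma rename_Const [simp]: "rename \<pi> (Const c) = Const c"
  by (simp add: rename_def ring_hom_funD[OF ring_hom_fun_Const])

lemma rename_rename: "rename \<sigma> (rename \<pi> p) = rename (\<lambda>v. \<sigma> (\<pi> v)) p"
proof -
  have "rename \<sigma> (rename \<pi> p) = meval (\<lambda>c. rename \<sigma> (Const c)) (\<lambda>v. rename \<sigma> (Var (\<pi> v))) p"
    unfolding rename_def[of \<pi>] by (rule meval_hom_comp[OF ring_hom_fun_rename])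
  then show ?thesis by (simp only: rename_Const rename_Var) (simp add: rename_def)
qed

lemma rename_id [simp]: "rename (\<lambda>v. v) p = p"
  by (simp add: rename_def)

lemma rename_eq_0_iff:
  assumes "inj \<pi>"
  shows "rename \<pi> p = 0 \<longleftrightarrow> p = 0"
proof -
  have "rename (inv_into UNIV \<pi>) (rename \<pi> p) = p"
    using assms by (simp add: rename_rename)
  then show ?thesis
    by (metis ring_hom_funD(4) ring_hom_fun_rename)
qed

type_synonym ('v, 'k) ratfun = "('v, 'k) mpoly fract"

definition rf_const :: "'k::field \<Rightarrow> ('v, 'k) ratfun" where
  "rf_const c = to_fract (Const c)"

definition rf_var :: "'v \<Rightarrow> ('v, 'k::field) ratfun" where
  "rf_var v = to_fract (Var v)"

text \<open>
  The substitution of \<open>\<pi> v\<close> for each variable \<open>v\<close> in a rational function. It is meaningful for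
  bijective \<open>\<pi>\<close> only, as otherwise a denominator may be mapped to zero.
\<close>

definition permute_vars :: "('v \<Rightarrow> 'v) \<Rightarrow> ('v, 'k::field) ratfun \<Rightarrow> ('v, 'k) ratfun" where
  "permute_vars \<pi> x =
     (THE y. \<exists>a b. b \<noteq> 0 \<and> x = Fract a b \<and> y = Fract (rename \<pi> a) (rename \<pi> b))"

lemma permute_vars_Fract:
  assumes "bij \<pi>" "b \<noteq> 0"
  shows "permute_vars \<pi> (Fract a b) = Fract (rename \<pi> a) (rename \<pi> b)"
  unfolding permute_vars_def
proof (rule the_equality)
  show "\<exists>a' b'. b' \<noteq> 0 \<and> Fract a b = Fract a' b' \<and>
      Fract (rename \<pi> a) (rename \<pi> b) = Fract (rename \<pi> a') (rename \<pi> b')"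
    using assms(2) by blast
  fix y
  assume "\<exists>a' b'. b' \<noteq> 0 \<and> Fract a b = Fract a' b' \<and> y = Fract (rename \<pi> a') (rename \<pi> b')"
  then obtain a' b' where b': "b' \<noteq> 0" "Fract a b = Fract a' b'"
      "y = Fract (rename \<pi> a') (rename \<pi> b')"
    by blast
  have "rename \<pi> (a * b') = rename \<pi> (a' * b)"
    using b' assms(2) by (simp add: eq_fract)
  then show "y = Fract (rename \<pi> a) (rename \<pi> b)"
    using b' assms(2)
    by (simp add: eq_fract rename_eq_0_iff[OF bij_is_inj[OF assms(1)]]
        ring_hom_funD(3)[OF ring_hom_fun_rename])
qed

lemma ring_hom_fun_rf_const: "ring_hom_fun (rf_const :: 'k::field \<Rightarrow> ('v, 'k) ratfun)"
  unfolding ring_hom_fun_def rf_const_def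
  by (simp add: ring_hom_funD[OF ring_hom_fun_Const])

lemma permute_vars_var: "bij \<pi> \<Longrightarrow> permute_vars \<pi> (rf_var v) = rf_var (\<pi> v)"
  by (simp add: rf_var_def to_fract_def permute_vars_Fract ring_hom_funD[OF ring_hom_fun_rename])

lemma permute_vars_const: "bij \<pi> \<Longrightarrow> permute_vars \<pi> (rf_const c) = rf_const c"
  by (simp add: rf_const_def to_fract_def permute_vars_Fract ring_hom_funD[OF ring_hom_fun_rename])

lemma ring_hom_fun_permute_vars:
  assumes "bij \<pi>"
  shows "ring_hom_fun (permute_vars \<pi>)"
proof -
  note [simp] = ring_hom_funD[OF ring_hom_fun_rename] rename_eq_0_iff[OF bij_is_inj[OF assms]]
  show ?thesis
    unfolding ring_hom_fun_def
  proof (intro conjI allI)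
    show "permute_vars \<pi> 1 = 1"
      by (simp add: One_fract_def permute_vars_Fract[OF assms])
    fix x y
    show "permute_vars \<pi> (x + y) = permute_vars \<pi> x + permute_vars \<pi> y"
      by (cases x; cases y) (simp add: permute_vars_Fract[OF assms])
    show "permute_vars \<pi> (x * y) = permute_vars \<pi> x * permute_vars \<pi> y"
      by (cases x; cases y) (simp add: permute_vars_Fract[OF assms])
  qed
qed

lemma permute_vars_comp:
  assumes "bij \<pi>" "bij \<sigma>"
  shows "permute_vars \<sigma> (permute_vars \<pi> x) = permute_vars (\<lambda>v. \<sigma> (\<pi> v)) x"
proof -
  have "bij (\<lambda>v. \<sigma> (\<pi> v))" using bij_comp[OF assms] by (simp add: o_def)
  then show ?thesis using assms
    by (cases x) (simp add: permute_vars_Fract rename_rename rename_eq_0_iff bij_is_inj)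
qed

text \<open>
  A field extension of \<open>'k\<close> is given by a field embedding \<open>h\<close> of \<open>'k\<close> into the field \<open>'l\<close>
  together with a subfield of \<open>'l\<close> containing the range of \<open>h\<close>; \<open>adjoin h S\<close> is the extension
  generated by \<open>S\<close>.
\<close>

definition adjoin :: "('k::field \<Rightarrow> 'l::field) \<Rightarrow> 'l set \<Rightarrow> 'l set" where
  "adjoin h S = generate_field ring_of_type_algebra (range h \<union> S)"

text \<open>
  The elements of \<open>B\<close> serve as names of the variables, hence a polynomial in these variables is
  evaluated at \<open>B\<close> by replacing every variable by itself.
\<close>

definition algebraically_independent :: "('k::field \<Rightarrow> 'l::field) \<Rightarrow> 'l set \<Rightarrow> bool" where
  "algebraically_independent h B \<longleftrightarrow>
     (\<forall>p :: ('l, 'k) mpoly. vars p \<subseteq> B \<longrightarrow> meval h (\<lambda>b. b) p = 0 \<longrightarrow> p = 0)"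

definition rational_over :: "('k::field \<Rightarrow> 'l::field) \<Rightarrow> 'l set \<Rightarrow> bool" where
  "rational_over h F \<longleftrightarrow> (\<exists>B. algebraically_independent h B \<and> F = adjoin h B)"

definition rational_function_field :: "'v set \<Rightarrow> ('v, 'k::field) ratfun set" where
  "rational_function_field V = adjoin rf_const (rf_var ` V)"

lemma Var_inject [simp]: "Var v = (Var w :: ('v, 'k::zero_neq_one) mpoly) \<longleftrightarrow> v = w"
proof
  assume "Var v = (Var w :: ('v, 'k) mpoly)"
  then have "Poly_Mapping.keys (coeffs (Var v :: ('v, 'k) mpoly)) =
      Poly_Mapping.keys (coeffs (Var w :: ('v, 'k) mpoly))"
    by simp
  then have "Poly_Mapping.single v (1::nat) = Poly_Mapping.single w 1"
    by (simp add: Var.rep_eq)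
  then have "Poly_Mapping.keys (Poly_Mapping.single v (1::nat)) =
      Poly_Mapping.keys (Poly_Mapping.single w (1::nat))"
    by simp
  then show "v = w" by simp
qed simp

lemma rf_var_inject [simp]: "rf_var v = (rf_var w :: ('v, 'k::field) ratfun) \<longleftrightarrow> v = w"
  by (simp add: rf_var_def)

lemma ring_hom_fun_to_fract: "ring_hom_fun to_fract"
  by (simp add: ring_hom_fun_def)

lemma algebraically_independent_vars:
  "algebraically_independent rf_const (rf_var ` V :: ('v, 'k::field) ratfun set)"
  unfolding algebraically_independent_def
proof (intro allI impI)
  fix p :: "(('v, 'k) ratfun, 'k) mpoly"
  assume V: "vars p \<subseteq> rf_var ` V" and 0: "meval rf_const (\<lambda>b. b) p = 0"
  define r where "r = inv_into UNIV (rf_var :: 'v \<Rightarrow> ('v, 'k) ratfun)"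
  have r: "rf_var (r x) = x" if "x \<in> vars p" for x
    unfolding r_def using that V by (intro f_inv_into_f) auto
  have "to_fract (rename r p) = meval rf_const (\<lambda>b. rf_var (r b)) p"
    using meval_hom_comp[OF ring_hom_fun_to_fract, of Const "\<lambda>v. Var (r v)" p]
    by (simp add: rename_def rf_const_def[abs_def] rf_var_def)
  also have "\<dots> = 0"
    using 0 meval_cong[of p "\<lambda>b. rf_var (r b)" "\<lambda>b. b"] r by metis
  finally have "rename r p = 0" by simp
  then have "rename (\<lambda>x. rf_var (r x) :: ('v, 'k) ratfun) p = 0"
    by (metis rename_rename ring_hom_funD(4) ring_hom_fun_rename)
  moreover have "rename (\<lambda>x. rf_var (r x)) p = rename (\<lambda>x. x) p"
    unfolding rename_def by (rule meval_cong) (simp add: r)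
  ultimately show "p = 0" by simp
qed

text \<open>
  The variables are indexed by the carrier of the group, which may be a proper subset of the
  type \<open>'g\<close>; the remaining elements of the type are left alone.
\<close>

definition left_mult :: "('g, 'm) monoid_scheme \<Rightarrow> 'g \<Rightarrow> 'g \<Rightarrow> 'g" where
  "left_mult G g h = (if h \<in> carrier G then g \<otimes>\<^bsub>G\<^esub> h else h)"

definition group_action_ratfun ::
    "('g, 'm) monoid_scheme \<Rightarrow> 'g \<Rightarrow> ('g, 'k::field) ratfun \<Rightarrow> ('g, 'k) ratfun" where
  "group_action_ratfun G g = permute_vars (left_mult G g)"

definition fixed_field :: "('g, 'm) monoid_scheme \<Rightarrow> ('g, 'k::field) ratfun set" where
  "fixed_field G = {f \<in> rational_function_field (carrier G).
     \<forall>g \<in> carrier G. group_action_ratfun G g f = f}"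

lemma bij_left_mult:
  assumes "group G" "g \<in> carrier G"
  shows "bij (left_mult G g)"
proof -
  interpret group G by fact
  have 1: "left_mult G a (left_mult G b h) = h"
    if "a \<otimes>\<^bsub>G\<^esub> b = \<one>\<^bsub>G\<^esub>" "a \<in> carrier G" "b \<in> carrier G" for a b h
    using that by (auto simp: left_mult_def simp flip: m_assoc)
  show ?thesis
    by (rule o_bij[of "left_mult G (inv\<^bsub>G\<^esub> g)"])
      (use assms(2) in \<open>auto simp: fun_eq_iff intro!: 1\<close>)
qed

lemma group_action_ratfun_var:
  assumes "group G" "g \<in> carrier G" "h \<in> carrier G"
  shows "group_action_ratfun G g (rf_var h) = rf_var (g \<otimes>\<^bsub>G\<^esub> h)"
  using assms by (simp add: group_action_ratfun_def permute_vars_var bij_left_mult left_mult_def)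

lemma group_action_ratfun_const:
  assumes "group G" "g \<in> carrier G"
  shows "group_action_ratfun G g (rf_const c) = rf_const c"
  using assms by (simp add: group_action_ratfun_def permute_vars_const bij_left_mult)

lemma ring_hom_fun_group_action_ratfun:
  assumes "group G" "g \<in> carrier G"
  shows "ring_hom_fun (group_action_ratfun G g)"
  using assms by (simp add: group_action_ratfun_def ring_hom_fun_permute_vars bij_left_mult)

definition primitive_root_of_unity :: "nat \<Rightarrow> 'k::field \<Rightarrow> bool" where
  "primitive_root_of_unity n z \<longleftrightarrow> n > 0 \<and> z ^ n = 1 \<and> (\<forall>m. 0 < m \<and> m < n \<longrightarrow> z ^ m \<noteq> 1)"

end

theory Submission
  imports Defs
begin

text \<open>
  Only the number of generators of the fixed field has to be controlled. The function field has
  transcendence degree \<open>|G|\<close> over \<open>K\<close> and is algebraic over the fixed field of the finite group \<open>G\<close>;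
  so if the fixed field is generated over \<open>K\<close> by at most \<open>|G|\<close> elements, these elements are
  algebraically independent (\<open>rational_if_fixed_gens\<close>, which rests on the exchange lemma
  \<open>steinitz\<close> for algebraic dependence).

  Generators of fixed fields are produced along towers of fields by two results. If \<open>G\<close> acts on
  \<open>F(x)\<close>, with \<open>x\<close> transcendental over the stable field \<open>F\<close>, by affine substitutions
  \<open>x \<mapsto> \<alpha> x + \<beta>\<close> over \<open>F\<close>, then the fixed field of \<open>F(x)\<close> is that of \<open>F\<close> with one more generator
  (\<open>Fix_affine_extension\<close>). If \<open>\<alpha>\<^sup>n\<close> lies in \<open>F\<close> and some automorphism fixes \<open>F\<close> and multiplies
  \<open>\<alpha>\<close> by a primitive \<open>n\<close>-th root of unity, then \<open>F(\<alpha>)\<close> has no more invariants than \<open>F\<close>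
  (\<open>Kummer_fixed\<close>). It remains to write the function field as a suitable tower.

  A non-abelian group of order \<open>p\<^sup>3\<close> is generated by elements \<open>a\<close>, \<open>b\<close> whose commutator \<open>z\<close>
  generates the center, and \<open>b\<close> can be chosen of order \<open>p\<close>, except in the quaternion group
  (\<open>nonabelian_prime_cube\<close>). This leads to three cases.

  In characteristic \<open>p\<close> the linear action on the span of the variables is unipotent. It has a
  flag of stable subspaces, and a basis adapted to the flag gives a tower of affine substitutions
  (\<open>rational_char_p\<close>).

  If the characteristic is not \<open>p\<close> and \<open>b\<close> has order \<open>p\<close>, the subgroup \<open>\<langle>b, z\<rangle>\<close> is diagonalized with the
  given root of unity, and \<open>a\<close> permutes its eigenvectors. One faithful \<open>p\<close>-dimensional summand
  is treated by hand: for the quotients of its coordinates, a Fourier transform along \<open>a\<close>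
  exhibits their field as a Kummer extension of a field on which the group acts diagonally. Over
  the function field of this summand everything else is diagonal (\<open>rational_split\<close>).

  For the quaternion group the faithful summand is the quaternion algebra, with the group
  acting by left multiplication. A quaternion up to scalars is a rotation, and the group changes the
  signs of the rows of its matrix. The invariants of this sign action are the lines spanned by
  the rows; two orthogonal lines in space have three rational parameters
  (\<open>rational_quaternion\<close>).
\<close>

section \<open>Subfields\<close>

definition is_subfield :: "'l::field set \<Rightarrow> bool" where
  "is_subfield F \<longleftrightarrow>
     1 \<in> F \<and> (\<forall>x\<in>F. \<forall>y\<in>F. x - y \<in> F \<and> x * y \<in> F) \<and> (\<forall>x\<in>F. inverse x \<in> F)"

lemma is_subfieldD:
  assumes "is_subfield F"
  shows "1 \<in> F" "0 \<in> F" "x \<in> F \<Longrightarrow> y \<in> F \<Longrightarrow> x - y \<in> F" "x \<in> F \<Longrightarrow> - x \<in> F"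
    "x \<in> F \<Longrightarrow> y \<in> F \<Longrightarrow> x + y \<in> F" "x \<in> F \<Longrightarrow> y \<in> F \<Longrightarrow> x * y \<in> F"
    "x \<in> F \<Longrightarrow> inverse x \<in> F" "x \<in> F \<Longrightarrow> y \<in> F \<Longrightarrow> x / y \<in> F" "x \<in> F \<Longrightarrow> x ^ n \<in> F"
    "(\<And>a. a \<in> A \<Longrightarrow> f a \<in> F) \<Longrightarrow> sum f A \<in> F" "(\<And>a. a \<in> A \<Longrightarrow> f a \<in> F) \<Longrightarrow> prod f A \<in> F"
    "of_nat n \<in> F"
proof -
  show 1: "1 \<in> F" and d: "x \<in> F \<Longrightarrow> y \<in> F \<Longrightarrow> x - y \<in> F"
    and m: "x \<in> F \<Longrightarrow> y \<in> F \<Longrightarrow> x * y \<in> F" and i: "x \<in> F \<Longrightarrow> inverse x \<in> F" for x y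
    using assms by (auto simp: is_subfield_def)
  show 0: "0 \<in> F" using d[OF 1 1] by simp
  show n: "x \<in> F \<Longrightarrow> - x \<in> F" for x using d[OF 0, of x] by simp
  show a: "x \<in> F \<Longrightarrow> y \<in> F \<Longrightarrow> x + y \<in> F" for x y using d[OF _ n, of x y] by simp
  show "x \<in> F \<Longrightarrow> y \<in> F \<Longrightarrow> x / y \<in> F" using m i by (simp add: divide_inverse)
  show "x \<in> F \<Longrightarrow> x ^ n \<in> F" by (induction n) (auto simp: 1 m)
  show "(\<And>a. a \<in> A \<Longrightarrow> f a \<in> F) \<Longrightarrow> sum f A \<in> F"
    by (induction A rule: infinite_finite_induct) (auto simp: 0 a)
  show "(\<And>a. a \<in> A \<Longrightarrow> f a \<in> F) \<Longrightarrow> prod f A \<in> F"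
    by (induction A rule: infinite_finite_induct) (auto simp: 1 m)
  show "of_nat n \<in> F" by (induction n) (auto simp: 0 1 a)
qed

lemma a_inv_type_algebra: "a_inv ring_of_type_algebra x = - (x :: 'l::field)"
proof -
  interpret field "ring_of_type_algebra :: 'l ring" by (rule field_from_type_algebra)
  show ?thesis by (rule minus_equality) (auto simp: ring_of_type_algebra_def)
qed

lemma m_inv_type_algebra:
  assumes "x \<noteq> (0 :: 'l::field)"
  shows "m_inv ring_of_type_algebra x = inverse x"
proof -
  interpret field "ring_of_type_algebra :: 'l ring" by (rule field_from_type_algebra)
  show ?thesis
    using assms by (intro comm_inv_char) (auto simp: ring_of_type_algebra_def)
qed

lemma is_subfield_iff: "is_subfield F \<longleftrightarrow> subfield F ring_of_type_algebra"
proof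
  interpret field "ring_of_type_algebra :: 'a ring" by (rule field_from_type_algebra)
  assume F: "is_subfield F"
  show "subfield F ring_of_type_algebra"
  proof (intro subfieldI' subringI)
    fix k assume "k \<in> F - {\<zero>\<^bsub>ring_of_type_algebra\<^esub>}"
    then show "inv\<^bsub>ring_of_type_algebra\<^esub> k \<in> F"
      using m_inv_type_algebra[of k] is_subfieldD[OF F] by (simp add: ring_of_type_algebra_def)
  next
    fix x assume "x \<in> F"
    then show "a_inv ring_of_type_algebra x \<in> F"
      using a_inv_type_algebra[of x] is_subfieldD[OF F] by simp
  qed (use is_subfieldD[OF F] in \<open>auto simp: ring_of_type_algebra_def\<close>)
next
  interpret field "ring_of_type_algebra :: 'a ring" by (rule field_from_type_algebra)
  assume F: "subfield F ring_of_type_algebra"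
  note R = subringE[OF subfieldE(1)[OF F]]
  have 0: "0 \<in> F" and 1: "1 \<in> F" using R(2,3) by (simp_all add: ring_of_type_algebra_def)
  have "x - y \<in> F" if "x \<in> F" "y \<in> F" for x y
    using R(7)[OF that(1) R(5)[OF that(2)]] a_inv_type_algebra[of y]
    by (simp add: ring_of_type_algebra_def)
  moreover have "x * y \<in> F" if "x \<in> F" "y \<in> F" for x y
    using R(6)[OF that] by (simp add: ring_of_type_algebra_def)
  moreover have "inverse x \<in> F" if "x \<in> F" for x
    using subfield_m_inv(1)[OF F, of x] m_inv_type_algebra[of x] that 0
    by (cases "x = 0") (auto simp: ring_of_type_algebra_def)
  ultimately show "is_subfield F" using 1 by (auto simp: is_subfield_def)
qed

lemma adjoin_subfield:
  fixes h :: "'k::field \<Rightarrow> 'l::field"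
  shows "is_subfield (adjoin h S)"
proof -
  interpret field "ring_of_type_algebra :: 'l ring" by (rule field_from_type_algebra)
  show ?thesis unfolding is_subfield_iff adjoin_def
    by (rule generate_field_is_subfield) (simp add: ring_of_type_algebra_def)
qed

lemmas adjoinD = is_subfieldD[OF adjoin_subfield]

lemma adjoin_incl: "(S :: 'l::field set) \<subseteq> adjoin h S" and adjoin_base: "h c \<in> adjoin h S"
  by (auto simp: adjoin_def intro: generate_field.incl)

lemma adjoin_least:
  fixes h :: "'k::field \<Rightarrow> 'l::field"
  assumes "is_subfield F" "range h \<subseteq> F" "S \<subseteq> F"
  shows "adjoin h S \<subseteq> F"
proof -
  interpret field "ring_of_type_algebra :: 'l ring" by (rule field_from_type_algebra)
  show ?thesis using assms unfolding is_subfield_iff adjoin_def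
    by (intro generate_field_min_subfield1) (auto simp: ring_of_type_algebra_def)
qed

lemma adjoin_subset_iff: "adjoin h S \<subseteq> adjoin h T \<longleftrightarrow> S \<subseteq> adjoin h T"
  using adjoin_least[OF adjoin_subfield[of h T], of h S] adjoin_incl[of S h] adjoin_base[of h]
  by blast

lemma adjoin_mono: "S \<subseteq> T \<Longrightarrow> adjoin h S \<subseteq> adjoin h T"
  using adjoin_subset_iff adjoin_incl by blast

lemma adjoin_eqI: "S \<subseteq> adjoin h T \<Longrightarrow> T \<subseteq> adjoin h S \<Longrightarrow> adjoin h S = adjoin h T"
  by (simp add: adjoin_subset_iff subset_antisym)

section \<open>Simple extensions\<close>

definition polys_over :: "'l::field set \<Rightarrow> 'l poly set" where
  "polys_over F = {p. \<forall>i. coeff p i \<in> F}"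

lemma polys_overD: "p \<in> polys_over F \<Longrightarrow> coeff p i \<in> F"
  by (simp add: polys_over_def)

lemma polys_over_mono: "F \<subseteq> F' \<Longrightarrow> polys_over F \<subseteq> polys_over F'"
  by (auto simp: polys_over_def)

lemma polys_over_intros:
  assumes F: "is_subfield F"
  shows "0 \<in> polys_over F" "1 \<in> polys_over F" "c \<in> F \<Longrightarrow> [:c:] \<in> polys_over F"
    "c \<in> F \<Longrightarrow> p \<in> polys_over F \<Longrightarrow> pCons c p \<in> polys_over F"
    "p \<in> polys_over F \<Longrightarrow> q \<in> polys_over F \<Longrightarrow> p + q \<in> polys_over F"
    "p \<in> polys_over F \<Longrightarrow> q \<in> polys_over F \<Longrightarrow> p - q \<in> polys_over F"
    "p \<in> polys_over F \<Longrightarrow> - p \<in> polys_over F"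
    "c \<in> F \<Longrightarrow> p \<in> polys_over F \<Longrightarrow> smult c p \<in> polys_over F"
    "c \<in> F \<Longrightarrow> monom c n \<in> polys_over F"
    "p \<in> polys_over F \<Longrightarrow> q \<in> polys_over F \<Longrightarrow> p * q \<in> polys_over F"
    "p \<in> polys_over F \<Longrightarrow> p ^ n \<in> polys_over F"
    "(\<And>a. a \<in> A \<Longrightarrow> f a \<in> polys_over F) \<Longrightarrow> sum f A \<in> polys_over F"
    "(\<And>a. a \<in> A \<Longrightarrow> f a \<in> polys_over F) \<Longrightarrow> prod f A \<in> polys_over F"
    "p \<in> polys_over F \<Longrightarrow> q \<in> polys_over F \<Longrightarrow> pcompose p q \<in> polys_over F"
proof -
  note D = is_subfieldD[OF F]
  show 0: "0 \<in> polys_over F" and 1: "1 \<in> polys_over F"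
    and c: "c \<in> F \<Longrightarrow> [:c:] \<in> polys_over F"
    and "c \<in> F \<Longrightarrow> p \<in> polys_over F \<Longrightarrow> pCons c p \<in> polys_over F"
    and a: "p \<in> polys_over F \<Longrightarrow> q \<in> polys_over F \<Longrightarrow> p + q \<in> polys_over F"
    and "p \<in> polys_over F \<Longrightarrow> q \<in> polys_over F \<Longrightarrow> p - q \<in> polys_over F"
    and "p \<in> polys_over F \<Longrightarrow> - p \<in> polys_over F"
    and "c \<in> F \<Longrightarrow> p \<in> polys_over F \<Longrightarrow> smult c p \<in> polys_over F"
    and "c \<in> F \<Longrightarrow> monom c n \<in> polys_over F" for c p q
    using D by (auto simp: polys_over_def coeff_pCons coeff_monom coeff_1 split: nat.splits)
  show m: "p \<in> polys_over F \<Longrightarrow> q \<in> polys_over F \<Longrightarrow> p * q \<in> polys_over F" for p q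
    using D by (auto simp: polys_over_def coeff_mult intro!: D(10))
  show "p \<in> polys_over F \<Longrightarrow> p ^ n \<in> polys_over F"
    by (induction n) (auto simp: 1 m)
  show "(\<And>a. a \<in> A \<Longrightarrow> f a \<in> polys_over F) \<Longrightarrow> sum f A \<in> polys_over F"
    by (induction A rule: infinite_finite_induct) (auto simp: 0 a)
  show "(\<And>a. a \<in> A \<Longrightarrow> f a \<in> polys_over F) \<Longrightarrow> prod f A \<in> polys_over F"
    by (induction A rule: infinite_finite_induct) (auto simp: 1 m)
  show "p \<in> polys_over F \<Longrightarrow> q \<in> polys_over F \<Longrightarrow> pcompose p q \<in> polys_over F"
  proof (induction p)
    case (pCons d p)
    have "d \<in> F" using polys_overD[OF pCons.prems(1), of 0] by simp
    moreover have "p \<in> polys_over F"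
      using polys_overD[OF pCons.prems(1), of "Suc i" for i] by (simp add: polys_over_def)
    ultimately show ?case
      unfolding pcompose_pCons using pCons.IH pCons.prems(2) by (intro a m c) auto
  qed (simp add: 0)
qed

lemma poly_in_subfield:
  assumes "is_subfield F" "p \<in> polys_over F" "x \<in> F"
  shows "poly p x \<in> F"
  unfolding poly_altdef using assms
  by (auto intro!: is_subfieldD[OF assms(1)] polys_overD)

text \<open>
  This is the field \<open>F(x)\<close>. Its elements are written out as fractions, because every argument about
  them below is an argument about polynomials over \<open>F\<close>.
\<close>

definition ext :: "'l::field set \<Rightarrow> 'l \<Rightarrow> 'l set" where
  "ext F x = {poly p x / poly q x | p q. p \<in> polys_over F \<and> q \<in> polys_over F \<and> poly q x \<noteq> 0}"

lemma ext_subfield: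
  assumes F: "is_subfield F"
  shows "is_subfield (ext F x)"
proof -
  note I = polys_over_intros[OF F]
  have I': "poly p x / poly q x \<in> ext F x"
    if "p \<in> polys_over F" "q \<in> polys_over F" "poly q x \<noteq> 0" for p q
    using that by (auto simp: ext_def)
  have 1: "1 \<in> ext F x" using I'[OF I(2) I(2)] by simp
  have d: "y - z \<in> ext F x \<and> y * z \<in> ext F x" if yz: "y \<in> ext F x" "z \<in> ext F x" for y z
  proof -
    from yz obtain p q r s where *: "p \<in> polys_over F" "q \<in> polys_over F" "poly q x \<noteq> 0"
      "y = poly p x / poly q x" "r \<in> polys_over F" "s \<in> polys_over F" "poly s x \<noteq> 0"
      "z = poly r x / poly s x"
      by (auto simp: ext_def)
    have "y - z = poly (p * s - r * q) x / poly (q * s) x" "y * z = poly (p * r) x / poly (q * s) x"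
      using *(3,7) unfolding *(4,8) by (simp_all add: field_simps)
    moreover have "poly (p * s - r * q) x / poly (q * s) x \<in> ext F x"
      "poly (p * r) x / poly (q * s) x \<in> ext F x"
      using *(3,7) by (intro I' I *; simp)+
    ultimately show ?thesis by simp
  qed
  have i: "inverse y \<in> ext F x" if y: "y \<in> ext F x" for y
  proof -
    from y obtain p q where *: "p \<in> polys_over F" "q \<in> polys_over F" "poly q x \<noteq> 0"
      "y = poly p x / poly q x" by (auto simp: ext_def)
    show ?thesis
      using I'[OF *(2,1)] I'[OF I(1,2)] * by (cases "poly p x = 0") auto
  qed
  show ?thesis using 1 d i by (auto simp: is_subfield_def)
qed

lemma ext_incl:
  assumes F: "is_subfield F"
  shows "F \<subseteq> ext F x" "x \<in> ext F x"
proof -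
  note I = polys_over_intros[OF F]
  show "F \<subseteq> ext F x"
  proof
    fix c assume "c \<in> F"
    then show "c \<in> ext F x"
      unfolding ext_def using I(2,3) by (intro CollectI exI[of _ "[:c:]"] exI[of _ 1]) simp
  qed
  have "[:0, 1:] \<in> polys_over F" by (intro I is_subfieldD[OF F])
  then show "x \<in> ext F x"
    unfolding ext_def using I(2) by (intro CollectI exI[of _ "[:0, 1:]"] exI[of _ 1]) simp
qed

lemma ext_least:
  assumes "is_subfield F'" "F \<subseteq> F'" "x \<in> F'"
  shows "ext F x \<subseteq> F'"
  using assms poly_in_subfield[OF assms(1) _ assms(3)] polys_over_mono[OF assms(2)]
  by (auto simp: ext_def intro!: is_subfieldD(8)[OF assms(1)])

lemma adjoin_insert: "adjoin h (insert x S) = ext (adjoin h S) x"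
proof
  note F = adjoin_subfield[of h S]
  show "adjoin h (insert x S) \<subseteq> ext (adjoin h S) x"
    using ext_incl[OF F] adjoin_incl[of S h] adjoin_base[of h]
    by (intro adjoin_least ext_subfield F) blast+
  show "ext (adjoin h S) x \<subseteq> adjoin h (insert x S)"
    using adjoin_incl[of "insert x S" h]
    by (intro ext_least adjoin_subfield adjoin_mono) auto
qed

section \<open>Algebraic dependence as a matroid\<close>

definition alg_over :: "'l::field set \<Rightarrow> 'l \<Rightarrow> bool" where
  "alg_over F x \<longleftrightarrow> (\<exists>p \<in> polys_over F. p \<noteq> 0 \<and> poly p x = 0)"

lemma alg_over_self:
  assumes "is_subfield F" "x \<in> F"
  shows "alg_over F x"
proof -
  have "[:- x, 1:] \<in> polys_over F"
    by (intro polys_over_intros[OF assms(1)] is_subfieldD[OF assms(1)] assms(2))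
  then show ?thesis unfolding alg_over_def by (intro bexI[of _ "[:- x, 1:]"]) auto
qed

lemma type_algebra_simps:
  "monoid.mult ring_of_type_algebra = ((*) :: 'l::field \<Rightarrow> 'l \<Rightarrow> 'l)"
  "ring.add ring_of_type_algebra = ((+) :: 'l \<Rightarrow> 'l \<Rightarrow> 'l)"
  "ring.zero ring_of_type_algebra = (0 :: 'l)" "monoid.one ring_of_type_algebra = (1 :: 'l)"
  "carrier ring_of_type_algebra = (UNIV :: 'l set)"
  by (simp_all add: ring_of_type_algebra_def)

lemma eval_type_algebra:
  "ring.eval ring_of_type_algebra l x = poly (Poly (rev l)) (x :: 'l::field)"
proof -
  interpret field "ring_of_type_algebra :: 'l ring" by (rule field_from_type_algebra)
  have pow: "x [^]\<^bsub>ring_of_type_algebra\<^esub> n = x ^ n" for n :: nat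
    by (induction n) (auto simp: ring_of_type_algebra_def)
  show ?thesis
  proof (induction l)
    case (Cons a l)
    have "Poly (rev l @ [a]) = Poly (rev l) + Polynomial.monom a (length l)"
      by (simp add: Poly_append smult_monom)
    then show ?case using Cons pow[of "length l"]
      by (simp add: type_algebra_simps poly_monom)
  qed (simp add: type_algebra_simps)
qed

text \<open>
  The theory of finite extensions is stated for rings with a carrier and for polynomials as lists
  with the leading coefficient first. The translation is needed only for the two closure
  properties of algebraic elements that follow.
\<close>

lemma alg_over_iff:
  assumes F: "is_subfield F"
  shows "alg_over F x \<longleftrightarrow> (ring.algebraic ring_of_type_algebra over F) x"
proof
  interpret field "ring_of_type_algebra :: 'a ring" by (rule field_from_type_algebra)
  assume "alg_over F x"
  then obtain p where p: "p \<in> polys_over F" "p \<noteq> 0" "poly p x = 0" by (auto simp: alg_over_def)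
  define l where "l = rev (Polynomial.coeffs p)"
  have l: "l \<noteq> []" "set l \<subseteq> F" "hd l \<noteq> 0"
    using p by (auto simp: l_def hd_rev last_coeffs_eq_coeff_degree Polynomial.coeffs_def polys_over_def)
  show "(algebraic over F) x"
  proof (rule algebraicI)
    show "l \<in> carrier (F [X]\<^bsub>ring_of_type_algebra\<^esub>)"
      using l by (auto simp: univ_poly_def polynomial_def ring_of_type_algebra_def)
    show "eval l x = \<zero>\<^bsub>ring_of_type_algebra\<^esub>"
      using p(3) unfolding eval_type_algebra by (simp add: l_def ring_of_type_algebra_def)
  qed (rule l)
next
  interpret field "ring_of_type_algebra :: 'a ring" by (rule field_from_type_algebra)
  assume "(algebraic over F) x"
  moreover have "subring F ring_of_type_algebra" using F subfieldE(1) is_subfield_iff by blast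
  ultimately obtain l where l: "l \<in> carrier (F [X]\<^bsub>ring_of_type_algebra\<^esub>)" "l \<noteq> []"
      "eval l x = \<zero>\<^bsub>ring_of_type_algebra\<^esub>"
    using algebraicE[of F x] by (auto simp: type_algebra_simps)
  have l': "set l \<subseteq> F" "hd l \<noteq> 0"
    using l(1,2) by (auto simp: univ_poly_def polynomial_def ring_of_type_algebra_def)
  have "poly.coeff (Poly (rev l)) i \<in> F" for i
  proof (cases "i < length l")
    case True
    then have "rev l ! i \<in> set l" using nth_mem[of i "rev l"] by simp
    then show ?thesis using True l'(1) by (auto simp: nth_default_def)
  qed (simp add: nth_default_def is_subfieldD(2)[OF F])
  moreover have "Poly (rev l) \<noteq> 0"
  proof
    assume "Poly (rev l) = 0"
    then have "poly.coeff (Poly (rev l)) (length l - 1) = 0" by simp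
    then show False using l'(2) l(2) by (cases l) (auto simp: nth_default_def nth_append)
  qed
  ultimately show "alg_over F x"
    using l(3) unfolding eval_type_algebra alg_over_def
    by (intro bexI[of _ "Poly (rev l)"]) (auto simp: polys_over_def ring_of_type_algebra_def)
qed

lemma subfield_algebraic:
  assumes F: "is_subfield F"
  shows "is_subfield {x. alg_over F x}"
proof -
  interpret field "ring_of_type_algebra :: 'a ring" by (rule field_from_type_algebra)
  show ?thesis
    using subfield_of_algebraics[OF F[unfolded is_subfield_iff]]
    unfolding is_subfield_iff alg_over_iff[OF F] by (simp add: ring_of_type_algebra_def)
qed

text \<open>
  The coefficients of an equation for \<open>x\<close> over \<open>F'\<close> generate a finite extension of \<open>F\<close>, so \<open>x\<close> lies
  in a finite extension of \<open>F\<close>.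
\<close>

lemma alg_over_trans:
  assumes F: "is_subfield F" and F': "is_subfield F'"
    and alg: "\<And>y. y \<in> F' \<Longrightarrow> alg_over F y" and x: "alg_over F' x"
  shows "alg_over F x"
proof -
  interpret field "ring_of_type_algebra :: 'a ring" by (rule field_from_type_algebra)
  have C: "A \<subseteq> carrier ring_of_type_algebra" for A :: "'a set" by (simp add: ring_of_type_algebra_def)
  then have Cx: "y \<in> carrier ring_of_type_algebra" for y :: 'a by blast
  note FR = F[unfolded is_subfield_iff]
  have "(algebraic over F') x" using x alg_over_iff[OF F'] by simp
  then obtain l where l: "l \<in> carrier (F' [X]\<^bsub>ring_of_type_algebra\<^esub>)" "l \<noteq> []"
      "eval l x = \<zero>\<^bsub>ring_of_type_algebra\<^esub>"
    using algebraicE[of F' x] F' subfieldE(1) Cx unfolding is_subfield_iff by blast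
  have lF: "set l \<subseteq> F'" using l(1) by (auto simp: univ_poly_def polynomial_def)
  let ?E = "finite_extension F l"
  have alg': "(algebraic over F) y" if "y \<in> set l" for y
    using alg that lF alg_over_iff[OF F] by blast
  have E: "subfield ?E ring_of_type_algebra" "finite_dimension F ?E"
    using finite_extension_is_subfield[OF FR C] finite_extension_finite_dimension(1)[OF FR C] alg' by blast+
  have "set l \<subseteq> ?E" using finite_extension_mem[OF subfieldE(1)[OF FR] C] by blast
  then have "l \<in> carrier (?E [X]\<^bsub>ring_of_type_algebra\<^esub>)"
    using l(1) by (auto simp: univ_poly_def polynomial_def)
  then have "(algebraic over ?E) x" using algebraicI l by blast
  then have "finite_dimension ?E (simple_extension ?E x)"
    using finite_dimension_simple_extension[OF E(1) Cx] by blast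
  then have "finite_dimension F (simple_extension ?E x)"
    using telescopic_base_dim(1)[OF FR E(1,2)] by blast
  then have "(algebraic over F) x"
    using finite_dimension_imp_algebraic[OF FR simple_extension_is_subring[OF subfieldE(1)[OF E(1)] Cx]]
      simple_extension_mem[OF subfieldE(1)[OF E(1)] Cx] by blast
  then show ?thesis using alg_over_iff[OF F] by simp
qed

lemma clear_denominators:
  fixes P :: "'l::field poly"
  assumes R: "0 \<in> R" "1 \<in> R" "\<And>a b. a \<in> R \<Longrightarrow> b \<in> R \<Longrightarrow> a * b \<in> R"
    and P: "\<And>i. \<exists>a\<in>R. \<exists>b\<in>R. b \<noteq> 0 \<and> poly.coeff P i = a / b"
  shows "\<exists>d\<in>R. d \<noteq> 0 \<and> (\<forall>i. poly.coeff P i * d \<in> R)"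
  using P
proof (induction P)
  case 0
  show ?case using R by (intro bexI[of _ 1]) auto
next
  case (pCons c P)
  obtain a b where ab: "a \<in> R" "b \<in> R" "b \<noteq> 0" "c = a / b"
    using pCons.prems[of 0] by auto
  obtain d where d: "d \<in> R" "d \<noteq> 0" "\<And>i. poly.coeff P i * d \<in> R"
    using pCons.IH pCons.prems[of "Suc i" for i] by auto
  show ?case
  proof (intro bexI[of _ "b * d"] conjI allI)
    fix i
    have "c * (b * d) = a * d" using ab by simp
    moreover have "poly.coeff P j * (b * d) = b * (poly.coeff P j * d)" for j by simp
    ultimately show "poly.coeff (pCons c P) i * (b * d) \<in> R"
      using R(3)[OF ab(1) d(1)] R(3)[OF ab(2) d(3)] by (cases i) (simp_all only: coeff_pCons_0 coeff_pCons_Suc)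
  qed (use ab d R in auto)
qed

text \<open>
  After clearing denominators, an equation for \<open>y\<close> over \<open>F(c)\<close> is a polynomial relation over \<open>F\<close>
  between \<open>c\<close> and \<open>y\<close>. It is read as an equation for \<open>c\<close>; since \<open>y\<close> is transcendental, a
  coefficient of the relation that is a nonzero polynomial in \<open>y\<close> does not vanish.
\<close>

lemma alg_over_exchange:
  assumes F: "is_subfield F" and y: "alg_over (ext F c) y" "\<not> alg_over F y"
  shows "alg_over (ext F y) c"
proof -
  obtain P where P: "P \<in> polys_over (ext F c)" "P \<noteq> 0" "poly P y = 0"
    using y(1) by (auto simp: alg_over_def)
  obtain d q where dq: "d \<in> polys_over F" "poly d c \<noteq> 0"
    "\<And>i. q i \<in> polys_over F" "\<And>i. poly.coeff P i * poly d c = poly (q i) c"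
  proof -
    note I = polys_over_intros[OF F]
    let ?R = "(\<lambda>q. poly q c) ` polys_over F"
    have "\<exists>d\<in>?R. d \<noteq> 0 \<and> (\<forall>i. poly.coeff P i * d \<in> ?R)"
    proof (rule clear_denominators)
      show "0 \<in> ?R" using I(1) by force
      show "1 \<in> ?R" using I(2) by force
      show "a * b \<in> ?R" if "a \<in> ?R" "b \<in> ?R" for a b
        using that I(10) by (force simp flip: poly_mult)
      show "\<exists>a\<in>?R. \<exists>b\<in>?R. b \<noteq> 0 \<and> poly.coeff P i = a / b" for i
        using polys_overD[OF P(1), of i] by (auto simp: ext_def)
    qed
    then obtain d where d: "d \<in> polys_over F" "poly d c \<noteq> 0"
      "\<forall>i. poly.coeff P i * poly d c \<in> ?R"
      by (elim bexE conjE imageE) simp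
    have "\<forall>i. \<exists>q. q \<in> polys_over F \<and> poly.coeff P i * poly d c = poly q c"
      using d(3) by blast
    from choice[OF this] d(1,2) show thesis using that by blast
  qed
  define n m where "n = degree P" and "m = Max ((\<lambda>i. degree (q i)) ` {..n})"
  have m: "degree (q i) \<le> m" if "i \<le> n" for i
    unfolding m_def using that by (intro Max_ge) auto
  have q: "poly (q i) c = (\<Sum>j\<le>m. coeff (q i) j * c ^ j)" if "i \<le> n" for i
    using arg_cong[OF poly_as_sum_of_monoms'[OF m[OF that]], of "\<lambda>p. poly p c"]
    by (simp add: poly_sum poly_monom)
  define R where "R = (\<Sum>j\<le>m. Polynomial.monom (\<Sum>i\<le>n. coeff (q i) j * y ^ i) j)"
  have "poly R c = (\<Sum>j\<le>m. \<Sum>i\<le>n. coeff (q i) j * c ^ j * y ^ i)"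
    by (simp add: R_def poly_sum poly_monom sum_distrib_right sum_distrib_left mult_ac)
  also have "\<dots> = (\<Sum>i\<le>n. poly (q i) c * y ^ i)"
    by (subst sum.swap) (simp add: q sum_distrib_right)
  also have "\<dots> = (\<Sum>i\<le>n. poly.coeff P i * y ^ i) * poly d c"
    by (simp add: dq(4)[symmetric] sum_distrib_right sum_distrib_left mult_ac)
  also have "\<dots> = 0" using P(3) by (simp add: poly_altdef n_def)
  finally have R0: "poly R c = 0" .
  have qF: "coeff (q i) j \<in> ext F y" for i j
    using dq(3) polys_overD ext_incl(1)[OF F] by blast
  have yF: "y \<in> ext F y" by (rule ext_incl(2)[OF F])
  have RF: "R \<in> polys_over (ext F y)"
    unfolding R_def using qF yF
    by (intro polys_over_intros[OF ext_subfield[OF F]] is_subfieldD[OF ext_subfield[OF F]])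
  have "coeff P n \<noteq> 0" using P(2) by (simp add: n_def)
  then have "poly (q n) c \<noteq> 0" using dq(2) dq(4)[of n] by (metis mult_eq_0_iff)
  then have "q n \<noteq> 0" by auto
  then obtain j where j: "coeff (q n) j \<noteq> 0" by (auto simp: poly_eq_iff)
  define S where "S = (\<Sum>i\<le>n. Polynomial.monom (coeff (q i) j) i)"
  have "coeff S n = coeff (q n) j" by (simp add: S_def coeff_sum coeff_monom)
  then have "S \<noteq> 0" using j by auto
  moreover have "S \<in> polys_over F"
    unfolding S_def using dq(3) polys_overD by (intro polys_over_intros[OF F]) blast
  ultimately have "poly S y \<noteq> 0" using y(2) by (auto simp: alg_over_def)
  moreover have "j \<le> m" using j m[of n] le_degree[of "q n" j] by simp
  then have "coeff R j = poly S y"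
    by (simp add: R_def S_def coeff_sum coeff_monom poly_sum poly_monom)
  ultimately have "R \<noteq> 0" by auto
  then show ?thesis using R0 RF by (auto simp: alg_over_def)
qed

definition indep :: "('a set \<Rightarrow> 'a set) \<Rightarrow> 'a set \<Rightarrow> bool" where
  "indep cl B \<longleftrightarrow> (\<forall>b\<in>B. b \<notin> cl (B - {b}))"

locale matroid_closure =
  fixes cl :: "'a set \<Rightarrow> 'a set"
  assumes cl_incl: "S \<subseteq> cl S"
    and cl_subset: "T \<subseteq> cl S \<Longrightarrow> cl T \<subseteq> cl S"
    and cl_exchange: "x \<in> cl (insert c S) \<Longrightarrow> x \<notin> cl S \<Longrightarrow> c \<in> cl (insert x S)"
begin

lemma cl_mono: "S \<subseteq> T \<Longrightarrow> cl S \<subseteq> cl T"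
  using cl_incl cl_subset by (meson order_trans)

text \<open>
  The elements of \<open>B\<close> are moved into the spanning set one at a time: a maximal part \<open>D\<close> of \<open>C\<close> that
  contains \<open>B \<inter> C\<close> and does not span \<open>b\<close> leaves out some \<open>c\<close>, and this \<open>c\<close> can be exchanged for \<open>b\<close>.
\<close>

lemma steinitz:
  assumes B: "indep cl B" "finite B" and C: "finite C" "B \<subseteq> cl C"
  shows "card B \<le> card C"
  using C
proof (induction "card (B - C)" arbitrary: C rule: less_induct)
  case less
  show ?case
  proof (cases "B \<subseteq> C")
    case True
    then show ?thesis using less.prems card_mono by blast
  next
    case False
    then obtain b where b: "b \<in> B" "b \<notin> C" by blast
    let ?\<D> = "{D. B \<inter> C \<subseteq> D \<and> D \<subseteq> C \<and> b \<notin> cl D}"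
    have "b \<notin> cl (B \<inter> C)"
      using B(1) b cl_mono[of "B \<inter> C" "B - {b}"] by (auto simp: indep_def)
    then have "B \<inter> C \<in> ?\<D>" by blast
    moreover have "finite ?\<D>" using less.prems(1) by simp
    ultimately have "\<exists>D\<in>?\<D>. B \<inter> C \<subseteq> D \<and> (\<forall>D'\<in>?\<D>. D \<subseteq> D' \<longrightarrow> D = D')"
      by (intro finite_has_maximal2)
    then obtain D where D: "D \<in> ?\<D>" and max: "\<forall>D'\<in>?\<D>. D \<subseteq> D' \<longrightarrow> D = D'"
      by (elim bexE conjE)
    have "D \<noteq> C" using D b less.prems(2) by blast
    then obtain c where c: "c \<in> C" "c \<notin> D" using D by blast
    have "b \<in> cl (insert c D)"
      using max[THEN bspec, of "insert c D"] D c by blast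
    then have cb: "c \<in> cl (insert b D)" using D cl_exchange by blast
    define C' where "C' = insert b (C - {c})"
    have "insert b D \<subseteq> C'" using D c by (auto simp: C'_def)
    then have "c \<in> cl C'" using cb cl_mono by blast
    then have "C \<subseteq> cl C'" using cl_incl[of C'] by (auto simp: C'_def)
    then have "B \<subseteq> cl C'" using less.prems(2) cl_subset by blast
    moreover have "c \<notin> B" using c D by blast
    then have "B - C' \<subset> B - C" using b by (auto simp: C'_def)
    then have "card (B - C') < card (B - C)" using B(2) by (simp add: psubset_card_mono)
    moreover have "finite C'" using less.prems by (simp add: C'_def)
    ultimately have "card B \<le> card C'" using less.hyps by blast
    also have "card C' = card C"
      using b c less.prems(1) card_Suc_Diff1[of C c] by (simp add: C'_def)
    finally show ?thesis .
  qed
qed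

lemma indep_if_spanning:
  assumes B: "indep cl B" "finite B" "B \<subseteq> cl C" and C: "finite C" "card C \<le> card B"
  shows "indep cl C" "card C = card B"
proof -
  show "card C = card B" using steinitz[OF B(1,2) C(1) B(3)] C(2) by simp
  show "indep cl C" unfolding indep_def
  proof (intro ballI notI)
    fix c assume c: "c \<in> C" "c \<in> cl (C - {c})"
    then have "C \<subseteq> cl (C - {c})" using cl_incl[of "C - {c}"] by blast
    then have "B \<subseteq> cl (C - {c})" using B(3) cl_subset by blast
    then have "card B \<le> card (C - {c})" using steinitz[OF B(1,2), of "C - {c}"] C(1) by blast
    then show False using c(1) C by (metis card_Diff1_less leD order_less_le_trans)
  qed
qed

end

definition acl :: "('k::field \<Rightarrow> 'l::field) \<Rightarrow> 'l set \<Rightarrow> 'l set" where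
  "acl h S = {x. alg_over (adjoin h S) x}"

lemma adjoin_subset_acl: "adjoin h S \<subseteq> acl h S"
  by (auto simp: acl_def intro: alg_over_self adjoin_subfield)

lemma acl_subfield: "is_subfield (acl h S)"
  unfolding acl_def by (rule subfield_algebraic[OF adjoin_subfield])

interpretation acl: matroid_closure "acl h" for h :: "'k::field \<Rightarrow> 'l::field"
proof
  show "S \<subseteq> acl h S" for S using adjoin_subset_acl[of h S] adjoin_incl[of S h] by blast
  show "acl h T \<subseteq> acl h S" if T: "T \<subseteq> acl h S" for S T
  proof
    fix x assume "x \<in> acl h T"
    moreover have "range h \<subseteq> acl h S" using adjoin_subset_acl[of h S] adjoin_base[of h] by blast
    then have "adjoin h T \<subseteq> acl h S"
      by (intro adjoin_least acl_subfield T)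
    ultimately show "x \<in> acl h S"
      using alg_over_trans[OF adjoin_subfield[of h S] adjoin_subfield[of h T], of x]
      unfolding acl_def by blast
  qed
  show "c \<in> acl h (insert x S)" if "x \<in> acl h (insert c S)" "x \<notin> acl h S" for x c S
    using that alg_over_exchange[OF adjoin_subfield] by (simp add: acl_def adjoin_insert)
qed

section \<open>Algebraic independence and algebraic dependence\<close>

lemma meval_in_subsemiring:
  assumes "0 \<in> R" "1 \<in> R" "\<And>a b. a \<in> R \<Longrightarrow> b \<in> R \<Longrightarrow> a + b \<in> R"
    "\<And>a b. a \<in> R \<Longrightarrow> b \<in> R \<Longrightarrow> a * b \<in> R"
    and "\<And>c. h c \<in> R" "\<And>v. v \<in> vars p \<Longrightarrow> f v \<in> R"
  shows "meval h f p \<in> R"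
proof -
  have sum: "sum g A \<in> R" if "\<And>a. a \<in> A \<Longrightarrow> g a \<in> R" for g A
    using that by (induction A rule: infinite_finite_induct) (auto simp: assms)
  have prod: "prod g A \<in> R" if "\<And>a. a \<in> A \<Longrightarrow> g a \<in> R" for g A
    using that by (induction A rule: infinite_finite_induct) (auto simp: assms)
  have pow: "a ^ n \<in> R" if "a \<in> R" for a n
    using that by (induction n) (auto simp: assms)
  show ?thesis unfolding meval.rep_eq
    by (intro sum assms(4,5) prod pow assms(6)) (auto simp: vars.rep_eq)
qed

lemma vars_Const [simp]: "vars (Const c) = {}"
  by transfer simp

lemma vars_Var [simp]: "vars (Var v :: ('v, 'k::zero_neq_one) mpoly) = {v}"
  by transfer simp

lemma vars_add: "vars (p + q) \<subseteq> vars p \<union> vars q"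
  unfolding vars.rep_eq plus_mpoly.rep_eq using keys_add[of "coeffs p" "coeffs q"] by blast

lemma vars_mult: "vars (p * q) \<subseteq> vars p \<union> vars (q :: ('v, 'k::comm_ring_1) mpoly)"
proof (transfer, intro subsetI)
  fix p q :: "('v \<Rightarrow>\<^sub>0 nat) \<Rightarrow>\<^sub>0 'k" and v
  assume "v \<in> (\<Union>m\<in>Poly_Mapping.keys (p * q). Poly_Mapping.keys m)"
  then obtain m where m: "m \<in> Poly_Mapping.keys (p * q)" "v \<in> Poly_Mapping.keys m" by blast
  then obtain a b where "m = a + b" "a \<in> Poly_Mapping.keys p" "b \<in> Poly_Mapping.keys q"
    using keys_mult[of p q] by blast
  then show "v \<in> (\<Union>m\<in>Poly_Mapping.keys p. Poly_Mapping.keys m) \<union>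
      (\<Union>m\<in>Poly_Mapping.keys q. Poly_Mapping.keys m)"
    using m(2) keys_add[of a b] by blast
qed

lemma vars_in_intros:
  fixes p q :: "('v, 'k::comm_ring_1) mpoly"
  shows "vars p \<subseteq> V \<Longrightarrow> vars q \<subseteq> V \<Longrightarrow> vars (p + q) \<subseteq> V"
    "vars p \<subseteq> V \<Longrightarrow> vars q \<subseteq> V \<Longrightarrow> vars (p * q) \<subseteq> V"
    "vars (0 :: ('v, 'k) mpoly) \<subseteq> V" "vars (1 :: ('v, 'k) mpoly) \<subseteq> V"
    "vars p \<subseteq> V \<Longrightarrow> vars (p ^ n) \<subseteq> V"
    "(\<And>a. a \<in> A \<Longrightarrow> vars (g a :: ('v, 'k) mpoly) \<subseteq> V) \<Longrightarrow> vars (sum g A) \<subseteq> V"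
proof -
  show a: "vars p \<subseteq> V \<Longrightarrow> vars q \<subseteq> V \<Longrightarrow> vars (p + q) \<subseteq> V"
    and m: "vars p \<subseteq> V \<Longrightarrow> vars q \<subseteq> V \<Longrightarrow> vars (p * q) \<subseteq> V" for p q :: "('v, 'k) mpoly"
    using vars_add[of p q] vars_mult[of p q] by blast+
  show 0: "vars (0 :: ('v, 'k) mpoly) \<subseteq> V" by transfer simp
  show 1: "vars (1 :: ('v, 'k) mpoly) \<subseteq> V" by transfer simp
  show "vars p \<subseteq> V \<Longrightarrow> vars (p ^ n) \<subseteq> V" by (induction n) (simp_all add: 1 m)
  show "(\<And>a. a \<in> A \<Longrightarrow> vars (g a :: ('v, 'k) mpoly) \<subseteq> V) \<Longrightarrow> vars (sum g A) \<subseteq> V"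
    using 0 a by (induction A rule: infinite_finite_induct) auto
qed

lemma adjoin_fraction:
  assumes h: "ring_hom_fun h" and x: "x \<in> adjoin h B"
  shows "\<exists>p q. vars p \<subseteq> B \<and> vars q \<subseteq> B \<and> meval h (\<lambda>b. b) q \<noteq> 0 \<and>
    x = meval h (\<lambda>b. b) p / meval h (\<lambda>b. b) q"
proof -
  let ?e = "meval h (\<lambda>b. b)"
  note e = ring_hom_funD[OF ring_hom_fun_meval[OF h, of "\<lambda>b. b"]]
  have eC: "?e (Const c) = h c" for c using ring_hom_funD[OF h] by simp
  have eV: "?e (Var b) = b" for b using ring_hom_funD[OF h] by simp
  define F where "F = {?e p / ?e q | p q. vars p \<subseteq> B \<and> vars q \<subseteq> B \<and> ?e q \<noteq> 0}"
  have I: "?e p / ?e q \<in> F" if "vars p \<subseteq> B" "vars q \<subseteq> B" "?e q \<noteq> 0" for p q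
    using that by (auto simp: F_def)
  have I1: "?e p \<in> F" if "vars p \<subseteq> B" for p
    using I[OF that vars_in_intros(4)] by (simp add: e)
  have "is_subfield F" unfolding is_subfield_def
  proof (intro conjI ballI)
    show "1 \<in> F" using I1[OF vars_in_intros(4)] by (simp add: e)
    fix y assume "y \<in> F"
    then obtain p q where y: "vars p \<subseteq> B" "vars q \<subseteq> B" "?e q \<noteq> 0" "y = ?e p / ?e q"
      by (auto simp: F_def)
    show "inverse y \<in> F"
      using I[OF y(2,1)] I1[OF vars_in_intros(3)] y(4) by (cases "?e p = 0") (auto simp: e)
    fix z assume "z \<in> F"
    then obtain r s where z: "vars r \<subseteq> B" "vars s \<subseteq> B" "?e s \<noteq> 0" "z = ?e r / ?e s"
      by (auto simp: F_def)
    have m1: "?e (Const (- 1)) = - 1"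
      unfolding eC using ring_hom_funD(1,2,4)[OF h] by (metis add.right_inverse add_eq_0_iff)
    have "?e (p * s + Const (- 1) * (r * q)) / ?e (q * s) \<in> F" "?e (p * r) / ?e (q * s) \<in> F"
      using y(1-3) z(1-3) by (intro I vars_in_intros; simp add: e)+
    moreover have "y - z = ?e (p * s + Const (- 1) * (r * q)) / ?e (q * s)"
      "y * z = ?e (p * r) / ?e (q * s)"
      using y(3) z(3) unfolding y(4) z(4) e m1 by (simp_all add: field_simps)
    ultimately show "y - z \<in> F" "y * z \<in> F" by simp_all
  qed
  moreover have "range h \<subseteq> F" using I1[of "Const c" for c] by (auto simp: eC)
  moreover have "B \<subseteq> F" using I1[of "Var b" for b] by (auto simp: eV)
  ultimately have "adjoin h B \<subseteq> F" by (rule adjoin_least)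
  then have "x \<in> F" using x by blast
  then show ?thesis unfolding F_def by (simp only: mem_Collect_eq) blast
qed

text \<open>
  The multivariate polynomial seen as a univariate one in the variable \<open>x\<close>, whose coefficients are
  polynomials in the remaining variables.
\<close>

definition as_poly_in :: "'v \<Rightarrow> ('v, 'k::comm_ring_1) mpoly \<Rightarrow> ('v, 'k) mpoly poly" where
  "as_poly_in x = meval (\<lambda>c. [:Const c:]) (\<lambda>w. if w = x then [:0, 1:] else [:Var w:])"

lemma ring_hom_fun_as_poly_in: "ring_hom_fun (as_poly_in x)"
  unfolding as_poly_in_def
  by (rule ring_hom_fun_meval)
    (use ring_hom_funD[OF ring_hom_fun_Const] in \<open>auto simp: ring_hom_fun_def one_pCons mult.commute\<close>)

lemma poly_as_poly_in: "poly (as_poly_in x p) (Var x) = p"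
proof -
  have "ring_hom_fun (\<lambda>P. poly P (Var x))" by (simp add: ring_hom_fun_def)
  note * = meval_hom_comp[OF this]
  have "poly (as_poly_in x p) (Var x) = meval Const (\<lambda>v. poly (if v = x then [:0, 1:] else [:Var v:]) (Var x)) p"
    unfolding as_poly_in_def * by simp
  also have "\<dots> = meval Const Var p" by (rule meval_cong) auto
  finally show ?thesis by simp
qed

lemma as_poly_in_const:
  assumes "x \<notin> vars p"
  shows "as_poly_in x p = [:p:]"
proof -
  have "as_poly_in x p = meval (\<lambda>c. [:Const c:]) (\<lambda>w. [:Var w:]) p"
    unfolding as_poly_in_def using assms by (intro meval_cong) auto
  also have "\<dots> = [:meval Const Var p:]"
    by (rule meval_hom_comp[symmetric]) (auto simp: ring_hom_fun_def one_pCons)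
  finally show ?thesis by simp
qed

lemma vars_coeff_as_poly_in: "vars (coeff (as_poly_in x p) i) \<subseteq> vars p - {x}"
proof -
  let ?R = "{P. \<forall>i. vars (poly.coeff P i) \<subseteq> vars p - {x}}"
  have "as_poly_in x p \<in> ?R" unfolding as_poly_in_def
    by (rule meval_in_subsemiring)
      (auto simp: coeff_pCons coeff_mult coeff_1 vars_in_intros split: nat.splits
        intro!: vars_in_intros)
  then show ?thesis by blast
qed

text \<open>
  An equation for \<open>b\<close> over the field generated by the other elements becomes, without denominators,
  a polynomial relation among the elements of \<open>B\<close>.
\<close>

theorem indep_if_algebraically_independent:
  assumes h: "ring_hom_fun h" and B: "algebraically_independent h B"
  shows "indep (acl h) B"
  unfolding indep_def
proof (intro ballI notI)
  fix b assume b: "b \<in> B" "b \<in> acl h (B - {b})"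
  let ?e = "meval h (\<lambda>b. b)"
  note e = ring_hom_funD[OF ring_hom_fun_meval[OF h, of "\<lambda>b. b"]]
  obtain P where P: "P \<in> polys_over (adjoin h (B - {b}))" "P \<noteq> 0" "poly P b = 0"
    using b(2) by (auto simp: acl_def alg_over_def)
  let ?R = "?e ` {q. vars q \<subseteq> B - {b}}"
  have "\<exists>d\<in>?R. d \<noteq> 0 \<and> (\<forall>i. poly.coeff P i * d \<in> ?R)"
  proof (rule clear_denominators)
    show "0 \<in> ?R" "1 \<in> ?R" using vars_in_intros(3,4) e(1,4) by (metis (lifting) imageI mem_Collect_eq)+
    show "a * c \<in> ?R" if "a \<in> ?R" "c \<in> ?R" for a c
    proof -
      from that obtain p q where "a = ?e p" "vars p \<subseteq> B - {b}" "c = ?e q" "vars q \<subseteq> B - {b}" by blast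
      then have "a * c = ?e (p * q)" "vars (p * q) \<subseteq> B - {b}"
        using vars_in_intros(2)[of p "B - {b}" q] by (simp_all only: e)
      then show ?thesis by blast
    qed
    show "\<exists>a\<in>?R. \<exists>c\<in>?R. c \<noteq> 0 \<and> poly.coeff P i = a / c" for i
      using adjoin_fraction[OF h polys_overD[OF P(1), of i]] by blast
  qed
  then obtain d where d: "d \<noteq> 0" "\<forall>i. \<exists>q. vars q \<subseteq> B - {b} \<and> poly.coeff P i * d = ?e q"
    by blast
  then obtain q where q: "\<And>i. vars (q i) \<subseteq> B - {b}" "\<And>i. poly.coeff P i * d = ?e (q i)"
    using choice[OF d(2)] by blast
  define n Q where "n = degree P" and "Q = (\<Sum>i\<le>n. q i * Var b ^ i)"
  have eV: "?e (Var b) = b" using ring_hom_funD[OF h] by simp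
  have qB: "vars (q i) \<subseteq> B" for i using q(1) by blast
  have "?e Q = (\<Sum>i\<le>n. poly.coeff P i * b ^ i) * d"
    by (simp add: Q_def e eV q(2)[symmetric] sum_distrib_left sum_distrib_right mult_ac)
  also have "\<dots> = 0" using P(3) by (simp add: poly_altdef n_def)
  finally have "Q = 0"
    using B b(1) unfolding algebraically_independent_def
    by (metis (no_types, lifting) Q_def qB vars_in_intros(2,5,6) vars_Var empty_subsetI insert_subset)
  note a = ring_hom_funD[OF ring_hom_fun_as_poly_in[of b]]
  have ab: "as_poly_in b (Var b :: ('b, 'a) mpoly) = [:0, 1:]"
    unfolding as_poly_in_def
    by (subst meval_Var) (simp_all add: ring_hom_funD[OF ring_hom_fun_Const] one_pCons)
  have "as_poly_in b (q i) = [:q i:]" for i using q(1) by (intro as_poly_in_const) blast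
  then have "as_poly_in b Q = (\<Sum>i\<le>n. Polynomial.monom (q i) i)"
    by (simp add: Q_def a ab monom_altdef)
  then have "(\<Sum>i\<le>n. Polynomial.monom (q i) i) = 0" using \<open>Q = 0\<close> a(4) by metis
  then have "coeff (\<Sum>i\<le>n. Polynomial.monom (q i) i) n = 0" by simp
  then have "q n = 0" by (simp add: coeff_sum coeff_monom)
  then have "coeff P n * d = 0" using q(2) e(4) by metis
  then show False using d(1) P(2) by (simp add: n_def)
qed

text \<open>
  Induction on \<open>B\<close>: a relation that involves the new element \<open>b\<close> is a univariate polynomial in \<open>b\<close>,
  which must be zero; its coefficients are relations among the old elements.
\<close>

theorem algebraically_independent_if_indep:
  assumes h: "ring_hom_fun h" and "finite B" "indep (acl h) B"
  shows "algebraically_independent h B"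
  using assms(2,3)
proof (induction B rule: finite_induct)
  case empty
  show ?case unfolding algebraically_independent_def
  proof (intro allI impI)
    fix p :: "('b, 'a) mpoly" assume p: "vars p \<subseteq> {}" "meval h (\<lambda>b. b) p = 0"
    have "p = meval Const Var p" by simp
    also have "\<dots> = meval Const (\<lambda>_. 0) p" using p(1) by (intro meval_cong) auto
    also have "\<dots> = Const (meval (\<lambda>c. c) (\<lambda>_. 0) p)"
      unfolding meval_hom_comp[OF ring_hom_fun_Const] ring_hom_funD(4)[OF ring_hom_fun_Const] ..
    finally obtain c where c: "p = Const c" by blast
    then have "h c = 0" using p(2) ring_hom_funD[OF h] by simp
    moreover have "h c * h (inverse c) = 1" if "c \<noteq> 0"
      using that ring_hom_funD(1,3)[OF h] by (metis right_inverse)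
    ultimately have "c = 0" by fastforce
    then show "p = 0" using c ring_hom_funD[OF ring_hom_fun_Const] by simp
  qed
next
  case (insert b B)
  let ?e = "meval h (\<lambda>b. b)"
  note e = ring_hom_funD[OF ring_hom_fun_meval[OF h, of "\<lambda>b. b"]]
  have "indep (acl h) B"
    unfolding indep_def
  proof (intro ballI notI)
    fix c assume "c \<in> B" "c \<in> acl h (B - {c})"
    moreover have "acl h (B - {c}) \<subseteq> acl h (insert b B - {c})" by (intro acl.cl_mono) auto
    ultimately show False using insert.prems by (auto simp: indep_def)
  qed
  then have B: "algebraically_independent h B" by (rule insert.IH)
  have "b \<notin> acl h (insert b B - {b})" using insert.prems by (auto simp: indep_def)
  then have b: "\<not> alg_over (adjoin h B) b" using insert.hyps by (simp add: acl_def)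
  show ?case unfolding algebraically_independent_def
  proof (intro allI impI)
    fix p :: "('b, 'a) mpoly" assume p: "vars p \<subseteq> insert b B" "?e p = 0"
    define Q where "Q = as_poly_in b p"
    define P where "P = (\<Sum>i\<le>degree Q. Polynomial.monom (?e (coeff Q i)) i)"
    have QB: "vars (coeff Q i) \<subseteq> B" for i
      using vars_coeff_as_poly_in[of b p i] p(1) by (auto simp: Q_def)
    have "?e (coeff Q i) \<in> adjoin h B" for i
      using QB[of i] adjoin_incl[of B h]
      by (intro meval_in_subsemiring adjoinD adjoin_base) auto
    then have "P \<in> polys_over (adjoin h B)"
      unfolding P_def by (intro polys_over_intros[OF adjoin_subfield])
    moreover have eV: "?e (Var b) = b" using ring_hom_funD[OF h] by simp
    have "?e p = ?e (poly Q (Var b))" by (simp add: Q_def poly_as_poly_in)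
    then have "poly P b = 0"
      using p(2) by (simp add: poly_altdef[of Q] e eV P_def poly_sum poly_monom)
    ultimately have "P = 0" using b by (auto simp: alg_over_def)
    have "coeff Q i = 0" for i
    proof (cases "i \<le> degree Q")
      case True
      then have "?e (coeff Q i) = poly.coeff P i" by (simp add: P_def coeff_sum coeff_monom)
      then show ?thesis using \<open>P = 0\<close> B QB[of i] by (auto simp: algebraically_independent_def)
    qed (simp add: coeff_eq_0)
    then have "Q = 0" by (simp add: poly_eq_iff)
    then show "p = 0" using poly_as_poly_in[of b p] by (simp add: Q_def)
  qed
qed

text \<open>
  This is the counting principle behind every independence claim below: as many elements as the
  transcendence degree are independent as soon as everything is algebraic over them.
\<close>

theorem independent_if_enough:
  assumes h: "ring_hom_fun h" and B: "algebraically_independent h B" "finite B" "B \<subseteq> acl h C"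
    and C: "finite C" "card C \<le> card B"
  shows "indep (acl h) C" "algebraically_independent h C" "card C = card B"
  using acl.indep_if_spanning[OF indep_if_algebraically_independent[OF h B(1)] B(2,3) C]
    algebraically_independent_if_indep[OF h C(1)] by blast+

section \<open>Fixed fields of finite automorphism groups\<close>

lemma field_hom:
  fixes \<sigma> :: "'l::field \<Rightarrow> 'm::field"
  assumes "ring_hom_fun \<sigma>"
  shows "\<sigma> (- x) = - \<sigma> x" "\<sigma> (x - y) = \<sigma> x - \<sigma> y" "\<sigma> (inverse x) = inverse (\<sigma> x)"
    "\<sigma> (x / y) = \<sigma> x / \<sigma> y" "\<sigma> x = 0 \<longleftrightarrow> x = 0" "\<sigma> x = \<sigma> y \<longleftrightarrow> x = y"
proof -
  note h = ring_hom_funD[OF assms]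
  show n: "\<sigma> (- x) = - \<sigma> x" for x
    using h(2)[of x "- x"] h(4) by (simp add: eq_neg_iff_add_eq_0 add.commute)
  show d: "\<sigma> (x - y) = \<sigma> x - \<sigma> y" for x y
    using h(2)[of x "- y"] n by simp
  have 1: "\<sigma> x * \<sigma> (inverse x) = 1" if "x \<noteq> 0" for x
    using that by (simp add: h(1) flip: h(3))
  show z: "\<sigma> x = 0 \<longleftrightarrow> x = 0" for x
    using 1[of x] h(4) by (metis mult_zero_left zero_neq_one)
  show i: "\<sigma> (inverse x) = inverse (\<sigma> x)" for x
    using 1[of x] h(4) by (cases "x = 0") (auto intro: inverse_unique[symmetric])
  show "\<sigma> (x / y) = \<sigma> x / \<sigma> y" by (simp add: divide_inverse h(3) i)
  show "\<sigma> x = \<sigma> y \<longleftrightarrow> x = y" using z[of "x - y"] d by simp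
qed

lemma hom_poly:
  assumes "ring_hom_fun \<sigma>"
  shows "\<sigma> (poly p x) = poly (map_poly \<sigma> p) (\<sigma> x)"
proof -
  note h = ring_hom_funD[OF assms]
  show ?thesis
    by (induction p) (simp_all add: h map_poly_pCons)
qed

lemma ring_hom_fun_map_poly:
  assumes "ring_hom_fun \<sigma>"
  shows "ring_hom_fun (map_poly \<sigma>)"
proof -
  note h = ring_hom_funD[OF assms]
  show ?thesis unfolding ring_hom_fun_def
    by (intro conjI allI poly_eqI)
      (simp_all add: coeff_map_poly h coeff_mult coeff_1 of_bool_def)
qed

lemma poly_over_division:
  assumes F: "is_subfield F" and f: "f \<in> polys_over F" "f \<noteq> 0" and p: "p \<in> polys_over F"
  shows "\<exists>q\<in>polys_over F. \<exists>r\<in>polys_over F. p = f * q + r \<and> (r = 0 \<or> degree r < degree f)"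
  using p
proof (induction "degree p" arbitrary: p rule: less_induct)
  case less
  note I = polys_over_intros[OF F]
  show ?case
  proof (cases "p = 0 \<or> degree p < degree f")
    case True
    then show ?thesis using less.prems I(1) by (intro bexI[of _ 0] bexI[of _ p]) auto
  next
    case False
    define c where "c = lead_coeff p / lead_coeff f"
    define m where "m = Polynomial.monom c (degree p - degree f)"
    have "c \<in> F" unfolding c_def
      by (intro is_subfieldD[OF F] polys_overD less.prems f(1))
    then have m: "m \<in> polys_over F" unfolding m_def by (rule I)
    have c0: "c \<noteq> 0" using False f(2) by (simp add: c_def)
    define p' where "p' = p - f * m"
    have p': "p' \<in> polys_over F" unfolding p'_def by (intro I m f less.prems)
    have dm: "degree (f * m) = degree p"
      using False c0 f(2) by (simp add: degree_mult_eq m_def degree_monom_eq)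
    have "lead_coeff (f * m) = lead_coeff p"
      using f(2) c0 by (simp add: lead_coeff_mult m_def degree_monom_eq c_def)
    then have "poly.coeff p' (degree p) = 0" using dm by (simp add: p'_def)
    moreover have "degree p' \<le> degree p" unfolding p'_def using dm by (intro degree_diff_le) auto
    ultimately have "p' = 0 \<or> degree p' < degree p"
      using leading_coeff_0_iff[of p'] by (metis le_neq_implies_less)
    then have "\<exists>q\<in>polys_over F. \<exists>r\<in>polys_over F. p' = f * q + r \<and> (r = 0 \<or> degree r < degree f)"
    proof
      assume "p' = 0"
      then show ?thesis using I(1) by (intro bexI[of _ 0]) auto
    next
      assume "degree p' < degree p"
      then show ?thesis using less.hyps p' by blast
    qed
    then obtain q r where "q \<in> polys_over F" "r \<in> polys_over F" "p' = f * q + r"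
      "r = 0 \<or> degree r < degree f" by blast
    moreover from this have "p = f * (q + m) + r"
      unfolding p'_def diff_eq_eq by (simp add: distrib_left)
    ultimately show ?thesis using I(5)[OF _ m] by blast
  qed
qed

locale automorphism_group =
  fixes \<Gamma> :: "('l::field \<Rightarrow> 'l) set"
  assumes finite: "finite \<Gamma>"
    and id_in: "(\<lambda>x. x) \<in> \<Gamma>"
    and hom: "\<sigma> \<in> \<Gamma> \<Longrightarrow> ring_hom_fun \<sigma>"
    and comp: "\<sigma> \<in> \<Gamma> \<Longrightarrow> \<tau> \<in> \<Gamma> \<Longrightarrow> (\<lambda>x. \<sigma> (\<tau> x)) \<in> \<Gamma>"
begin

definition Fix :: "'l set \<Rightarrow> 'l set" where
  "Fix F = {x \<in> F. \<forall>\<sigma>\<in>\<Gamma>. \<sigma> x = x}"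

definition stable :: "'l set \<Rightarrow> bool" where
  "stable R \<longleftrightarrow> (\<forall>\<sigma>\<in>\<Gamma>. \<forall>x\<in>R. \<sigma> x \<in> R)"

lemma bij_left_comp:
  assumes "\<tau> \<in> \<Gamma>"
  shows "bij_betw (\<lambda>\<sigma> x. \<tau> (\<sigma> x)) \<Gamma> \<Gamma>"
proof -
  have "inj_on (\<lambda>\<sigma> x. \<tau> (\<sigma> x)) \<Gamma>"
    using field_hom(6)[OF hom[OF assms]] by (auto simp: inj_on_def fun_eq_iff)
  moreover have "(\<lambda>\<sigma> x. \<tau> (\<sigma> x)) ` \<Gamma> \<subseteq> \<Gamma>" using comp[OF assms] by blast
  ultimately show ?thesis using endo_inj_surj[OF finite] by (simp add: bij_betw_def)
qed

lemma inverse_in: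
  assumes "\<sigma> \<in> \<Gamma>"
  shows "\<exists>\<tau>\<in>\<Gamma>. \<forall>x. \<tau> (\<sigma> x) = x"
proof -
  obtain \<tau> where \<tau>: "\<tau> \<in> \<Gamma>" "(\<lambda>x. \<sigma> (\<tau> x)) = (\<lambda>x. x)"
    using bij_left_comp[OF assms] id_in unfolding bij_betw_def by (metis (no_types, lifting) imageE)
  have "\<tau> (\<sigma> x) = x" for x
    using fun_cong[OF \<tau>(2), of "\<sigma> x"] field_hom(6)[OF hom[OF assms]] by simp
  then show ?thesis using \<tau>(1) by blast
qed

lemma prod_orbit_fixed:
  fixes g :: "'l \<Rightarrow> 'b::comm_monoid_mult"
  assumes "\<tau> \<in> \<Gamma>"
  shows "(\<Prod>\<sigma>\<in>\<Gamma>. g (\<tau> (\<sigma> x))) = (\<Prod>\<sigma>\<in>\<Gamma>. g (\<sigma> x))"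
  using prod.reindex_bij_betw[OF bij_left_comp[OF assms], of "\<lambda>\<sigma>. g (\<sigma> x)"] by simp

lemma Fix_subfield:
  assumes "is_subfield F"
  shows "is_subfield (Fix F)"
proof -
  have "\<sigma> 1 = 1 \<and> \<sigma> (x - y) = x - y \<and> \<sigma> (x * y) = x * y \<and> \<sigma> (inverse x) = inverse x"
    if \<sigma>: "\<sigma> \<in> \<Gamma>" and xy: "x \<in> Fix F" "y \<in> Fix F" for \<sigma> x y
  proof -
    have "\<sigma> x = x" "\<sigma> y = y" using \<sigma> xy unfolding Fix_def by blast+
    then show ?thesis
      using field_hom(2,3)[OF hom[OF \<sigma>]] ring_hom_funD(1,3)[OF hom[OF \<sigma>]] by simp
  qed
  then have *: "\<sigma> 1 = 1" "\<sigma> (x - y) = x - y" "\<sigma> (x * y) = x * y" "\<sigma> (inverse x) = inverse x"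
    if "\<sigma> \<in> \<Gamma>" "x \<in> Fix F" "y \<in> Fix F" for \<sigma> x y
    using that by blast+
  have D: "x \<in> F" if "x \<in> Fix F" for x using that by (simp add: Fix_def)
  have I: "x \<in> Fix F" if "x \<in> F" "\<And>\<sigma>. \<sigma> \<in> \<Gamma> \<Longrightarrow> \<sigma> x = x" for x
    using that by (simp add: Fix_def)
  show ?thesis
    unfolding is_subfield_def
  proof (intro conjI ballI)
    show "1 \<in> Fix F" using ring_hom_funD(1)[OF hom] is_subfieldD(1)[OF assms] by (intro I)
  next
    fix x y assume xy: "x \<in> Fix F" "y \<in> Fix F"
    show "x - y \<in> Fix F" using is_subfieldD(3)[OF assms D D, OF xy] *(2)[OF _ xy] by (rule I)
    show "x * y \<in> Fix F" using is_subfieldD(6)[OF assms D D, OF xy] *(3)[OF _ xy] by (rule I)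
  next
    fix x assume x: "x \<in> Fix F"
    show "inverse x \<in> Fix F" using is_subfieldD(7)[OF assms D, OF x] *(4)[OF _ x x] by (rule I)
  qed
qed

text \<open>
  Numerator and denominator are multiplied by the nontrivial conjugates of the denominator. The
  denominator is then a norm, hence fixed, and so the numerator is fixed as well.
\<close>

lemma fixed_fraction:
  assumes R: "1 \<in> R" "\<And>a b. a \<in> R \<Longrightarrow> b \<in> R \<Longrightarrow> a * b \<in> R" "stable R"
    and ab: "a \<in> R" "b \<in> R" "b \<noteq> 0" "\<And>\<sigma>. \<sigma> \<in> \<Gamma> \<Longrightarrow> \<sigma> (a / b) = a / b"
  shows "\<exists>a'\<in>Fix R. \<exists>b'\<in>Fix R. b' \<noteq> 0 \<and> a / b = a' / b'"
proof -
  define N where "N = (\<Prod>\<sigma>\<in>\<Gamma>. \<sigma> b)"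
  have prod: "prod g A \<in> R" if "\<And>a. a \<in> A \<Longrightarrow> g a \<in> R" for g and A :: "('l \<Rightarrow> 'l) set"
    using that by (induction A rule: infinite_finite_induct) (auto simp: R)
  have \<sigma>b: "\<sigma> b \<in> R" if "\<sigma> \<in> \<Gamma>" for \<sigma> using R(3) ab(2) that by (auto simp: stable_def)
  have N0: "N \<noteq> 0"
    using finite ab(3) field_hom(5)[OF hom] by (auto simp: N_def)
  have N: "\<tau> N = N" if "\<tau> \<in> \<Gamma>" for \<tau>
    unfolding N_def ring_hom_funD(7)[OF hom[OF that]]
    using prod_orbit_fixed[OF that, of "\<lambda>x. x" b] by simp
  have "N = b * (\<Prod>\<sigma>\<in>\<Gamma> - {\<lambda>x. x}. \<sigma> b)"
    unfolding N_def by (rule prod.remove[OF finite id_in])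
  then have "a / b * N = a * (\<Prod>\<sigma>\<in>\<Gamma> - {\<lambda>x. x}. \<sigma> b)" using ab(3) by simp
  also have "\<dots> \<in> R" using \<sigma>b by (intro R ab prod) auto
  finally have "a / b * N \<in> R" .
  moreover have "\<tau> (a / b * N) = a / b * N" if "\<tau> \<in> \<Gamma>" for \<tau>
    by (simp only: ab(4)[OF that] N[OF that] ring_hom_funD(3)[OF hom[OF that]])
  moreover have "N \<in> R" unfolding N_def using \<sigma>b by (intro prod)
  ultimately show ?thesis
    using N N0 by (intro bexI[of _ "a / b * N"] bexI[of _ N]) (auto simp: Fix_def)
qed

text \<open>
  The product of the factors \<open>T - \<sigma> x\<close> has fixed coefficients and the root \<open>x\<close>.
\<close>

lemma alg_over_Fix:
  assumes F: "is_subfield F" "stable F" and x: "x \<in> F"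
  shows "alg_over (Fix F) x"
proof -
  define P where "P = (\<Prod>\<sigma>\<in>\<Gamma>. [:- \<sigma> x, 1:])"
  have "P \<in> polys_over F" unfolding P_def using F(2) x
    by (intro polys_over_intros[OF F(1)] is_subfieldD[OF F(1)]) (auto simp: stable_def)
  moreover have "map_poly \<tau> P = P" if "\<tau> \<in> \<Gamma>" for \<tau>
  proof -
    note h = ring_hom_funD[OF hom[OF that]] field_hom[OF hom[OF that]]
    have "map_poly \<tau> P = (\<Prod>\<sigma>\<in>\<Gamma>. [:- \<tau> (\<sigma> x), 1:])"
      unfolding P_def ring_hom_funD(7)[OF ring_hom_fun_map_poly[OF hom[OF that]]]
      by (simp add: map_poly_pCons h)
    then show ?thesis unfolding P_def
      using prod_orbit_fixed[OF that, of "\<lambda>y. [:- y, 1:]" x] by simp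
  qed
  then have "\<tau> (poly.coeff P i) = poly.coeff P i" if "\<tau> \<in> \<Gamma>" for \<tau> i
    using that coeff_map_poly[of \<tau> P i] ring_hom_funD(4)[OF hom[OF that]] by simp
  ultimately have "P \<in> polys_over (Fix F)" by (auto simp: polys_over_def Fix_def)
  moreover have "P \<noteq> 0" using finite by (simp add: P_def)
  moreover have "poly P x = 0" using finite id_in by (auto simp: P_def poly_prod)
  ultimately show ?thesis by (auto simp: alg_over_def)
qed

text \<open>
  The group acts on \<open>F[x]\<close> and preserves degrees. Let \<open>f\<close> be an invariant polynomial of minimal
  positive degree; one exists, because the norm of \<open>x\<close> is invariant. Division by \<open>f\<close> is unique, so
  quotient and remainder of an invariant polynomial are invariant, and by minimality the remainder
  is a constant. Hence all invariant polynomials are polynomials in \<open>f\<close> over the fixed field of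
  \<open>F\<close>, and the invariant rational functions are quotients of such. This is Miyata's theorem.
\<close>

theorem Fix_affine_extension:
  assumes F: "is_subfield F" "stable F" and x: "\<not> alg_over F x"
    and aff: "\<And>\<sigma>. \<sigma> \<in> \<Gamma> \<Longrightarrow> \<exists>\<alpha>\<in>F. \<exists>\<beta>\<in>F. \<sigma> x = \<alpha> * x + \<beta>"
  shows "\<exists>f. Fix (ext F x) = ext (Fix F) f"
proof -
  note I = polys_over_intros[OF F(1)]
  have unique: "p = q" if "p \<in> polys_over F" "q \<in> polys_over F" "poly p x = poly q x" for p q
  proof -
    have "poly (p - q) x = 0" "p - q \<in> polys_over F" using that I by auto
    then show ?thesis using x by (auto simp: alg_over_def)
  qed
  have act: "\<exists>q\<in>polys_over F. \<sigma> (poly p x) = poly q x \<and> degree q = degree p"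
    if \<sigma>: "\<sigma> \<in> \<Gamma>" and p: "p \<in> polys_over F" for \<sigma> p
  proof -
    note h = ring_hom_funD[OF hom[OF \<sigma>]] field_hom[OF hom[OF \<sigma>]]
    obtain \<alpha> \<beta> where ab: "\<alpha> \<in> F" "\<beta> \<in> F" "\<sigma> x = \<alpha> * x + \<beta>" using aff[OF \<sigma>] by blast
    have "\<alpha> \<noteq> 0"
    proof
      assume "\<alpha> = 0"
      then have "\<sigma> x \<in> F" using ab by simp
      moreover obtain \<tau> where \<tau>: "\<tau> \<in> \<Gamma>" "\<tau> (\<sigma> x) = x" using inverse_in[OF \<sigma>] by blast
      ultimately have "x \<in> F" using F(2) unfolding stable_def by metis
      then show False using x alg_over_self[OF F(1)] by blast
    qed
    define q where "q = pcompose (map_poly \<sigma> p) [:\<beta>, \<alpha>:]"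
    have "map_poly \<sigma> p \<in> polys_over F"
      using p F(2) \<sigma> by (auto simp: polys_over_def coeff_map_poly h stable_def)
    then have "q \<in> polys_over F" unfolding q_def using ab(1,2) I(1)
      by (intro I(14) I(4))
    moreover have "\<sigma> (poly p x) = poly q x"
      unfolding hom_poly[OF hom[OF \<sigma>]] by (simp add: q_def poly_pcompose ab(3) add.commute mult.commute)
    moreover have "degree (map_poly \<sigma> p) = degree p"
      by (cases "p = 0") (auto intro!: map_poly_degree_eq simp: h)
    then have "degree q = degree p"
      using \<open>\<alpha> \<noteq> 0\<close> by (simp add: q_def degree_pcompose)
    ultimately show ?thesis by blast
  qed
  define invariant where "invariant p \<longleftrightarrow> p \<in> polys_over F \<and> (\<forall>\<sigma>\<in>\<Gamma>. \<sigma> (poly p x) = poly p x)" for p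
  \<comment> \<open>the norm of x is an invariant of positive degree\<close>
  have "\<exists>p. invariant p \<and> degree p > 0"
  proof -
    have "[:0, 1:] \<in> polys_over F" by (intro I is_subfieldD[OF F(1)])
    then have "\<exists>q\<in>polys_over F. \<sigma> x = poly q x \<and> degree q = 1" if "\<sigma> \<in> \<Gamma>" for \<sigma>
      using act[OF that, of "[:0, 1:]"] by simp
    then have "\<forall>\<sigma>\<in>\<Gamma>. \<exists>q. q \<in> polys_over F \<and> \<sigma> x = poly q x \<and> degree q = 1" by blast
    from bchoice[OF this] obtain q where q: "\<And>\<sigma>. \<sigma> \<in> \<Gamma> \<Longrightarrow> q \<sigma> \<in> polys_over F"
      "\<And>\<sigma>. \<sigma> \<in> \<Gamma> \<Longrightarrow> \<sigma> x = poly (q \<sigma>) x" "\<And>\<sigma>. \<sigma> \<in> \<Gamma> \<Longrightarrow> degree (q \<sigma>) = 1"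
      by blast
    define N where "N = (\<Prod>\<sigma>\<in>\<Gamma>. q \<sigma>)"
    have N: "poly N x = (\<Prod>\<sigma>\<in>\<Gamma>. \<sigma> x)" using q(2) by (simp add: N_def poly_prod)
    have "\<tau> (poly N x) = poly N x" if "\<tau> \<in> \<Gamma>" for \<tau>
      unfolding N ring_hom_funD(7)[OF hom[OF that]]
      using prod_orbit_fixed[OF that, of "\<lambda>x. x" x] by simp
    moreover have "N \<in> polys_over F" unfolding N_def using q(1) by (intro I)
    ultimately have "invariant N" by (auto simp: invariant_def)
    have "q \<sigma> \<noteq> 0" if "\<sigma> \<in> \<Gamma>" for \<sigma> using q(3)[OF that] by auto
    then have "degree N = (\<Sum>\<sigma>\<in>\<Gamma>. degree (q \<sigma>))"
      unfolding N_def by (intro degree_prod_eq_sum_degree) auto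
    also have "\<dots> = card \<Gamma>" using q(3) by simp
    also have "\<dots> > 0" using finite id_in card_gt_0_iff by blast
    finally show ?thesis using \<open>invariant N\<close> by blast
  qed
  then obtain f where f: "invariant f" "degree f > 0"
    and min: "\<And>p. invariant p \<Longrightarrow> degree p > 0 \<Longrightarrow> degree f \<le> degree p"
    using ex_has_least_nat[of "\<lambda>p. invariant p \<and> degree p > 0" _ degree] by blast
  have fF: "f \<in> polys_over F" "f \<noteq> 0" using f by (auto simp: invariant_def)
  let ?E = "ext (Fix F) (poly f x)"
  have E: "is_subfield ?E" by (intro ext_subfield Fix_subfield F)
  have const: "poly p x \<in> ?E" if p: "invariant p" "degree p = 0" for p
  proof -
    obtain c where c: "p = [:c:]" using p(2) degree_eq_zeroE by blast
    then have "c \<in> Fix F" using p(1) polys_overD[of p F 0] by (auto simp: invariant_def Fix_def)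
    then show ?thesis using c ext_incl(1)[OF Fix_subfield[OF F(1)]] by auto
  qed
  have gen: "poly p x \<in> ?E" if "invariant p" for p
    using that
  proof (induction "degree p" arbitrary: p rule: less_induct)
    case less
    show ?case
    proof (cases "degree p = 0")
      case True
      then show ?thesis using const less.prems by blast
    next
      case False
      then have fp: "degree f \<le> degree p" using min less.prems by blast
      obtain q r where qr: "q \<in> polys_over F" "r \<in> polys_over F" "p = f * q + r"
        "r = 0 \<or> degree r < degree f"
        using poly_over_division[OF F(1) fF, of p] less.prems by (auto simp: invariant_def)
      have qr_inv: "\<sigma> (poly q x) = poly q x \<and> \<sigma> (poly r x) = poly r x" if \<sigma>: "\<sigma> \<in> \<Gamma>" for \<sigma>
      proof -
        note h = ring_hom_funD[OF hom[OF \<sigma>]]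
        obtain q' where q': "q' \<in> polys_over F" "\<sigma> (poly q x) = poly q' x"
          using act[OF \<sigma> qr(1)] by blast
        obtain r' where r': "r' \<in> polys_over F" "\<sigma> (poly r x) = poly r' x" "degree r' = degree r"
          using act[OF \<sigma> qr(2)] by blast
        have "\<sigma> (poly f x) = poly f x" "\<sigma> (poly p x) = poly p x"
          using f(1) less.prems \<sigma> by (auto simp: invariant_def)
        then have "poly (f * q' + r') x = poly p x"
          using q'(2) r'(2) unfolding qr(3) by (simp add: h)
        then have eq: "f * q' + r' = f * q + r"
          using less.prems qr q' r' fF unfolding invariant_def
          by (intro unique) (auto intro!: I(5,10))
        have "q' = q"
        proof (rule ccontr)
          assume "q' \<noteq> q"
          then have "degree f \<le> degree (f * (q' - q))" using fF(2) by (simp add: degree_mult_eq)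
          also have "f * (q' - q) = r - r'" using eq by (simp add: algebra_simps)
          also have "degree (r - r') < degree f"
            using qr(4) r'(3) f(2) by (intro degree_diff_less) auto
          finally show False by simp
        qed
        then show ?thesis using eq q' r' by auto
      qed
      have "invariant q" "invariant r" using qr qr_inv by (auto simp: invariant_def)
      have "degree q < degree p"
      proof (cases "q = 0")
        case False
        then have "degree (f * q) = degree f + degree q" using fF(2) by (simp add: degree_mult_eq)
        moreover have "degree p = degree (f * q)"
        proof (cases "r = 0")
          case False
          then have "degree r < degree (f * q)" using qr(4) calculation by simp
          then show ?thesis unfolding qr(3) by (rule degree_add_eq_left)
        qed (simp add: qr(3))
        ultimately show ?thesis using f(2) by simp
      qed (use False in auto)
      then have "poly q x \<in> ?E" using less.hyps \<open>invariant q\<close> by blast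
      moreover have "poly r x \<in> ?E"
      proof -
        have "degree r < degree f" using qr(4) f(2) by auto
        then have "degree r = 0" using min[OF \<open>invariant r\<close>] by force
        then show ?thesis using const \<open>invariant r\<close> by blast
      qed
      ultimately show ?thesis
        unfolding qr(3) using ext_incl(2)[OF Fix_subfield[OF F(1)], of "poly f x"]
        by (simp add: is_subfieldD[OF E])
    qed
  qed
  let ?R = "(\<lambda>p. poly p x) ` polys_over F"
  have "stable ?R" using act by (fastforce simp: stable_def)
  have "Fix (ext F x) \<subseteq> ?E"
  proof
    fix y assume y: "y \<in> Fix (ext F x)"
    then obtain p q where pq: "p \<in> polys_over F" "q \<in> polys_over F" "poly q x \<noteq> 0"
      "y = poly p x / poly q x" by (auto simp: Fix_def ext_def)
    have "\<exists>a'\<in>Fix ?R. \<exists>b'\<in>Fix ?R. b' \<noteq> 0 \<and> poly p x / poly q x = a' / b'"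
    proof (rule fixed_fraction)
      show "1 \<in> ?R" using I(2) by force
      show "a * b \<in> ?R" if "a \<in> ?R" "b \<in> ?R" for a b
        using that I(10) by (force simp flip: poly_mult)
      show "\<sigma> (poly p x / poly q x) = poly p x / poly q x" if "\<sigma> \<in> \<Gamma>" for \<sigma>
        using y that by (simp add: Fix_def pq(4))
    qed (use pq \<open>stable ?R\<close> in auto)
    then obtain a' b' where "a' \<in> Fix ?R" "b' \<in> Fix ?R" "y = a' / b'" unfolding pq(4) by blast
    moreover have "Fix ?R \<subseteq> ?E" using gen by (auto simp: Fix_def invariant_def)
    ultimately show "y \<in> ?E" using is_subfieldD(8)[OF E] by blast
  qed
  moreover have "?E \<subseteq> Fix (ext F x)"
  proof (intro ext_least Fix_subfield ext_subfield F)
    show "Fix F \<subseteq> Fix (ext F x)" using ext_incl(1)[OF F(1)] by (auto simp: Fix_def)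
    have "poly f x \<in> ext F x"
      using polys_over_mono[OF ext_incl(1)[OF F(1)], of x] fF(1)
      by (intro poly_in_subfield[OF ext_subfield[OF F(1)]] ext_incl(2)[OF F(1)]) blast
    then show "poly f x \<in> Fix (ext F x)" using f(1) by (auto simp: Fix_def invariant_def)
  qed
  ultimately show ?thesis by blast
qed

end

lemma root_of_unity_sum:
  fixes z :: "'l::field"
  assumes "z ^ n = 1" "z \<noteq> 1"
  shows "(\<Sum>j<n. z ^ j) = 0"
  using geometric_sum[OF assms(2), of n] assms(1) by simp

lemma primitive_root_pow_eq_1:
  assumes "primitive_root_of_unity n z" "z ^ i = 1"
  shows "n dvd i"
proof -
  have n: "n > 0" "z ^ n = 1" "\<And>m. 0 < m \<Longrightarrow> m < n \<Longrightarrow> z ^ m \<noteq> 1"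
    using assms(1) by (auto simp: primitive_root_of_unity_def)
  have "z ^ i = z ^ (i mod n) * (z ^ n) ^ (i div n)"
    by (metis mod_mult_div_eq power_add power_mult)
  then have "z ^ (i mod n) = 1" using n assms(2) by simp
  then show ?thesis using n by (metis mod_greater_zero_iff_not_dvd mod_less_divisor)
qed

text \<open>
  The map \<open>\<sigma>\<close> multiplies \<open>\<alpha>\<^sup>i\<close> by \<open>\<zeta>\<^sup>i\<close>. Averaging over the powers of \<open>\<sigma>\<close> therefore kills all powers of
  \<open>\<alpha>\<close> except those of \<open>\<alpha>\<^sup>n\<close>, which lie in \<open>F\<close>. This settles polynomials in \<open>\<alpha>\<close>; a fraction is
  reduced to them by making the denominator a norm.
\<close>

theorem Kummer_fixed:
  fixes \<sigma> :: "'l::field \<Rightarrow> 'l"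
  assumes \<sigma>: "ring_hom_fun \<sigma>" and F: "is_subfield F" "\<And>c. c \<in> F \<Longrightarrow> \<sigma> c = c"
    and \<zeta>: "\<zeta> \<in> F" "primitive_root_of_unity n \<zeta>" "of_nat n \<noteq> (0::'l)"
    and \<alpha>: "\<sigma> \<alpha> = \<zeta> * \<alpha>" "\<alpha> ^ n \<in> F"
    and x: "x \<in> ext F \<alpha>" "\<sigma> x = x"
  shows "x \<in> F"
proof -
  note I = polys_over_intros[OF F(1)] and D = is_subfieldD[OF F(1)]
  note h = ring_hom_funD[OF \<sigma>] field_hom[OF \<sigma>]
  have \<zeta>n: "n > 0" "\<zeta> ^ n = 1" using \<zeta>(2) by (auto simp: primitive_root_of_unity_def)
  let ?R = "(\<lambda>p. poly p \<alpha>) ` polys_over F"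
  have \<sigma>\<alpha>: "(\<sigma> ^^ j) (poly p \<alpha>) = poly p (\<zeta> ^ j * \<alpha>)" if "p \<in> polys_over F" for p j
  proof (induction j)
    case (Suc j)
    have "map_poly \<sigma> p = p"
      using polys_overD[OF that] F(2) by (intro poly_eqI) (simp add: coeff_map_poly h)
    then show ?case using Suc by (simp add: hom_poly[OF \<sigma>] h F(2)[OF \<zeta>(1)] \<alpha>(1) mult_ac)
  qed simp
  have R: "d \<in> F" if d: "d \<in> ?R" "\<sigma> d = d" for d
  proof -
    obtain p where p: "p \<in> polys_over F" "d = poly p \<alpha>" using d(1) by blast
    have "(\<sigma> ^^ j) d = d" for j using d(2) by (induction j) auto
    then have "of_nat n * d = (\<Sum>j<n. (\<sigma> ^^ j) d)" by simp
    also have "\<dots> = (\<Sum>j<n. \<Sum>i\<le>degree p. poly.coeff p i * (\<zeta> ^ j * \<alpha>) ^ i)"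
      unfolding p(2) using \<sigma>\<alpha>[OF p(1)] by (simp add: poly_altdef)
    also have "\<dots> = (\<Sum>i\<le>degree p. poly.coeff p i * (\<alpha> ^ i * (\<Sum>j<n. (\<zeta> ^ i) ^ j)))"
      by (subst sum.swap) (simp add: sum_distrib_left power_mult_distrib mult_ac flip: power_mult)
    also have "\<dots> \<in> F"
    proof (intro D(10) D(6)[OF polys_overD[OF p(1)]])
      fix i
      show "\<alpha> ^ i * (\<Sum>j<n. (\<zeta> ^ i) ^ j) \<in> F"
      proof (cases "\<zeta> ^ i = 1")
        case True
        then obtain k where "i = n * k" using primitive_root_pow_eq_1[OF \<zeta>(2)] by (auto simp: dvd_def)
        then have "\<alpha> ^ i \<in> F" using D(9)[OF \<alpha>(2)] by (simp add: power_mult)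
        then show ?thesis using True D(6,12) by simp
      next
        case False
        moreover have "(\<zeta> ^ i) ^ n = 1" using \<zeta>n(2) by (metis power_mult mult.commute power_one)
        ultimately have "(\<Sum>j<n. (\<zeta> ^ i) ^ j) = 0" by (intro root_of_unity_sum)
        then show ?thesis using D(2) by simp
      qed
    qed
    finally have "of_nat n * d / of_nat n \<in> F" using D(8,12) by blast
    then show ?thesis using \<zeta>(3) by simp
  qed
  obtain p q where pq: "p \<in> polys_over F" "q \<in> polys_over F" "poly q \<alpha> \<noteq> 0"
    "x = poly p \<alpha> / poly q \<alpha>" using x(1) by (auto simp: ext_def)
  define b where "b j = (\<sigma> ^^ j) (poly q \<alpha>)" for j
  have b: "b j = poly (pcompose q [:0, \<zeta> ^ j:]) \<alpha>" for j
    by (simp add: b_def \<sigma>\<alpha>[OF pq(2)] poly_pcompose mult.commute)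
  have bR: "pcompose q [:0, \<zeta> ^ j:] \<in> polys_over F" for j
    using D(2) D(9)[OF \<zeta>(1), of j] by (intro I(14) pq I(4) I(1)) auto
  have b0: "b j \<noteq> 0" for j
    unfolding b_def using pq(3) h by (induction j) auto
  have bn: "b n = b 0" by (simp add: b_def \<sigma>\<alpha>[OF pq(2)] \<zeta>n)
  define N where "N = (\<Prod>j<n. b j)"
  obtain m where m: "n = Suc m" using \<zeta>n(1) gr0_implies_Suc by blast
  have "\<sigma> N = (\<Prod>j<n. b (Suc j))" by (simp add: N_def h b_def)
  also have "\<dots> = N"
    unfolding N_def m using bn prod.lessThan_Suc_shift[of b m] by (simp add: m mult.commute)
  finally have \<sigma>N: "\<sigma> N = N" .
  have N0: "N \<noteq> 0" using b0 by (simp add: N_def)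
  have "N = poly (\<Prod>j<n. pcompose q [:0, \<zeta> ^ j:]) \<alpha>" by (simp add: N_def b poly_prod)
  moreover have "(\<Prod>j<n. pcompose q [:0, \<zeta> ^ j:]) \<in> polys_over F" by (intro I(13) bR)
  ultimately have "N \<in> ?R" by (rule image_eqI)
  then have NF: "N \<in> F" using R \<sigma>N by blast
  have "N = b 0 * (\<Prod>j<m. b (Suc j))" unfolding N_def m by (rule prod.lessThan_Suc_shift)
  then have "x * N = poly p \<alpha> * (\<Prod>j<m. b (Suc j))"
    using pq(3) by (simp add: pq(4) b_def)
  also have "\<dots> = poly (p * (\<Prod>j<m. pcompose q [:0, \<zeta> ^ Suc j:])) \<alpha>" by (simp add: b poly_prod)
  finally have "x * N = poly (p * (\<Prod>j<m. pcompose q [:0, \<zeta> ^ Suc j:])) \<alpha>" .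
  moreover have "p * (\<Prod>j<m. pcompose q [:0, \<zeta> ^ Suc j:]) \<in> polys_over F"
    by (intro I(10)[OF pq(1)] I(13) bR)
  ultimately have "x * N \<in> ?R" by (rule image_eqI)
  then have "x * N \<in> F" using R \<sigma>N x(2) h(3) by metis
  then have "x * N / N \<in> F" using NF D(8) by blast
  then show ?thesis using N0 by simp
qed

section \<open>Counting generators of a fixed field\<close>

text \<open>
  In a finite group every element is a product of generators without inverses.
\<close>

inductive_set compositions :: "('a \<Rightarrow> 'a) set \<Rightarrow> ('a \<Rightarrow> 'a) set" for gen where
  id: "(\<lambda>x. x) \<in> compositions gen"
| comp: "g \<in> gen \<Longrightarrow> \<tau> \<in> compositions gen \<Longrightarrow> (\<lambda>x. g (\<tau> x)) \<in> compositions gen"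

locale rational_action = automorphism_group \<Gamma> for \<Gamma> :: "('l::field \<Rightarrow> 'l) set" +
  fixes h :: "'k::field \<Rightarrow> 'l" and B :: "'l set" and gen :: "('l \<Rightarrow> 'l) set"
  assumes base_hom: "ring_hom_fun h"
    and base_fixed: "\<sigma> \<in> \<Gamma> \<Longrightarrow> \<sigma> (h c) = h c"
    and indep_B: "algebraically_independent h B" "finite B"
    and generated: "\<Gamma> = compositions gen"
begin

lemma gen_in: "gen \<subseteq> \<Gamma>"
  unfolding generated using compositions.comp[OF _ compositions.id] by auto

lemma hom_adjoin:
  assumes "\<sigma> \<in> \<Gamma>" "\<And>s. s \<in> S \<Longrightarrow> \<sigma> s \<in> adjoin h T" "x \<in> adjoin h S"
  shows "\<sigma> x \<in> adjoin h T"
proof -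
  note hs = ring_hom_funD[OF hom[OF assms(1)]] field_hom[OF hom[OF assms(1)]]
  have "is_subfield {x. \<sigma> x \<in> adjoin h T}"
    by (auto simp: is_subfield_def hs intro: adjoinD)
  then have "adjoin h S \<subseteq> {x. \<sigma> x \<in> adjoin h T}"
    using assms(2) by (intro adjoin_least) (auto simp: base_fixed[OF assms(1)] adjoin_base)
  then show ?thesis using assms(3) by blast
qed

lemma stable_adjoin:
  assumes "\<And>g s. g \<in> gen \<Longrightarrow> s \<in> S \<Longrightarrow> g s \<in> adjoin h S"
  shows "stable (adjoin h S)"
  unfolding stable_def
proof (intro ballI)
  fix \<sigma> x assume "\<sigma> \<in> \<Gamma>" and x: "x \<in> adjoin h S"
  from this(1) show "\<sigma> x \<in> adjoin h S"
    unfolding generated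
  proof induction
    case id
    then show ?case using x by simp
  next
    case (comp g \<tau>)
    then show ?case using hom_adjoin[of g S S] assms[of g] gen_in by blast
  qed
qed

lemma affine_if_gen:
  assumes F: "is_subfield F" "stable F"
    and g: "\<And>g. g \<in> gen \<Longrightarrow> \<exists>\<alpha>\<in>F. \<exists>\<beta>\<in>F. g x = \<alpha> * x + \<beta>" and \<sigma>: "\<sigma> \<in> \<Gamma>"
  shows "\<exists>\<alpha>\<in>F. \<exists>\<beta>\<in>F. \<sigma> x = \<alpha> * x + \<beta>"
  using \<sigma> unfolding generated
proof induction
  case id
  show ?case using is_subfieldD(1,2)[OF F(1)] by (intro bexI[of _ 1] bexI[of _ 0]) auto
next
  case (comp g \<tau>)
  obtain \<alpha> \<beta> where ab: "\<alpha> \<in> F" "\<beta> \<in> F" "\<tau> x = \<alpha> * x + \<beta>" using comp by blast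
  obtain \<alpha>' \<beta>' where ab': "\<alpha>' \<in> F" "\<beta>' \<in> F" "g x = \<alpha>' * x + \<beta>'" using g comp by blast
  have "g \<in> \<Gamma>" using comp gen_in by blast
  then have "g \<alpha> \<in> F" "g \<beta> \<in> F" using F(2) ab by (auto simp: stable_def)
  then have "g \<alpha> * \<alpha>' \<in> F" "g \<alpha> * \<beta>' + g \<beta> \<in> F" using ab' is_subfieldD[OF F(1)] by auto
  moreover have "g (\<tau> x) = g \<alpha> * \<alpha>' * x + (g \<alpha> * \<beta>' + g \<beta>)"
    unfolding ab(3) using ring_hom_funD(2,3)[OF hom[OF \<open>g \<in> \<Gamma>\<close>]] ab'(3) by (simp add: algebra_simps)
  ultimately show ?case by blast
qed

lemma fixed_if_gen:
  assumes "\<And>g. g \<in> gen \<Longrightarrow> g x = x" "\<sigma> \<in> \<Gamma>"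
  shows "\<sigma> x = x"
  using assms(2) unfolding generated by induction (simp_all add: assms(1))

text \<open>
  A bound for the number of generators of the fixed field of \<open>K(S)\<close> over \<open>K\<close>. Stability is included
  so that the bound can be carried from one extension to the next.
\<close>

definition fixed_gens :: "'l set \<Rightarrow> nat \<Rightarrow> bool" where
  "fixed_gens S n \<longleftrightarrow> stable (adjoin h S) \<and>
     (\<exists>T. finite T \<and> card T \<le> n \<and> Fix (adjoin h S) = adjoin h T)"

lemma fixed_gens_mono: "fixed_gens S n \<Longrightarrow> n \<le> m \<Longrightarrow> fixed_gens S m"
  unfolding fixed_gens_def by (meson order_trans)

lemma fixed_gens_all_fixed:
  assumes "finite S" "\<And>g s. g \<in> gen \<Longrightarrow> s \<in> S \<Longrightarrow> g s = s"
  shows "fixed_gens S (card S)"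
proof -
  have "S \<subseteq> Fix (adjoin h S)" using fixed_if_gen assms(2) adjoin_incl[of S h] by (auto simp: Fix_def)
  moreover have "range h \<subseteq> Fix (adjoin h S)" by (auto simp: Fix_def base_fixed adjoin_base)
  ultimately have "adjoin h S \<subseteq> Fix (adjoin h S)"
    by (intro adjoin_least Fix_subfield adjoin_subfield)
  moreover have "Fix (adjoin h S) \<subseteq> adjoin h S" by (auto simp: Fix_def)
  ultimately have "Fix (adjoin h S) = adjoin h S" by blast
  moreover have "stable (adjoin h S)"
  proof (rule stable_adjoin)
    fix g s assume "g \<in> gen" "s \<in> S"
    then show "g s \<in> adjoin h S" using assms(2)[of g s] adjoin_incl[of S h] by auto
  qed
  ultimately show ?thesis using assms(1) unfolding fixed_gens_def by blast
qed

lemma fixed_gens_affine: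
  assumes S: "fixed_gens S n" and x: "\<not> alg_over (adjoin h S) x"
    and aff: "\<And>g. g \<in> gen \<Longrightarrow> \<exists>\<alpha>\<in>adjoin h S. \<exists>\<beta>\<in>adjoin h S. g x = \<alpha> * x + \<beta>"
  shows "fixed_gens (insert x S) (Suc n)"
proof -
  have st: "stable (adjoin h S)" using S by (simp add: fixed_gens_def)
  obtain T where T: "finite T" "card T \<le> n" "Fix (adjoin h S) = adjoin h T"
    using S by (auto simp: fixed_gens_def)
  have "\<exists>\<alpha>\<in>adjoin h S. \<exists>\<beta>\<in>adjoin h S. \<sigma> x = \<alpha> * x + \<beta>" if "\<sigma> \<in> \<Gamma>" for \<sigma>
    by (rule affine_if_gen[OF adjoin_subfield st _ that]) (rule aff)
  then obtain f where "Fix (ext (adjoin h S) x) = ext (Fix (adjoin h S)) f"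
    using Fix_affine_extension[OF adjoin_subfield st x] by blast
  then have "Fix (adjoin h (insert x S)) = adjoin h (insert f T)"
    by (simp add: adjoin_insert T(3))
  moreover have "card (insert f T) \<le> Suc n" using T card_insert_le_m1[of "Suc n" T f] by simp
  moreover have "stable (adjoin h (insert x S))"
  proof (rule stable_adjoin)
    fix g s assume g: "g \<in> gen" and s: "s \<in> insert x S"
    have sub: "adjoin h S \<subseteq> adjoin h (insert x S)" by (intro adjoin_mono) auto
    show "g s \<in> adjoin h (insert x S)"
    proof (cases "s = x")
      case True
      obtain \<alpha> \<beta> where "\<alpha> \<in> adjoin h S" "\<beta> \<in> adjoin h S" "g x = \<alpha> * x + \<beta>" using aff g by blast
      then show ?thesis using True sub adjoin_incl[of "insert x S" h]
        by (auto intro!: adjoinD)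
    next
      case False
      then have "s \<in> adjoin h S" using s adjoin_incl[of S h] by blast
      then show ?thesis using st g gen_in sub unfolding stable_def by blast
    qed
  qed
  ultimately show ?thesis using T(1) unfolding fixed_gens_def by (meson finite_insert)
qed

lemma not_alg_if_indep:
  assumes "indep (acl h) C" "A \<subseteq> C" "x \<in> C" "x \<notin> A"
  shows "\<not> alg_over (adjoin h A) x"
proof -
  have "acl h A \<subseteq> acl h (C - {x})" using assms(2,4) by (intro acl.cl_mono) auto
  then show ?thesis using assms(1,3) by (auto simp: indep_def acl_def)
qed

lemma fixed_gens_diagonal:
  assumes S: "fixed_gens S n" and T: "finite T" "indep (acl h) (S \<union> T)"
    and diag: "\<And>g t. g \<in> gen \<Longrightarrow> t \<in> T \<Longrightarrow> \<exists>\<alpha>\<in>adjoin h S. g t = \<alpha> * t"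
  shows "fixed_gens (S \<union> T) (n + card T)"
proof -
  have "fixed_gens (S \<union> U) (n + card U)" if "U \<subseteq> T" for U
    using finite_subset[OF that T(1)] that
  proof (induction U rule: finite_induct)
    case empty
    then show ?case using S by simp
  next
    case (insert t U)
    show ?case
    proof (cases "t \<in> S")
      case True
      then have "S \<union> insert t U = S \<union> U" by blast
      moreover have "fixed_gens (S \<union> U) (n + card U)" using insert by blast
      ultimately show ?thesis using insert.hyps by (auto intro: fixed_gens_mono)
    next
      case False
      have "\<not> alg_over (adjoin h (S \<union> U)) t"
        using insert False by (intro not_alg_if_indep[OF T(2)]) auto
      moreover have "\<exists>\<alpha>\<in>adjoin h (S \<union> U). \<exists>\<beta>\<in>adjoin h (S \<union> U). g t = \<alpha> * t + \<beta>" if g: "g \<in> gen" for g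
      proof -
        have "t \<in> T" using insert.prems by blast
        then obtain \<alpha> where "\<alpha> \<in> adjoin h S" "g t = \<alpha> * t" using diag[OF g] by blast
        then show ?thesis using adjoin_mono[of S "S \<union> U" h] adjoinD(2)[of h "S \<union> U"]
          by (intro bexI[of _ \<alpha>] bexI[of _ 0]) auto
      qed
      ultimately have "fixed_gens (insert t (S \<union> U)) (Suc (n + card U))"
        using insert by (intro fixed_gens_affine) auto
      then show ?thesis using insert.hyps by simp
    qed
  qed
  then show ?thesis by blast
qed

lemma indep_subset:
  assumes "indep (acl h) C" "A \<subseteq> C"
  shows "indep (acl h) A"
  unfolding indep_def
proof (intro ballI notI)
  fix x assume "x \<in> A" "x \<in> acl h (A - {x})"
  then show False using not_alg_if_indep[OF assms(1), of "A - {x}" x] assms(2) by (auto simp: acl_def)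
qed

lemma nonzero_if_indep:
  assumes "indep (acl h) C" "x \<in> C"
  shows "x \<noteq> 0"
proof
  assume "x = 0"
  then have "alg_over (adjoin h {}) x" by (simp add: alg_over_self adjoin_subfield adjoinD(2))
  then show False using not_alg_if_indep[OF assms(1) _ assms(2), of "{}"] by simp
qed

lemma indep_if_generating:
  assumes "B \<subseteq> acl h C" "finite C" "card C \<le> card B"
  shows "indep (acl h) C" "card C = card B"
  using independent_if_enough[OF base_hom indep_B assms] by auto

text \<open>
  A field is algebraic over the fixed field of a finite group. So generators of the fixed field,
  if they are no more than the transcendence degree, are algebraically independent.
\<close>

lemma rational_if_fixed_gens:
  assumes "fixed_gens S (card B)" "adjoin h S = adjoin h B"
  shows "rational_over h (Fix (adjoin h B))"
proof -
  obtain T where T: "finite T" "card T \<le> card B" "Fix (adjoin h B) = adjoin h T"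
    using assms by (auto simp: fixed_gens_def)
  have st: "stable (adjoin h B)" using assms by (simp add: fixed_gens_def)
  have "B \<subseteq> acl h T"
  proof
    fix x assume "x \<in> B"
    then have "x \<in> adjoin h B" using adjoin_incl by blast
    then have "alg_over (Fix (adjoin h B)) x" by (rule alg_over_Fix[OF adjoin_subfield st])
    then show "x \<in> acl h T" by (simp add: acl_def T(3))
  qed
  then have "algebraically_independent h T"
    using independent_if_enough[OF base_hom indep_B _ T(1,2)] by blast
  then show ?thesis using T(3) by (auto simp: rational_over_def)
qed

end

section \<open>Non-abelian groups of order \<open>p\<^sup>3\<close>\<close>

definition center :: "('g, 'm) monoid_scheme \<Rightarrow> 'g set" where
  "center G = {z \<in> carrier G. \<forall>x\<in>carrier G. z \<otimes>\<^bsub>G\<^esub> x = x \<otimes>\<^bsub>G\<^esub> z}"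

definition centralizer :: "('g, 'm) monoid_scheme \<Rightarrow> 'g \<Rightarrow> 'g set" where
  "centralizer G x = {y \<in> carrier G. y \<otimes>\<^bsub>G\<^esub> x = x \<otimes>\<^bsub>G\<^esub> y}"

context group
begin

lemma subgroup_centralizer:
  assumes x: "x \<in> carrier G"
  shows "subgroup (centralizer G x) G"
proof
  fix y assume y: "y \<in> centralizer G x"
  then have y': "y \<in> carrier G" "y \<otimes> x = x \<otimes> y" by (simp_all add: centralizer_def)
  have "x \<otimes> inv y = inv y \<otimes> (y \<otimes> x) \<otimes> inv y" using x y'(1) by (simp flip: m_assoc)
  also have "\<dots> = inv y \<otimes> x" unfolding y'(2) using x y'(1) by (simp add: m_assoc)
  finally show "inv y \<in> centralizer G x" using x y' by (simp add: centralizer_def)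
  fix z assume "z \<in> centralizer G x"
  then show "y \<otimes> z \<in> centralizer G x"
    using x y by (simp add: centralizer_def m_assoc) (simp flip: m_assoc)
qed (auto simp: centralizer_def x)

lemma center_eq: "center G = (\<Inter>x\<in>carrier G. centralizer G x) \<inter> carrier G"
  by (auto simp: center_def centralizer_def)

lemma subgroup_center: "subgroup (center G) G"
proof
  fix y z assume yz: "y \<in> center G" "z \<in> center G"
  then show "y \<otimes> z \<in> center G" "inv y \<in> center G"
    using subgroupE(4)[OF subgroup_centralizer, of _ y z] subgroupE(3)[OF subgroup_centralizer, of _ y]
    by (auto simp: center_eq)
qed (auto simp: center_def)

lemma conjugation_orbit_singleton:
  assumes x: "x \<in> carrier G" and orb: "card (orbit G (\<lambda>g. \<lambda>h\<in>carrier G. g \<otimes> h \<otimes> inv g) x) = 1"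
  shows "x \<in> center G"
proof -
  interpret A: group_action G "carrier G" "\<lambda>g. \<lambda>h\<in>carrier G. g \<otimes> h \<otimes> inv g"
    by (rule action_by_conjugation)
  let ?O = "orbit G (\<lambda>g. \<lambda>h\<in>carrier G. g \<otimes> h \<otimes> inv g) x"
  obtain w where w: "?O = {w}" using orb by (rule card_1_singletonE)
  moreover have "x \<in> ?O" by (rule A.orbit_refl[OF x])
  ultimately have O: "?O = {x}" by simp
  have "g \<otimes> x \<otimes> inv g = x" if "g \<in> carrier G" for g
  proof -
    have "g \<otimes> x \<otimes> inv g \<in> ?O" using that x by (auto simp: orbit_def)
    then show ?thesis unfolding O by (rule singletonD)
  qed
  then have "g \<otimes> x = x \<otimes> g" if "g \<in> carrier G" for g
    using that x inv_solve_right[of x "g \<otimes> x" g] by auto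
  then show ?thesis using x by (auto simp: center_def)
qed

text \<open>
  The class equation: if the unit element were the only class of size one, then \<open>p\<close> would divide
  \<open>p\<^sup>n - 1\<close>.
\<close>

lemma p_group_center_nontrivial:
  assumes p: "Factorial_Ring.prime p" and G: "Coset.order G = p ^ n" "n > 0"
  shows "\<exists>z\<in>center G. z \<noteq> \<one>"
proof (rule ccontr)
  assume triv: "\<not> ?thesis"
  let ?\<phi> = "\<lambda>g. \<lambda>h\<in>carrier G. g \<otimes> h \<otimes> inv g"
  interpret A: group_action G "carrier G" ?\<phi> by (rule action_by_conjugation)
  have fin: "finite (carrier G)"
    using G p order_gt_0_iff_finite by (metis prime_gt_0_nat zero_less_power)
  have dvd: "p dvd card (orbit G ?\<phi> x)" if "x \<in> carrier G" "x \<noteq> \<one>" for x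
  proof -
    have "card (orbit G ?\<phi> x) dvd p ^ n"
      by (rule dvdI[of _ _ "card (stabilizer G ?\<phi> x)"])
        (simp only: A.orbit_stabilizer_theorem[OF that(1)] G(1))
    then obtain k where k: "card (orbit G ?\<phi> x) = p ^ k"
      using divides_primepow_nat[OF p] by blast
    have "k > 0"
    proof (rule ccontr)
      assume "\<not> k > 0"
      then have "card (orbit G ?\<phi> x) = 1" using k by simp
      then show False using conjugation_orbit_singleton[OF that(1)] triv that(2) by blast
    qed
    then show ?thesis using k by simp
  qed
  have one: "orbit G ?\<phi> \<one> = {\<one>}" using A.orbit_refl[of \<one>] by (auto simp: orbit_def)
  have part: "\<Union>(orbits G (carrier G) ?\<phi>) = carrier G"
    "\<And>O1 O2. O1 \<in> orbits G (carrier G) ?\<phi> \<Longrightarrow> O2 \<in> orbits G (carrier G) ?\<phi> \<Longrightarrow> O1 \<noteq> O2 \<Longrightarrow> O1 \<inter> O2 = {}"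
    using partition.partition_coverture[OF A.orbit_partition]
      partition.disjoint_union[OF A.orbit_partition] by blast+
  let ?C = "orbits G (carrier G) ?\<phi> - {{\<one>}}"
  have "{\<one>} \<in> orbits G (carrier G) ?\<phi>" using one by (force simp: orbits_def)
  then have U: "\<Union>?C = carrier G - {\<one>}" using part by blast
  have "p dvd card (\<Union>?C)"
  proof (rule dvd_partition)
    show "finite (\<Union>?C)" using U fin by simp
    show "\<forall>c\<in>?C. p dvd card c"
    proof
      fix c assume c: "c \<in> ?C"
      then obtain x where "x \<in> carrier G" "c = orbit G ?\<phi> x" by (auto simp: orbits_def)
      then show "p dvd card c" using dvd one c by blast
    qed
    show "\<forall>c1\<in>?C. \<forall>c2\<in>?C. c1 \<noteq> c2 \<longrightarrow> c1 \<inter> c2 = {}" using part(2) by blast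
  qed
  then have "p dvd p ^ n - 1" using U G(1) fin by (simp add: Coset.order_def)
  moreover have "p dvd p ^ n" using G(2) by simp
  moreover have "p ^ n > 0" using p prime_gt_0_nat by simp
  ultimately have "p dvd 1" by (metis dvd_diffD1 One_nat_def Suc_leI)
  then show False using p not_prime_unit by blast
qed

lemma card_subgroup_dvd: "subgroup H G \<Longrightarrow> card H dvd Coset.order G"
  using lagrange by (metis dvd_triv_right)

lemma card_prime_power_le:
  assumes "Factorial_Ring.prime (p::nat)" "m dvd p ^ n" "p ^ k < m"
  shows "p ^ Suc k \<le> m"
proof -
  obtain i where i: "m = p ^ i" using divides_primepow_nat[OF assms(1)] assms(2) by blast
  have p: "p > 1" using assms(1) prime_gt_1_nat by blast
  then have "k < i" using assms(3) i power_less_imp_less_exp by blast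
  then show ?thesis unfolding i using p by (intro power_increasing) auto
qed

lemma finite_if_order_prime_power:
  "Factorial_Ring.prime p \<Longrightarrow> Coset.order G = p ^ n \<Longrightarrow> finite (carrier G)"
  using order_gt_0_iff_finite by (metis prime_gt_0_nat zero_less_power)

lemma center_subset_centralizer:
  assumes "finite (carrier G)" "x \<in> carrier G" "x \<notin> center G"
  shows "card (center G) < card (centralizer G x)" "card (centralizer G x) < Coset.order G"
proof -
  have C: "centralizer G x \<subseteq> carrier G" by (auto simp: centralizer_def)
  then have fin: "finite (centralizer G x)" using assms(1) finite_subset by blast
  have "center G \<subseteq> centralizer G x" "x \<in> centralizer G x"
    using assms(2) by (auto simp: center_def centralizer_def)
  then have "center G \<subset> centralizer G x" using assms(3) by blast
  then show "card (center G) < card (centralizer G x)" using fin psubset_card_mono by blast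
  have "centralizer G x \<noteq> carrier G"
  proof
    assume *: "centralizer G x = carrier G"
    have "y \<otimes> x = x \<otimes> y" if "y \<in> carrier G" for y
      using that unfolding *[symmetric] by (simp add: centralizer_def)
    then have "x \<in> center G" using assms(2) by (simp add: center_def)
    then show False using assms(3) by blast
  qed
  then show "card (centralizer G x) < Coset.order G"
    using C assms(1) psubset_card_mono[of "carrier G" "centralizer G x"] by (simp add: Coset.order_def psubsetI)
qed

lemma prime_le_card_center:
  assumes p: "Factorial_Ring.prime p" and G: "Coset.order G = p ^ n" "n > 0"
  shows "p \<le> card (center G)"
proof -
  have fin: "finite (center G)"
    using finite_if_order_prime_power[OF p G(1)] by (auto simp: center_def intro: finite_subset)
  obtain z where "z \<in> center G" "z \<noteq> \<one>" using p_group_center_nontrivial[OF assms] by blast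
  moreover have "\<one> \<in> center G" by (simp add: center_def)
  ultimately have "card {\<one>, z} \<le> card (center G)" using fin by (intro card_mono) auto
  then have "p ^ 0 < card (center G)" using \<open>z \<noteq> \<one>\<close> by simp
  moreover have "card (center G) dvd p ^ n" using card_subgroup_dvd[OF subgroup_center] G by simp
  ultimately show ?thesis using card_prime_power_le[OF p, of _ n 0] by simp
qed

text \<open>
  The centralizer of a non-central element would lie strictly between the center, of order at
  least \<open>p\<close>, and the group, of order \<open>p\<^sup>2\<close>.
\<close>

lemma order_prime_square_comm:
  assumes p: "Factorial_Ring.prime p" and G: "Coset.order G = p ^ 2"
    and xy: "x \<in> carrier G" "y \<in> carrier G"
  shows "x \<otimes> y = y \<otimes> x"
proof -
  have "x \<in> center G"
  proof (rule ccontr)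
    assume x: "x \<notin> center G"
    note c = center_subset_centralizer[OF finite_if_order_prime_power[OF p G] xy(1) x]
    have "p \<le> card (center G)" using prime_le_card_center[OF p G] by simp
    then have "p ^ 1 < card (centralizer G x)" using c(1) by simp
    moreover have "card (centralizer G x) dvd p ^ 2"
      using card_subgroup_dvd[OF subgroup_centralizer[OF xy(1)]] G by simp
    ultimately have "p ^ 2 \<le> card (centralizer G x)"
      using card_prime_power_le[OF p, of _ 2 1] by (simp add: numeral_2_eq_2)
    then show False using c(2) G by simp
  qed
  then show ?thesis using xy(2) by (simp add: center_def)
qed

lemma normal_center: "center G \<lhd> G"
proof (rule normal_invI[OF subgroup_center])
  fix x h assume "x \<in> carrier G" "h \<in> center G"
  moreover from this have "h \<in> carrier G" "x \<otimes> h = h \<otimes> x" by (simp_all add: center_def)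
  then have "x \<otimes> h \<otimes> inv x = h" using \<open>x \<in> carrier G\<close> by (simp add: m_assoc)
  ultimately show "x \<otimes> h \<otimes> inv x \<in> center G" by simp
qed

lemma card_center_order_prime_cube:
  assumes p: "Factorial_Ring.prime p" and G: "Coset.order G = p ^ 3" and x: "x \<in> carrier G" "x \<notin> center G"
  shows "card (center G) = p"
proof (rule ccontr)
  assume *: "card (center G) \<noteq> p"
  note c = center_subset_centralizer[OF finite_if_order_prime_power[OF p G] x]
  have d: "card (center G) dvd p ^ 3" "card (centralizer G x) dvd p ^ 3"
    using card_subgroup_dvd subgroup_center subgroup_centralizer[OF x(1)] G by metis+
  have "p \<le> card (center G)" using prime_le_card_center[OF p G] by simp
  then have "p ^ 2 \<le> card (center G)"
    using * card_prime_power_le[OF p d(1), of 1] by (simp add: numeral_2_eq_2)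
  then have "p ^ 3 \<le> card (centralizer G x)"
    using c(1) card_prime_power_le[OF p d(2), of 2] by (simp add: numeral_3_eq_3 numeral_2_eq_2)
  then show False using c(2) G by simp
qed

text \<open>
  The center has order \<open>p\<close>, so the quotient by it has order \<open>p\<^sup>2\<close> and is commutative.
\<close>

lemma commutator_in_center:
  assumes p: "Factorial_Ring.prime p" and G: "Coset.order G = p ^ 3"
    and xy: "x \<in> carrier G" "y \<in> carrier G" "x \<notin> center G"
  shows "\<exists>z\<in>center G. y \<otimes> x = x \<otimes> y \<otimes> z"
proof -
  interpret N: normal "center G" G by (rule normal_center)
  interpret Q: group "G Mod center G" by (rule N.factorgroup_is_group)
  have "Coset.order (G Mod center G) * p = p ^ 3"
    using lagrange[OF subgroup_center] card_center_order_prime_cube[OF p G xy(1,3)] G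
    by (simp add: FactGroup_def Coset.order_def)
  then have "Coset.order (G Mod center G) = p ^ 2"
    using p by (auto simp: power3_eq_cube power2_eq_square dest: prime_gt_0_nat)
  moreover have "center G #> u \<in> carrier (G Mod center G)" if "u \<in> carrier G" for u
    using that by (auto simp: FactGroup_def RCOSETS_def)
  ultimately have "(center G #> x) \<otimes>\<^bsub>G Mod center G\<^esub> (center G #> y) =
      (center G #> y) \<otimes>\<^bsub>G Mod center G\<^esub> (center G #> x)"
    using Q.order_prime_square_comm[OF p] xy by blast
  then have "center G #> (x \<otimes> y) = center G #> (y \<otimes> x)"
    using xy by (simp add: FactGroup_def N.rcos_sum)
  then have "y \<otimes> x \<in> center G #> (x \<otimes> y)" using xy subgroup_center rcos_self by auto
  then obtain z where z: "z \<in> center G" "y \<otimes> x = z \<otimes> (x \<otimes> y)" by (auto simp: r_coset_def)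
  moreover from z(1) have "z \<otimes> (x \<otimes> y) = x \<otimes> y \<otimes> z" using xy unfolding center_def by blast
  ultimately show ?thesis by (intro bexI[of _ z]) simp_all
qed

lemma center_closed: "w \<in> center G \<Longrightarrow> w \<in> carrier G"
  and center_commute: "w \<in> center G \<Longrightarrow> x \<in> carrier G \<Longrightarrow> w \<otimes> x = x \<otimes> w"
  by (auto simp: center_def)

lemma center_pow: "w \<in> center G \<Longrightarrow> w [^] (n::nat) \<in> center G"
  by (induction n) (auto intro: subgroup.m_closed[OF subgroup_center] subgroup.one_closed[OF subgroup_center])

lemma commutator_pow_right:
  assumes "u \<in> carrier G" "v \<in> carrier G" "w \<in> center G" "v \<otimes> u = u \<otimes> v \<otimes> w"
  shows "v \<otimes> u [^] (n::nat) = u [^] n \<otimes> v \<otimes> w [^] n"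
proof (induction n)
  case (Suc n)
  have wc: "w \<in> carrier G" using assms(3) center_closed by blast
  have "v \<otimes> u [^] Suc n = u [^] n \<otimes> v \<otimes> w [^] n \<otimes> u"
    using assms(1,2) Suc by (simp flip: m_assoc)
  also have "\<dots> = u [^] n \<otimes> v \<otimes> (u \<otimes> w [^] n)"
    using center_commute[OF center_pow[OF assms(3)] assms(1), of n] assms(1,2) wc by (simp add: m_assoc)
  also have "\<dots> = u [^] n \<otimes> (v \<otimes> u) \<otimes> w [^] n"
    using assms(1,2) wc by (simp add: m_assoc)
  also have "\<dots> = u [^] Suc n \<otimes> v \<otimes> (w \<otimes> w [^] n)"
    unfolding assms(4) using assms(1,2) wc by (simp add: m_assoc)
  finally show ?case by (simp only: nat_pow_Suc2[OF wc])
qed (use assms center_closed in auto)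

lemma commutator_pow_left:
  assumes "u \<in> carrier G" "v \<in> carrier G" "w \<in> center G" "v \<otimes> u = u \<otimes> v \<otimes> w"
  shows "v [^] (n::nat) \<otimes> u = u \<otimes> v [^] n \<otimes> w [^] n"
proof (induction n)
  case (Suc n)
  have wc: "w \<in> carrier G" using assms(3) center_closed by blast
  have "v [^] Suc n \<otimes> u = v [^] n \<otimes> u \<otimes> (v \<otimes> w)"
    using assms(1,2) wc by (simp add: m_assoc assms(4))
  also have "\<dots> = u \<otimes> v [^] n \<otimes> (w [^] n \<otimes> v) \<otimes> w"
    unfolding Suc using assms(1,2) wc by (simp add: m_assoc)
  also have "\<dots> = u \<otimes> v [^] Suc n \<otimes> w [^] Suc n"
    using center_commute[OF center_pow[OF assms(3)] assms(2), of n] assms(1,2) wc by (simp add: m_assoc)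
  finally show ?case .
qed (use assms center_closed in auto)

lemma class_two_power:
  assumes u: "u \<in> carrier G" and v: "v \<in> carrier G" and w: "w \<in> center G"
    and vu: "v \<otimes> u = u \<otimes> v \<otimes> w"
  shows "(u \<otimes> v) [^] n = u [^] n \<otimes> v [^] n \<otimes> w [^] (n * (n - 1) div 2 :: nat)"
proof (induction n)
  case (Suc n)
  have wc: "w \<in> carrier G" using w center_closed by blast
  let ?t = "n * (n - 1) div 2"
  have comm: "w [^] n \<otimes> (v \<otimes> w [^] ?t) = v \<otimes> (w [^] n \<otimes> w [^] ?t)"
    using center_commute[OF center_pow[OF w] v, of n] v wc by (simp flip: m_assoc)
  have "even (n * (n - 1))" by (cases n) auto
  then have t: "n + ?t = Suc n * (Suc n - 1) div 2" by (cases n) (auto simp: algebra_simps)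
  have "(u \<otimes> v) [^] Suc n = u [^] n \<otimes> v [^] n \<otimes> (w [^] ?t \<otimes> u) \<otimes> v"
    using u v wc Suc by (simp add: m_assoc)
  also have "\<dots> = u [^] n \<otimes> (v [^] n \<otimes> u) \<otimes> (w [^] ?t \<otimes> v)"
    unfolding center_commute[OF center_pow[OF w] u] using u v wc by (simp add: m_assoc)
  also have "\<dots> = u [^] Suc n \<otimes> v [^] n \<otimes> (w [^] n \<otimes> v) \<otimes> w [^] ?t"
    unfolding commutator_pow_left[OF assms] center_commute[OF center_pow[OF w] v]
    using u v wc comm by (simp add: m_assoc)
  also have "\<dots> = u [^] Suc n \<otimes> v [^] Suc n \<otimes> (w [^] n \<otimes> w [^] ?t)"
    unfolding center_commute[OF center_pow[OF w] v] using u v wc by (simp add: m_assoc)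
  finally show ?case using wc by (simp only: nat_pow_mult t)
qed (use u v in auto)

end

text \<open>
  One presentation for all non-abelian groups of order \<open>p\<^sup>3\<close>: they differ in where the \<open>p\<close>-th powers
  of \<open>a\<close> and \<open>b\<close> lie in the center \<open>\<langle>z\<rangle>\<close>, which is recorded by the exponents \<open>c\<close> and \<open>d\<close>.
\<close>

locale heisenberg_type = group G for G (structure) +
  fixes p :: nat and a b z :: 'a and c d :: nat
  assumes prime_p: "Factorial_Ring.prime p"
    and abz: "a \<in> carrier G" "b \<in> carrier G" "z \<in> center G"
    and commutator: "b \<otimes> a = a \<otimes> b \<otimes> z"
    and powers: "z [^] p = \<one>" "a [^] p = z [^] c" "b [^] p = z [^] d"
    and normal_form: "bij_betw (\<lambda>(i, j, k). a [^] i \<otimes> b [^] j \<otimes> z [^] k)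
      ({..<p} \<times> {..<p} \<times> {..<p}) (carrier G)"

context group
begin

text \<open>
  Any two elements that do not commute generate the group. Their commutator \<open>z\<close> generates the
  center, and in \<open>g = a\<^sup>i b\<^sup>j z\<^sup>k\<close> the exponents \<open>i\<close> and \<open>j\<close> can be read off from the commutators of \<open>g\<close>
  with \<open>b\<close> and \<open>a\<close>. So the \<open>p\<^sup>3\<close> products are distinct.
\<close>

lemma heisenberg_type_if_noncommuting:
  assumes p: "Factorial_Ring.prime p" and G: "Coset.order G = p ^ 3"
    and ab: "a \<in> carrier G" "b \<in> carrier G" "a \<otimes> b \<noteq> b \<otimes> a"
  shows "\<exists>z c d. heisenberg_type G p a b z c d"
proof -
  have fin: "finite (carrier G)" by (rule finite_if_order_prime_power[OF p G])
  have p1: "p > 1" using p prime_gt_1_nat by blast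
  have anc: "a \<notin> center G" using ab by (auto simp: center_def)
  have cp: "card (center G) = p" by (rule card_center_order_prime_cube[OF p G ab(1) anc])
  have wp: "w [^] p = \<one>" if "w \<in> center G" for w
  proof -
    interpret C: group "G\<lparr>carrier := center G\<rparr>" using subgroup_center subgroup_imp_group by blast
    have "w [^]\<^bsub>G\<lparr>carrier := center G\<rparr>\<^esub> Coset.order (G\<lparr>carrier := center G\<rparr>) = \<one>\<^bsub>G\<lparr>carrier := center G\<rparr>\<^esub>"
      by (rule C.pow_order_eq_1) (use that in simp)
    then show ?thesis using cp nat_pow_consistent[of w p "center G"] by (simp add: Coset.order_def)
  qed
  obtain z where z: "z \<in> center G" "b \<otimes> a = a \<otimes> b \<otimes> z"
    using commutator_in_center[OF p G ab(1,2) anc] by blast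
  have zc: "z \<in> carrier G" using z(1) center_closed by blast
  have z1: "z \<noteq> \<one>" using z(2) ab by auto
  have "ord z dvd p" using wp[OF z(1)] pow_eq_id[OF zc] by blast
  moreover have "ord z \<noteq> 1" using z1 zc ord_eq_1 by blast
  ultimately have oz: "ord z = p" using p unfolding prime_nat_iff by blast
  have zinj: "i = j" if "z [^] i = z [^] j" "i < p" "j < p" for i j :: nat
    using ord_inj[OF zc] that p1 unfolding oz inj_on_def by auto
  have zgen: "\<exists>k<p. w = z [^] k" if "w \<in> center G" for w
  proof -
    have "(\<lambda>k. z [^] k) ` {..<p} \<subseteq> center G" using center_pow[OF z(1)] by auto
    moreover have "card ((\<lambda>k. z [^] k) ` {..<p}) = p" using zinj by (subst card_image) (auto simp: inj_on_def)
    moreover have "finite (center G)" using fin by (auto simp: center_def intro: finite_subset)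
    ultimately have "(\<lambda>k. z [^] k) ` {..<p} = center G" using cp by (intro card_seteq) auto
    then show ?thesis using that by auto
  qed
  have pow_central: "u [^] p \<in> center G" if u: "u \<in> carrier G" "u \<notin> center G" for u
    unfolding center_def
  proof (intro CollectI conjI ballI)
    fix y assume y: "y \<in> carrier G"
    obtain w where w: "w \<in> center G" "y \<otimes> u = u \<otimes> y \<otimes> w"
      using commutator_in_center[OF p G u(1) y u(2)] by blast
    show "u [^] p \<otimes> y = y \<otimes> u [^] p"
      using commutator_pow_right[OF u(1) y w, of p] wp[OF w(1)] u(1) y by simp
  qed (use u in simp)
  have bnc: "b \<notin> center G" using ab center_commute[of b a] by auto
  obtain c :: nat where c: "a [^] p = z [^] c" using zgen[OF pow_central[OF ab(1) anc]] by blast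
  obtain d :: nat where d: "b [^] p = z [^] d" using zgen[OF pow_central[OF ab(2) bnc]] by blast
  let ?f = "\<lambda>(i::nat, j::nat, k::nat). a [^] i \<otimes> b [^] j \<otimes> z [^] k" and ?A = "{..<p} \<times> {..<p} \<times> {..<p}"
  have b_conj: "b \<otimes> ?f (i, j, k) = ?f (i, j, k) \<otimes> b \<otimes> z [^] i" for i j k
  proof -
    have "b \<otimes> ?f (i, j, k) = a [^] i \<otimes> b \<otimes> z [^] i \<otimes> (b [^] j \<otimes> z [^] k)"
      using commutator_pow_right[OF ab(1,2) z, of i] ab zc by (simp flip: m_assoc)
    also have "\<dots> = a [^] i \<otimes> b \<otimes> (b [^] j \<otimes> z [^] k) \<otimes> z [^] i"
      using center_commute[OF center_pow[OF z(1)], of "b [^] j \<otimes> z [^] k" i] ab zc by (simp add: m_assoc)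
    also have "\<dots> = a [^] i \<otimes> b [^] j \<otimes> (b \<otimes> z [^] k) \<otimes> z [^] i"
      using nat_pow_Suc2[OF ab(2), of j] ab zc by (simp flip: m_assoc) (simp add: m_assoc)
    also have "\<dots> = ?f (i, j, k) \<otimes> b \<otimes> z [^] i"
      using center_commute[OF center_pow[OF z(1)] ab(2), of k] ab zc by (simp add: m_assoc)
    finally show ?thesis .
  qed
  have a_conj: "?f (i, j, k) \<otimes> a = a \<otimes> ?f (i, j, k) \<otimes> z [^] j" for i j k
  proof -
    have "?f (i, j, k) \<otimes> a = a [^] i \<otimes> (b [^] j \<otimes> a) \<otimes> z [^] k"
      using center_commute[OF center_pow[OF z(1)] ab(1), of k] ab zc by (simp add: m_assoc)
    also have "\<dots> = a [^] i \<otimes> a \<otimes> b [^] j \<otimes> (z [^] j \<otimes> z [^] k)"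
      using commutator_pow_left[OF ab(1,2) z, of j] ab zc by (simp add: m_assoc)
    also have "\<dots> = a \<otimes> ?f (i, j, k) \<otimes> z [^] j"
    proof -
      have 1: "a [^] i \<otimes> a = a \<otimes> a [^] i" using nat_pow_Suc2[OF ab(1), of i] by simp
      have 2: "z [^] j \<otimes> z [^] k = z [^] k \<otimes> z [^] j"
        using center_commute[OF center_pow[OF z(1)], of "z [^] k" j] zc by simp
      show ?thesis unfolding 1 2 using ab zc by (simp add: m_assoc)
    qed
    finally show ?thesis .
  qed
  have fc: "?f t \<in> carrier G" for t using ab zc by (cases t) simp
  have "inj_on ?f ?A"
  proof (rule inj_onI)
    fix s t assume st: "s \<in> ?A" "t \<in> ?A" "?f s = ?f t"
    obtain i j k i' j' k' where s: "s = (i, j, k)" and t: "t = (i', j', k')" by (cases s; cases t) auto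
    have "?f s \<otimes> b \<otimes> z [^] i = ?f s \<otimes> b \<otimes> z [^] i'"
      using b_conj[of i j k] b_conj[of i' j' k'] st(3) unfolding s t by simp
    then have "i = i'" using st(1,2) zinj ab zc fc[of s] unfolding s t by simp
    have "a \<otimes> ?f s \<otimes> z [^] j = a \<otimes> ?f s \<otimes> z [^] j'"
      using a_conj[of i j k] a_conj[of i' j' k'] st(3) unfolding s t by simp
    then have "j = j'" using st(1,2) zinj ab zc fc[of s] unfolding s t by simp
    then have "k = k'" using st \<open>i = i'\<close> zinj ab zc unfolding s t by simp
    then show "s = t" using \<open>i = i'\<close> \<open>j = j'\<close> s t by simp
  qed
  moreover from this have "card (?f ` ?A) = p ^ 3"
    by (simp add: card_image card_cartesian_product power3_eq_cube)
  then have "?f ` ?A = carrier G"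
    using fc G fin by (intro card_seteq) (auto simp: Coset.order_def)
  ultimately have "bij_betw ?f ?A (carrier G)" by (simp add: bij_betw_def)
  then have "heisenberg_type G p a b z c d"
    using p ab z wp[OF z(1)] c d
    by (intro heisenberg_type.intro heisenberg_type_axioms.intro) (auto simp: is_group)
  then show ?thesis by blast
qed

end

text \<open>
  For odd \<open>p\<close> the \<open>p\<close>-th power map is multiplicative, because the correction in \<open>class_two_power\<close> has
  an exponent divisible by \<open>p\<close>. Hence, if \<open>x\<close> and \<open>y\<close> do not commute, \<open>x\<close> or some product \<open>x\<^sup>k y\<close> has
  trivial \<open>p\<close>-th power. For \<open>p = 2\<close> it can happen that both squares are \<open>z\<close>; this is the quaternion
  group.
\<close>

theorem nonabelian_prime_cube:
  fixes G (structure)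
  assumes G: "group G" "\<not> comm_group G" and p: "Factorial_Ring.prime p" and card: "Coset.order G = p ^ 3"
  shows "\<exists>a b z c d. heisenberg_type G p a b z c d \<and>
    (b [^] p = \<one> \<or> p = 2 \<and> a [^] p = z \<and> b [^] p = z)"
proof -
  interpret group G by (rule G)
  note heis = heisenberg_type_if_noncommuting[OF p card]
  obtain x y where xy: "x \<in> carrier G" "y \<in> carrier G" "x \<otimes> y \<noteq> y \<otimes> x"
    using G(2) group.group_comm_groupI[OF G(1)] by blast
  obtain z c d where H: "heisenberg_type G p x y z c d" using heis[OF xy] by blast
  interpret H: heisenberg_type G p x y z c d by (rule H)
  have zc: "z \<in> carrier G" using H.abz center_closed by blast
  show ?thesis
  proof (cases "x [^] p = \<one>")
    case True
    obtain z' c' d' where "heisenberg_type G p y x z' c' d'" using heis[OF xy(2,1)] xy(3) by metis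
    then show ?thesis using True by blast
  next
    case x: False
    show ?thesis
    proof (cases "p = 2")
      case True
      have z2: "z [^] i = \<one> \<or> z [^] i = z" for i :: nat
      proof -
        have "z [^] i = z [^] (i mod 2) \<otimes> (z [^] (2::nat)) [^] (i div 2)"
          using zc by (simp add: nat_pow_pow nat_pow_mult)
        also have "\<dots> = z [^] (i mod 2)" using H.powers(1) zc by (simp add: True)
        finally show ?thesis using zc by (cases "i mod 2 = 0") (auto simp: mod2_eq_if)
      qed
      show ?thesis
      proof (cases "y [^] p = \<one>")
        case True
        then show ?thesis using H by blast
      next
        case False
        then have "x [^] p = z" "y [^] p = z" using x z2 H.powers by metis+
        then show ?thesis using H True by blast
      qed
    next
      case False
      then have "odd p" using prime_odd_nat[OF p] prime_ge_2_nat[OF p] by simp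
      have "\<not> p dvd c"
      proof
        assume "p dvd c"
        then have "z [^] c = \<one>" using H.powers(1) zc by (auto simp flip: nat_pow_pow elim!: dvdE)
        then show False using x H.powers by simp
      qed
      moreover from this have "c \<noteq> 0" by (intro notI) simp
      then obtain e m n where e: "e dvd c" "e dvd p" "c * m = p * n + e"
        using bezout_add_strong_nat by blast
      ultimately have "c * m = p * n + 1" using p by (auto simp: prime_nat_iff)
      define k where "k = m * (p - d mod p)"
      have k: "p dvd k * c + d"
      proof -
        have "k * c + d = (c * m) * (p - d mod p) + d" by (simp add: k_def mult_ac)
        also have "\<dots> = p * n * (p - d mod p) + (p - d mod p + d)"
          unfolding \<open>c * m = p * n + 1\<close> by (simp only: distrib_right add.assoc mult_1)
        also have "p - d mod p + d = p + p * (d div p)"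
          using prime_gt_0_nat[OF p] mod_less_divisor[of p d] mult_div_mod_eq[of p d] by linarith
        finally show ?thesis by simp
      qed
      define b where "b = x [^] k \<otimes> y"
      have bc: "b \<in> carrier G" using xy by (simp add: b_def)
      have "y \<otimes> x [^] k = x [^] k \<otimes> y \<otimes> z [^] k"
        by (rule commutator_pow_right[OF xy(1,2) H.abz(3) H.commutator])
      then have "b [^] p = (x [^] k) [^] p \<otimes> y [^] p \<otimes> (z [^] k) [^] (p * (p - 1) div 2)"
        unfolding b_def using xy by (intro class_two_power center_pow H.abz) auto
      also have "(z [^] k) [^] (p * (p - 1) div 2) = \<one>"
      proof -
        have "p * (p - 1) div 2 = p * ((p - 1) div 2)" using \<open>odd p\<close> by (auto elim!: oddE)
        then have "(z [^] k) [^] (p * (p - 1) div 2) = (z [^] p) [^] (k * ((p - 1) div 2))"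
          using zc by (simp add: nat_pow_pow mult_ac)
        then show ?thesis using H.powers(1) by simp
      qed
      also have "(x [^] k) [^] p \<otimes> y [^] p = z [^] (k * c + d)"
      proof -
        have "(x [^] k) [^] p = (x [^] p) [^] k" using xy by (simp add: nat_pow_pow mult.commute)
        then show ?thesis using zc by (simp add: H.powers nat_pow_pow nat_pow_mult mult.commute)
      qed
      also have "z [^] (k * c + d) = \<one>"
        using k H.powers(1) zc by (auto simp flip: nat_pow_pow elim!: dvdE)
      finally have bp: "b [^] p = \<one>" by simp
      have "x \<otimes> b \<noteq> b \<otimes> x"
      proof
        assume "x \<otimes> b = b \<otimes> x"
        then have "x [^] k \<otimes> (x \<otimes> y) = x [^] k \<otimes> (y \<otimes> x)"
          using xy nat_pow_comm[of x k 1] by (simp add: b_def flip: m_assoc) 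
        then show False using xy by simp
      qed
      then obtain z' c' d' where "heisenberg_type G p x b z' c' d'" using heis[OF xy(1) bc] by blast
      then show ?thesis using bp by blast
    qed
  qed
qed

section \<open>The action on the variables\<close>

context group
begin

lemma group_action_ratfun_one: "group_action_ratfun G \<one> x = x"
proof -
  have "left_mult G \<one> = (\<lambda>v. v)" by (auto simp: left_mult_def fun_eq_iff)
  then show ?thesis
    by (cases x) (simp add: group_action_ratfun_def permute_vars_Fract bij_id[unfolded id_def])
qed

lemma group_action_ratfun_mult:
  assumes "g \<in> carrier G" "g' \<in> carrier G"
  shows "group_action_ratfun G g (group_action_ratfun G g' x) = group_action_ratfun G (g \<otimes> g') x"
proof -
  have "(\<lambda>v. left_mult G g (left_mult G g' v)) = left_mult G (g \<otimes> g')"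
    using assms by (auto simp: left_mult_def fun_eq_iff m_assoc)
  then show ?thesis
    unfolding group_action_ratfun_def
    by (simp add: permute_vars_comp bij_left_mult is_group assms)
qed

lemma automorphism_group_ratfun:
  assumes "finite (carrier G)"
  shows "automorphism_group (group_action_ratfun G ` carrier G)"
proof
  show "(\<lambda>x. x) \<in> group_action_ratfun G ` carrier G"
    by (rule image_eqI[of _ _ "\<one>"]) (auto simp: fun_eq_iff group_action_ratfun_one)
  show "(\<lambda>x. \<sigma> (\<tau> x)) \<in> group_action_ratfun G ` carrier G"
    if "\<sigma> \<in> group_action_ratfun G ` carrier G" "\<tau> \<in> group_action_ratfun G ` carrier G" for \<sigma> \<tau>
  proof -
    from that obtain g g' where "g \<in> carrier G" "\<sigma> = group_action_ratfun G g"
      "g' \<in> carrier G" "\<tau> = group_action_ratfun G g'" by auto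
    then show ?thesis
      by (intro image_eqI[of _ _ "g \<otimes> g'"]) (auto simp: fun_eq_iff group_action_ratfun_mult)
  qed
qed (use assms ring_hom_fun_group_action_ratfun[OF is_group] in auto)

end

locale heisenberg_action = heisenberg_type G p a b z c d
  for G (structure) and p a b z c d +
  fixes K :: "'k::field itself"
begin

abbreviation act :: "'a \<Rightarrow> ('a, 'k) ratfun \<Rightarrow> ('a, 'k) ratfun" where
  "act \<equiv> group_action_ratfun G"

abbreviation \<Gamma> :: "(('a, 'k) ratfun \<Rightarrow> ('a, 'k) ratfun) set" where
  "\<Gamma> \<equiv> act ` carrier G"

abbreviation B :: "('a, 'k) ratfun set" where
  "B \<equiv> rf_var ` carrier G"

abbreviation gen :: "(('a, 'k) ratfun \<Rightarrow> ('a, 'k) ratfun) set" where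
  "gen \<equiv> {act a, act b, act z}"

abbreviation h :: "'k \<Rightarrow> ('a, 'k) ratfun" where
  "h \<equiv> rf_const"

lemma p_gt: "p > 1" "p > 0"
  using prime_p prime_gt_1_nat prime_gt_0_nat by auto

lemma z_closed [simp]: "z \<in> carrier G"
  using abz center_closed by blast

lemmas ab_closed [simp] = abz(1,2)

lemma finite_G: "finite (carrier G)"
  using bij_betw_finite[OF normal_form] by simp

lemma card_G: "card (carrier G) = p ^ 3"
  using bij_betw_same_card[OF normal_form] by (simp add: card_cartesian_product power3_eq_cube)

lemma finite_B: "finite B" and card_B: "card B = p ^ 3"
  using finite_G card_G by (simp_all add: card_image inj_on_def)

lemma carrier_normal_form:
  "carrier G = {a [^] i \<otimes> b [^] j \<otimes> z [^] k | i j k. i < p \<and> j < p \<and> k < p}"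
proof -
  have "carrier G = (\<lambda>(i, j, k). a [^] i \<otimes> b [^] j \<otimes> z [^] k) ` ({..<p} \<times> {..<p} \<times> {..<p})"
    using normal_form by (simp add: bij_betw_def)
  also have "\<dots> = {a [^] i \<otimes> b [^] j \<otimes> z [^] k | i j k. i < p \<and> j < p \<and> k < p}"
    by force
  finally show ?thesis .
qed

lemma generated_by_abz: "\<Gamma> = compositions gen"
proof
  have pow: "act (g [^] n \<otimes> g') \<in> compositions gen"
    if "act g \<in> gen" "g \<in> carrier G" "g' \<in> carrier G" "act g' \<in> compositions gen"
    for g g' and n :: nat
  proof (induction n)
    case (Suc n)
    have "act (g [^] Suc n \<otimes> g') = (\<lambda>x. act g (act (g [^] n \<otimes> g') x))"
      using that(2,3) nat_pow_Suc2[OF that(2), of n] by (simp add: group_action_ratfun_mult m_assoc)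
    then show ?case using compositions.comp[OF that(1) Suc] by simp
  qed (use that in simp)
  have "act \<one> = (\<lambda>x. x)" by (simp add: fun_eq_iff group_action_ratfun_one)
  then have one: "act \<one> \<in> compositions gen" using compositions.id[of gen] by simp
  show "\<Gamma> \<subseteq> compositions gen"
  proof
    fix \<sigma> assume "\<sigma> \<in> \<Gamma>"
    then obtain g where "g \<in> carrier G" "\<sigma> = act g" by blast
    then obtain i j k :: nat where \<sigma>: "\<sigma> = act (a [^] i \<otimes> b [^] j \<otimes> z [^] k)"
      unfolding carrier_normal_form by blast
    have "act (a [^] i \<otimes> (b [^] j \<otimes> (z [^] k \<otimes> \<one>))) \<in> compositions gen"
      by (intro pow one) auto
    then show "\<sigma> \<in> compositions gen" unfolding \<sigma> by (simp add: m_assoc)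
  qed
  show "compositions gen \<subseteq> \<Gamma>"
  proof
    fix \<sigma> assume "\<sigma> \<in> compositions gen"
    then show "\<sigma> \<in> \<Gamma>"
    proof induction
      case id
      show ?case by (rule image_eqI[of _ _ "\<one>"]) (auto simp: fun_eq_iff group_action_ratfun_one)
    next
      case (comp g \<tau>)
      have "g \<in> \<Gamma>" using comp(1) by auto
      with comp obtain g1 g2 where "g1 \<in> carrier G" "g = act g1" "g2 \<in> carrier G" "\<tau> = act g2" by (elim imageE) blast
      then show ?case by (intro image_eqI[of _ _ "g1 \<otimes> g2"]) (auto simp: group_action_ratfun_mult)
    qed
  qed
qed

sublocale rational_action \<Gamma> h B gen
proof (intro rational_action.intro rational_action_axioms.intro)
  show "automorphism_group \<Gamma>" by (rule automorphism_group_ratfun[OF finite_G])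
  show "\<sigma> (h x) = h x" if "\<sigma> \<in> \<Gamma>" for \<sigma> x
    using that group_action_ratfun_const[OF is_group] by auto
qed (use ring_hom_fun_rf_const algebraically_independent_vars finite_B generated_by_abz in auto)

lemma act_hom:
  assumes "g \<in> carrier G"
  shows "ring_hom_fun (act g)" "act g (h x) = h x"
  using assms hom base_fixed by auto

text \<open>
  The variables in normal form coordinates. The exponents are arbitrary natural numbers, so that
  shifts of them need no reduction modulo \<open>p\<close>.
\<close>

definition xvar :: "nat \<Rightarrow> nat \<Rightarrow> nat \<Rightarrow> ('a, 'k) ratfun" where
  "xvar i j k = rf_var (a [^] i \<otimes> b [^] j \<otimes> z [^] k)"

lemma z_pow_commute: "x \<in> carrier G \<Longrightarrow> z [^] (n::nat) \<otimes> x = x \<otimes> z [^] n"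
  using center_commute[OF center_pow[OF abz(3)]] by blast

lemma act_xvar:
  "act a (xvar i j k) = xvar (Suc i) j k" "act b (xvar i j k) = xvar i (Suc j) (k + i)"
  "act z (xvar i j k) = xvar i j (Suc k)"
proof -
  have "a \<otimes> (a [^] i \<otimes> b [^] j \<otimes> z [^] k) = a [^] Suc i \<otimes> b [^] j \<otimes> z [^] k"
    unfolding nat_pow_Suc2[OF abz(1)] by (simp add: m_assoc)
  then show "act a (xvar i j k) = xvar (Suc i) j k"
    by (simp add: xvar_def group_action_ratfun_var is_group)
  have "z [^] i \<otimes> (b [^] j \<otimes> z [^] k) = b [^] j \<otimes> z [^] k \<otimes> z [^] i"
    by (rule z_pow_commute) simp
  then have zi: "z [^] i \<otimes> (b [^] j \<otimes> z [^] k) = b [^] j \<otimes> z [^] (k + i)"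
    by (simp add: m_assoc nat_pow_mult)
  have "b \<otimes> (a [^] i \<otimes> b [^] j \<otimes> z [^] k) = (b \<otimes> a [^] i) \<otimes> (b [^] j \<otimes> z [^] k)"
    by (simp add: m_assoc)
  also have "\<dots> = a [^] i \<otimes> b \<otimes> (z [^] i \<otimes> (b [^] j \<otimes> z [^] k))"
    unfolding commutator_pow_right[OF abz commutator] by (simp add: m_assoc)
  also have "\<dots> = a [^] i \<otimes> b [^] Suc j \<otimes> z [^] (k + i)"
    unfolding zi nat_pow_Suc2[OF abz(2)] by (simp add: m_assoc)
  finally show "act b (xvar i j k) = xvar i (Suc j) (k + i)"
    by (simp add: xvar_def group_action_ratfun_var is_group)
  have "z [^] (1::nat) \<otimes> (a [^] i \<otimes> b [^] j \<otimes> z [^] k) = a [^] i \<otimes> b [^] j \<otimes> z [^] k \<otimes> z [^] (1::nat)"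
    by (rule z_pow_commute) simp
  then have "z \<otimes> (a [^] i \<otimes> b [^] j \<otimes> z [^] k) = a [^] i \<otimes> b [^] j \<otimes> z [^] Suc k"
    by (simp add: m_assoc)
  then show "act z (xvar i j k) = xvar i j (Suc k)"
    by (simp add: xvar_def group_action_ratfun_var is_group)
qed

lemma xvar_periodic: "xvar i j (k + p) = xvar i j k" "xvar i (j + p) k = xvar i j (k + d)" "xvar (i + p) j k = xvar i j (k + c)"
proof -
  have "z [^] (k + p) = z [^] k" by (simp add: powers flip: nat_pow_mult)
  then show "xvar i j (k + p) = xvar i j k" by (simp add: xvar_def)
  have "b [^] (j + p) = b [^] j \<otimes> z [^] d" by (simp add: powers flip: nat_pow_mult)
  then have "a [^] i \<otimes> b [^] (j + p) \<otimes> z [^] k = a [^] i \<otimes> b [^] j \<otimes> z [^] (d + k)"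
    by (simp add: m_assoc nat_pow_mult)
  then show "xvar i (j + p) k = xvar i j (k + d)" by (simp add: xvar_def add.commute)
  have "z [^] c \<otimes> (b [^] j \<otimes> z [^] k) = b [^] j \<otimes> z [^] k \<otimes> z [^] c"
    by (rule z_pow_commute) simp
  moreover have "a [^] (i + p) = a [^] i \<otimes> z [^] c" by (simp add: powers flip: nat_pow_mult)
  ultimately have "a [^] (i + p) \<otimes> b [^] j \<otimes> z [^] k = a [^] i \<otimes> b [^] j \<otimes> z [^] (k + c)"
    by (simp add: m_assoc nat_pow_mult)
  then show "xvar (i + p) j k = xvar i j (k + c)" by (simp add: xvar_def)
qed

lemma xvar_in_B: "xvar i j k \<in> B"
  by (simp add: xvar_def)

lemma B_eq: "B = {xvar i j k | i j k. i < p \<and> j < p \<and> k < p}"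
  by (subst carrier_normal_form) (auto simp: xvar_def)

lemma fixed_field_eq: "fixed_field G = Fix (adjoin h B)"
  by (auto simp: fixed_field_def Fix_def rational_function_field_def)

end

section \<open>Characteristic \<open>p\<close>\<close>

lemma last_outside:
  assumes "v \<notin> W" "(u ^^ n) v \<in> W"
  shows "\<exists>k. (u ^^ k) v \<notin> W \<and> u ((u ^^ k) v) \<in> W"
  using assms
proof (induction n)
  case (Suc n)
  then show ?case by (cases "(u ^^ n) v \<in> W") auto
qed simp

lemma binomial_sum_Suc:
  fixes f :: "nat \<Rightarrow> 'l::field"
  shows "(\<Sum>k\<le>Suc n. of_nat (Suc n choose k) * f k) =
    (\<Sum>k\<le>n. of_nat (n choose k) * f k) + (\<Sum>k\<le>n. of_nat (n choose k) * f (Suc k))"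
proof -
  have "(\<Sum>k\<le>n. of_nat (n choose k) * f k) = (\<Sum>k\<le>Suc n. of_nat (n choose k) * f k)"
    by (simp add: binomial_eq_0)
  also have "\<dots> = f 0 + (\<Sum>k\<le>n. of_nat (n choose Suc k) * f (Suc k))"
    by (subst sum.atMost_Suc_shift) simp
  finally have "(\<Sum>k\<le>n. of_nat (n choose k) * f k) = f 0 + (\<Sum>k\<le>n. of_nat (n choose Suc k) * f (Suc k))" .
  moreover have "(\<Sum>k\<le>Suc n. of_nat (Suc n choose k) * f k) =
      f 0 + (\<Sum>k\<le>n. of_nat (Suc n choose Suc k) * f (Suc k))"
    by (subst sum.atMost_Suc_shift) simp
  ultimately show ?thesis by (simp add: distrib_right sum.distrib)
qed

lemma funpow_minus_id_binomial:
  fixes \<sigma> :: "'l::field \<Rightarrow> 'l"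
  assumes "ring_hom_fun \<sigma>"
  shows "(\<sigma> ^^ n) x = (\<Sum>k\<le>n. of_nat (n choose k) * ((\<lambda>x. \<sigma> x - x) ^^ k) x)"
proof (induction n)
  case (Suc n)
  note h = ring_hom_funD[OF assms]
  have of_nat: "\<sigma> (of_nat m) = of_nat m" for m by (induction m) (simp_all add: h)
  define u where "u k = ((\<lambda>x. \<sigma> x - x) ^^ k) x" for k
  have "\<sigma> (u k) = u (Suc k) + u k" for k by (simp add: u_def)
  then have "(\<sigma> ^^ Suc n) x = (\<Sum>k\<le>n. of_nat (n choose k) * (u (Suc k) + u k))"
    using Suc by (simp add: h of_nat flip: u_def)
  also have "\<dots> = (\<Sum>k\<le>Suc n. of_nat (Suc n choose k) * u k)"
    unfolding binomial_sum_Suc by (simp add: distrib_left sum.distrib add.commute)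
  finally show ?case by (simp add: u_def)
qed simp

text \<open>
  The identity \<open>(\<sigma> - 1)\<^sup>p = \<sigma>\<^sup>p - 1\<close> of operators, which holds because the mixed binomial coefficients
  vanish.
\<close>

lemma funpow_prime_char:
  fixes \<sigma> :: "'l::field \<Rightarrow> 'l"
  assumes \<sigma>: "ring_hom_fun \<sigma>" and p: "Factorial_Ring.prime p" "of_nat p = (0::'l)"
  shows "((\<lambda>x. \<sigma> x - x) ^^ p) x = (\<sigma> ^^ p) x - x"
proof -
  let ?u = "\<lambda>k. ((\<lambda>x. \<sigma> x - x) ^^ k) x"
  have p0: "p \<noteq> 0" using p by auto
  have "of_nat (p choose k) * ?u k = 0" if "k \<in> {..p} - {0, p}" for k
  proof -
    have "p dvd (p choose k)" using that p by (intro dvd_choose_prime) auto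
    then have "of_nat (p choose k) = (0::'l)" using p(2) by (auto elim!: dvdE)
    then show ?thesis by simp
  qed
  then have "(\<Sum>k\<le>p. of_nat (p choose k) * ?u k) = (\<Sum>k\<in>{0, p}. of_nat (p choose k) * ?u k)"
    by (intro sum.mono_neutral_right) auto
  then show ?thesis using p0 by (simp add: funpow_minus_id_binomial[OF \<sigma>])
qed

context heisenberg_action
begin

lemma act_pow: "g \<in> carrier G \<Longrightarrow> (act g ^^ n) x = act (g [^] n) x"
proof (induction n arbitrary: x)
  case (Suc n)
  then show ?case
    using nat_pow_Suc2[of g n] by (simp add: group_action_ratfun_mult)
qed (simp add: group_action_ratfun_one)

lemma act_b_act_a: "act b (act a x) = act a (act b (act z x))"
  by (simp add: group_action_ratfun_mult commutator m_assoc)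

lemma act_z_commute: "g \<in> carrier G \<Longrightarrow> act z (act g x) = act g (act z x)"
  using center_commute[OF abz(3)] by (simp add: group_action_ratfun_mult)

text \<open>
  Modulo \<open>W\<close>, some nonzero vector of \<open>V\<close> is fixed by the whole group. Apply \<open>z - 1\<close> as often as the
  result stays outside \<open>W\<close>; the number of times is finite, as \<open>(z - 1)\<^sup>p = z\<^sup>p - 1 = 0\<close>. The result is
  fixed by \<open>z\<close> modulo \<open>W\<close>. Repeat this with \<open>b - 1\<close> and \<open>a - 1\<close>, whose \<open>p\<close>-th powers vanish modulo \<open>W\<close>
  on vectors fixed by \<open>z\<close>; the commutation relations preserve what was reached before.
\<close>

lemma exists_unipotent_vector:
  assumes char: "of_nat p = (0 :: ('a, 'k) ratfun)"
    and W: "0 \<in> W" "\<And>x y. x \<in> W \<Longrightarrow> y \<in> W \<Longrightarrow> x + y \<in> W" "\<And>x y. x \<in> W \<Longrightarrow> y \<in> W \<Longrightarrow> x - y \<in> W"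
      "\<And>g x. g \<in> gen \<Longrightarrow> x \<in> W \<Longrightarrow> g x \<in> W"
    and V: "\<And>x y. x \<in> V \<Longrightarrow> y \<in> V \<Longrightarrow> x - y \<in> V" "\<And>g x. g \<in> gen \<Longrightarrow> x \<in> V \<Longrightarrow> g x \<in> V"
    and v: "v \<in> V" "v \<notin> W"
  shows "\<exists>v'\<in>V. v' \<notin> W \<and> (\<forall>g\<in>gen. g v' - v' \<in> W)"
proof -
  define u where "u g = (\<lambda>x. act g x - x)" for g
  have h: "ring_hom_fun (act g)" if "g \<in> {a, b, z}" for g using that by (auto intro: act_hom)
  note hs = ring_hom_funD[OF h] field_hom[OF h]
  have Wu: "u g x \<in> W" if "g \<in> {a, b, z}" "x \<in> W" for g x
    using that W(3,4) by (auto simp: u_def)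
  have Vu: "(u g ^^ k) x \<in> V" if "g \<in> {a, b, z}" "x \<in> V" for g x k
    using that V by (induction k) (auto simp: u_def)
  have up: "(u g ^^ p) x = act (g [^] p) x - x" if "g \<in> {a, b, z}" for g x
  proof -
    have "g \<in> carrier G" using that by auto
    then show ?thesis unfolding u_def
      using funpow_prime_char[OF h[OF that] prime_p char] act_pow[of g p x] by simp
  qed
  have zpow: "act (z [^] n) x - x \<in> W" if "u z x \<in> W" for x and n :: nat
  proof (induction n)
    case (Suc n)
    have "act (z [^] Suc n) x - x = act z (act (z [^] n) x - x) + u z x"
      using nat_pow_Suc2[of z n] by (simp add: u_def hs group_action_ratfun_mult)
    then show ?case using Suc W(2,4) that by simp
  qed (simp add: group_action_ratfun_one W(1))
  \<comment> \<open>a vector fixed by \<open>z\<close> modulo \<open>W\<close>\<close>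
  have "(u z ^^ p) v \<in> W" using up[of z v] powers(1) W(1) by (simp add: group_action_ratfun_one)
  from last_outside[OF v(2) this]
  obtain k where k: "(u z ^^ k) v \<notin> W" "u z ((u z ^^ k) v) \<in> W" by blast
  define v1 where "v1 = (u z ^^ k) v"
  have v1: "v1 \<in> V" "v1 \<notin> W" "u z v1 \<in> W" using k Vu v(1) by (auto simp: v1_def)
  have z_inv: "u z (u g x) \<in> W" if "g \<in> {a, b, z}" "u z x \<in> W" for g x
  proof -
    have "g \<in> carrier G" using that(1) by auto
    then have "u z (u g x) = u g (u z x)"
      using that(1) by (simp add: u_def hs act_z_commute)
    then show ?thesis using Wu that by simp
  qed
  \<comment> \<open>a vector fixed by \<open>b\<close> and \<open>z\<close> modulo \<open>W\<close>\<close>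
  have "(u b ^^ p) v1 \<in> W" using up[of b v1] powers(3) zpow[OF v1(3)] by simp
  from last_outside[OF v1(2) this]
  obtain k' where k': "(u b ^^ k') v1 \<notin> W" "u b ((u b ^^ k') v1) \<in> W" by blast
  define v2 where "v2 = (u b ^^ k') v1"
  have "u z ((u b ^^ k) v1) \<in> W" for k by (induction k) (use v1(3) z_inv in auto)
  then have v2: "v2 \<in> V" "v2 \<notin> W" "u z v2 \<in> W" "u b v2 \<in> W" using k' Vu v1(1) by (auto simp: v2_def)
  have b_inv: "u b (u a x) \<in> W" if x: "u z x \<in> W" "u b x \<in> W" for x
  proof -
    have "u b (u a x) = act a (u b x + act b (u z x)) - u b x"
      by (simp add: u_def hs act_b_act_a)
    then show ?thesis using x W(2,3,4) by simp
  qed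
  \<comment> \<open>a vector fixed by the whole group modulo \<open>W\<close>\<close>
  have "(u a ^^ p) v2 \<in> W" using up[of a v2] powers(2) zpow[OF v2(3)] by simp
  from last_outside[OF v2(2) this]
  obtain l where l: "(u a ^^ l) v2 \<notin> W" "u a ((u a ^^ l) v2) \<in> W" by blast
  have "u z ((u a ^^ k) v2) \<in> W \<and> u b ((u a ^^ k) v2) \<in> W" for k
    by (induction k) (use v2(3,4) z_inv b_inv in auto)
  then show ?thesis
    using l Vu[OF _ v2(1), of a l] by (intro bexI[of _ "(u a ^^ l) v2"]) (auto simp: u_def)
qed

lemma ratfun_vector_space: "vector_space (\<lambda>(c::'k) (x :: ('a, 'k) ratfun). h c * x)"
  by unfold_locales (simp_all add: ring_hom_funD[OF base_hom] algebra_simps)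

text \<open>
  A flag of stable subspaces of the span of the variables is built one vector at a time. Every
  new vector is moved only by elements of the previous subspace, so the fixed field
  gains one generator at each step. Linear independence gives transcendence: independent vectors
  extend to a basis of the span, which generates the whole field.
\<close>

theorem rational_char_p:
  assumes "CHAR('k) = p"
  shows "rational_over h (Fix (adjoin h B))"
proof -
  interpret V: vector_space "\<lambda>(c::'k) (x :: ('a, 'k) ratfun). h c * x" by (rule ratfun_vector_space)
  have "h (of_nat n) = of_nat n" for n
    by (induction n) (simp_all add: ring_hom_funD[OF base_hom])
  then have char: "of_nat p = (0 :: ('a, 'k) ratfun)"
    using ring_hom_funD(4)[OF base_hom] of_nat_CHAR[where 'a = 'k] assms by metis
  have span_adjoin: "V.span S \<subseteq> adjoin h S" for S
  proof (rule V.span_minimal)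
    show "S \<subseteq> adjoin h S" by (rule adjoin_incl)
    show "V.subspace (adjoin h S)" by (auto simp: V.subspace_def adjoinD adjoin_base)
  qed
  have act_span: "g x \<in> V.span S"
    if g: "g \<in> gen" and S: "\<And>s. s \<in> S \<Longrightarrow> g s \<in> V.span S" and x: "x \<in> V.span S" for g x S
  proof -
    have "g \<in> \<Gamma>" using g gen_in by blast
    note hs = ring_hom_funD[OF hom[OF this]] base_fixed[OF this]
    have "V.subspace {x. g x \<in> V.span S}"
      by (auto simp: V.subspace_def hs V.span_zero V.span_add V.span_scale)
    then have "V.span S \<subseteq> {x. g x \<in> V.span S}" using S by (intro V.span_minimal) auto
    then show ?thesis using x by blast
  qed
  have spanB: "g x \<in> V.span B" if "g \<in> gen" "x \<in> V.span B" for g x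
  proof (rule act_span[OF that(1) _ that(2)])
    fix s assume "s \<in> B"
    then have "g s \<in> B" using that(1) by (auto simp: group_action_ratfun_var is_group)
    then show "g s \<in> V.span B" by (rule V.span_base)
  qed
  have extend: "\<exists>t. card t \<le> card B \<and> finite t \<and> S \<subseteq> t \<and> B \<subseteq> V.span t"
    if S: "V.independent S" "S \<subseteq> V.span B" for S
  proof -
    obtain t where t: "S \<subseteq> t" "t \<subseteq> V.span B" "V.independent t" "V.span B \<subseteq> V.span t"
      using V.maximal_independent_subset_extend[OF S(2,1)] by blast
    then have "finite t \<and> card t \<le> card B" by (intro V.independent_span_bound finite_B)
    moreover have "B \<subseteq> V.span t" using t(4) V.span_superset by blast
    ultimately show ?thesis using t(1) by blast
  qed
  have indepB: "indep (acl h) B"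
    by (rule indep_if_algebraically_independent[OF base_hom indep_B(1)])
  have "\<exists>S. finite S \<and> card S = n \<and> S \<subseteq> V.span B \<and> V.independent S \<and>
      (\<forall>g\<in>gen. \<forall>x\<in>V.span S. g x \<in> V.span S) \<and> fixed_gens S n" if "n \<le> p ^ 3" for n
    using that
  proof (induction n)
    case 0
    have "g 0 = 0" if "g \<in> gen" for g using ring_hom_funD(4)[OF hom] gen_in that by blast
    then show ?case using fixed_gens_all_fixed[of "{}"]
      by (intro exI[of _ "{}"]) (auto simp: V.independent_empty)
  next
    case (Suc n)
    from Suc.IH[OF Suc_leD[OF Suc.prems]]
    obtain S where S: "finite S" "card S = n" "S \<subseteq> V.span B" "V.independent S" "fixed_gens S n"
      and "\<forall>g\<in>gen. \<forall>x\<in>V.span S. g x \<in> V.span S"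
      by (elim exE conjE)
    then have Sg: "g x \<in> V.span S" if "g \<in> gen" "x \<in> V.span S" for g x using that by blast
    have "\<not> B \<subseteq> V.span S"
    proof
      assume "B \<subseteq> V.span S"
      then have "B \<subseteq> acl h S" using span_adjoin[of S] adjoin_subset_acl[of h S] by blast
      then have "card B \<le> card S" by (rule acl.steinitz[OF indepB finite_B S(1)])
      then show False using S(2) Suc.prems card_B by simp
    qed
    then obtain v0 where v0: "v0 \<in> B" "v0 \<notin> V.span S" by blast
    then have "v0 \<in> V.span B" by (simp add: V.span_base)
    then have "\<exists>v\<in>V.span B. v \<notin> V.span S \<and> (\<forall>g\<in>gen. g v - v \<in> V.span S)"
      using v0(2)
      by (intro exists_unipotent_vector[where W = "V.span S" and V = "V.span B"])
        (simp_all only: char V.span_zero V.span_add V.span_diff Sg spanB)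
    then obtain v where v: "v \<in> V.span B" "v \<notin> V.span S" "\<And>g. g \<in> gen \<Longrightarrow> g v - v \<in> V.span S"
      by blast
    have vS: "v \<notin> S" using v(2) V.span_base by blast
    have ind: "V.independent (insert v S)" using S(4) v(2) vS by (simp add: V.independent_insert)
    obtain t where t: "card t \<le> card B" "finite t" "insert v S \<subseteq> t" "B \<subseteq> V.span t"
      using extend[OF ind] S(3) v(1) by blast
    have "B \<subseteq> acl h t" using t(4) span_adjoin[of t] adjoin_subset_acl[of h t] by blast
    then have "indep (acl h) t" using indep_if_generating t(1,2) by simp
    then have nalg: "\<not> alg_over (adjoin h S) v"
      using t(3) vS by (intro not_alg_if_indep[of t S v]) auto
    have aff: "\<exists>\<alpha>\<in>adjoin h S. \<exists>\<beta>\<in>adjoin h S. g v = \<alpha> * v + \<beta>" if "g \<in> gen" for g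
      using v(3)[OF that] span_adjoin[of S] adjoinD(1)[of h S]
      by (intro bexI[of _ 1] bexI[of _ "g v - v"]) auto
    have sub: "V.span S \<subseteq> V.span (insert v S)" by (intro V.span_mono) auto
    have st: "g x \<in> V.span (insert v S)" if g: "g \<in> gen" and x: "x \<in> V.span (insert v S)" for g x
    proof (rule act_span[OF g _ x])
      fix s assume s: "s \<in> insert v S"
      show "g s \<in> V.span (insert v S)"
      proof (cases "s = v")
        case True
        have "g v - v \<in> V.span (insert v S)" "v \<in> V.span (insert v S)"
          using v(3)[OF g] sub by (auto intro: V.span_base)
        then have "g v - v + v \<in> V.span (insert v S)" by (rule V.span_add)
        then show ?thesis using True by simp
      next
        case False
        then have "s \<in> V.span S" using s V.span_base by blast
        then show ?thesis using Sg[OF g] sub by blast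
      qed
    qed
    have "fixed_gens (insert v S) (Suc n)" using S(5) nalg aff by (rule fixed_gens_affine)
    then show ?case using S vS v(1) ind st by (intro exI[of _ "insert v S"]) auto
  qed
  then obtain S where S: "finite S" "card S = card B" "S \<subseteq> V.span B" "V.independent S" "fixed_gens S (card B)"
    unfolding card_B by blast
  obtain t where t: "card t \<le> card B" "finite t" "S \<subseteq> t" "B \<subseteq> V.span t"
    using extend[OF S(4,3)] by blast
  then have "S = t" using S(2) by (intro card_seteq) auto
  then have "adjoin h S = adjoin h B"
    using t(4) S(3) span_adjoin[of S] span_adjoin[of B] by (intro adjoin_eqI) auto
  then show ?thesis using rational_if_fixed_gens S(5) by blast
qed

end

section \<open>Groups with a non-central element of order \<open>p\<close>\<close>

lemma sum_shift_periodic: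
  fixes f :: "nat \<Rightarrow> 'l::comm_ring_1"
  assumes "\<And>s. f (s + n) = f s"
  shows "(\<Sum>s<n. f (s + t)) = (\<Sum>s<n. f s)"
proof (induction t)
  case (Suc t)
  have "(\<Sum>s<n. f (s + Suc t)) + f t = (\<Sum>s<Suc n. f (s + t))"
    by (subst sum.lessThan_Suc_shift) (simp add: add.commute)
  also have "\<dots> = (\<Sum>s<n. f (s + t)) + f t" using assms[of t] by (simp add: add.commute)
  finally show ?case using Suc by simp
qed simp

text \<open>
  Orthogonality of the characters of a cyclic group.
\<close>

lemma fourier_inversion:
  fixes \<omega> :: "'l::field"
  assumes \<omega>: "primitive_root_of_unity n \<omega>" "of_nat n \<noteq> (0::'l)" and r: "r < n"
  shows "f r = (\<Sum>k<n. \<omega> ^ (k * r) * (\<Sum>s<n. inverse \<omega> ^ (k * s) * f s)) / of_nat n"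
proof -
  have n: "n > 0" "\<omega> ^ n = 1" using \<omega>(1) by (auto simp: primitive_root_of_unity_def)
  then have \<omega>0: "\<omega> \<noteq> 0" by (metis power_0_left not_gr_zero zero_neq_one)
  have ortho: "(\<Sum>k<n. \<omega> ^ (k * r) * inverse \<omega> ^ (k * s)) = (if s = r then of_nat n else 0)" if s: "s < n" for s
  proof -
    define z where "z = \<omega> ^ r * inverse \<omega> ^ s"
    have sum: "(\<Sum>k<n. \<omega> ^ (k * r) * inverse \<omega> ^ (k * s)) = (\<Sum>k<n. z ^ k)"
      by (simp add: z_def power_mult_distrib mult.commute flip: power_mult)
    show ?thesis
    proof (cases "s = r")
      case True
      then have "z = 1" using \<omega>0 by (simp add: z_def power_inverse)
      then show ?thesis using True sum by simp
    next
      case False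
      have "z \<noteq> 1"
      proof
        assume "z = 1"
        then have eq: "\<omega> ^ r = \<omega> ^ s" using \<omega>0 by (simp add: z_def power_inverse field_simps)
        have "n dvd s - r" if "r \<le> s" "\<omega> ^ r = \<omega> ^ s" for r s
        proof -
          have "\<omega> ^ s = \<omega> ^ r * \<omega> ^ (s - r)" using that(1) by (simp flip: power_add)
          then have "\<omega> ^ (s - r) = 1" using that(2) \<omega>0 by simp
          then show ?thesis by (rule primitive_root_pow_eq_1[OF \<omega>(1)])
        qed
        from this[of r s] this[of s r] show False
          using eq False r s by (cases "r \<le> s") (auto dest: dvd_imp_le)
      qed
      moreover have "z ^ n = 1"
        using n(2) by (simp add: z_def power_mult_distrib power_inverse mult.commute flip: power_mult)
          (simp add: power_mult)
      ultimately show ?thesis using root_of_unity_sum[of z n] False sum by simp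
    qed
  qed
  have "(\<Sum>k<n. \<omega> ^ (k * r) * (\<Sum>s<n. inverse \<omega> ^ (k * s) * f s)) =
      (\<Sum>s<n. (\<Sum>k<n. \<omega> ^ (k * r) * inverse \<omega> ^ (k * s)) * f s)"
    unfolding sum_distrib_left sum_distrib_right by (subst sum.swap) (simp add: mult_ac)
  also have "\<dots> = (\<Sum>s<n. if s = r then of_nat n * f s else 0)"
    by (intro sum.cong) (simp_all add: ortho)
  also have "\<dots> = of_nat n * f r" using r by simp
  finally show ?thesis using \<omega>(2) by simp
qed

lemma fourier_mem:
  fixes \<omega> :: "'l::field"
  assumes \<omega>: "primitive_root_of_unity n \<omega>" "of_nat n \<noteq> (0::'l)"
    and F: "is_subfield F" "\<omega> \<in> F" "\<And>k. k < n \<Longrightarrow> (\<Sum>s<n. inverse \<omega> ^ (k * s) * f s) \<in> F" and r: "r < n"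
  shows "f r \<in> F"
  by (subst fourier_inversion[OF \<omega> r, of f]) (intro is_subfieldD[OF F(1)] F; simp)

lemma alg_over_root:
  assumes F: "is_subfield F" and x: "x ^ n \<in> F" "n > 0"
  shows "alg_over F x"
proof -
  define P where "P = Polynomial.monom 1 n - [:x ^ n:]"
  have "poly.coeff P n = 1" using x(2) by (cases n) (auto simp: P_def coeff_pCons)
  then have "P \<noteq> 0" by auto
  moreover have "P \<in> polys_over F"
    unfolding P_def by (intro polys_over_intros[OF F] is_subfieldD(1)[OF F] x)
  moreover have "poly P x = 0" by (simp add: P_def poly_monom)
  ultimately show ?thesis by (auto simp: alg_over_def)
qed

text \<open>
  If \<open>b\<close> has order \<open>p\<close>, then \<open>b\<close> and \<open>z\<close> generate a normal subgroup of type \<open>(p, p)\<close>. Its characters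
  have values in \<open>K\<close>, and the regular representation is a sum of representations induced from them.
\<close>

locale heisenberg_split = heisenberg_action G p a b z c d K
  for G (structure) and p a b z c d and K :: "'k::field itself" +
  fixes \<zeta> :: 'k
  assumes \<zeta>: "primitive_root_of_unity p \<zeta>"
    and not_char: "CHAR('k) \<noteq> p"
    and b_pow: "b [^] p = \<one>"
begin

abbreviation \<omega> :: "('a, 'k) ratfun" where "\<omega> \<equiv> h \<zeta>"

abbreviation \<theta> :: "('a, 'k) ratfun" where "\<theta> \<equiv> inverse (h \<zeta>)"

lemmas h_hom = ring_hom_funD[OF base_hom] field_hom[OF base_hom]

lemma \<omega>: "primitive_root_of_unity p \<omega>"
proof -
  have "\<omega> ^ m = 1 \<longleftrightarrow> \<zeta> ^ m = 1" for m
    using h_hom(13)[of "\<zeta> ^ m" 1] by (simp add: h_hom(1,5))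
  then show ?thesis using \<zeta> by (simp add: primitive_root_of_unity_def)
qed

lemma \<omega>_pow: "\<omega> ^ p = 1" and \<omega>_nonzero: "\<omega> \<noteq> 0"
proof -
  show "\<omega> ^ p = 1" using \<omega> by (simp add: primitive_root_of_unity_def)
  then show "\<omega> \<noteq> 0" using p_gt by (metis power_0_left not_gr_zero zero_neq_one)
qed

lemma p_nonzero: "of_nat p \<noteq> (0 :: ('a, 'k) ratfun)"
proof -
  have "h (of_nat n) = of_nat n" for n by (induction n) (simp_all add: h_hom)
  moreover have "of_nat p \<noteq> (0 :: 'k)"
  proof
    assume "of_nat p = (0 :: 'k)"
    then have "CHAR('k) dvd p" by (simp add: of_nat_eq_0_iff_char_dvd)
    then show False using not_char prime_p by (auto simp: prime_nat_iff)
  qed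
  ultimately show ?thesis using h_hom(12) by metis
qed

lemma act_\<omega>: "g \<in> carrier G \<Longrightarrow> act g \<omega> = \<omega>" "g \<in> carrier G \<Longrightarrow> act g \<theta> = \<theta>"
  using act_hom(2) field_hom(3)[OF act_hom(1)] by simp_all

lemma \<omega>_in: "\<omega> ^ n \<in> adjoin h S" "\<theta> ^ n \<in> adjoin h S"
  by (intro adjoinD adjoin_base)+

lemma \<theta>_shift: "\<theta> ^ n = \<omega> ^ m * \<theta> ^ (n + m)"
  using \<omega>_nonzero by (simp add: power_add power_inverse)

lemma \<theta>_periodic: "\<theta> ^ (n + p * m) = \<theta> ^ n"
  using \<omega>_pow by (simp add: power_add power_mult power_inverse)

lemmas act_simps = ring_hom_funD[OF act_hom(1)] field_hom[OF act_hom(1)] act_\<omega>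

text \<open>
  The translate by \<open>a\<^sup>j\<close> of the eigenvector for the character of \<open>\<langle>b, z\<rangle>\<close> that takes the value \<open>\<omega>\<^sup>k\<close> at \<open>b\<close>
  and \<open>\<omega>\<^sup>i\<close> at \<open>z\<close>.
\<close>

definition Y :: "nat \<Rightarrow> nat \<Rightarrow> nat \<Rightarrow> ('a, 'k) ratfun" where
  "Y i k j = (\<Sum>r<p. \<theta> ^ (k * r) * (\<Sum>s<p. \<theta> ^ (i * s) * xvar j r s))"

lemma xvar_shift_s: "(\<Sum>s<p. \<theta> ^ (i * s) * xvar j r (s + t)) = \<omega> ^ (i * t) * (\<Sum>s<p. \<theta> ^ (i * s) * xvar j r s)"
proof -
  have "(\<Sum>s<p. \<theta> ^ (i * s) * xvar j r (s + t)) =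
      \<omega> ^ (i * t) * (\<Sum>s<p. \<theta> ^ (i * (s + t)) * xvar j r (s + t))"
    unfolding sum_distrib_left by (intro sum.cong refl, subst \<theta>_shift[of _ "i * t"])
      (simp add: algebra_simps)
  also have "(\<Sum>s<p. \<theta> ^ (i * (s + t)) * xvar j r (s + t)) = (\<Sum>s<p. \<theta> ^ (i * s) * xvar j r s)"
    by (rule sum_shift_periodic[of "\<lambda>s. \<theta> ^ (i * s) * xvar j r s"])
      (use \<theta>_periodic[of "i * s" i for s] in \<open>simp add: xvar_periodic distrib_left mult.commute[of i p]\<close>)
  finally show ?thesis .
qed

lemma xvar_periodic_r: "xvar j (r + p) s = xvar j r s"
proof -
  have "b [^] (r + p) = b [^] r" using b_pow by (simp flip: nat_pow_mult)
  then show ?thesis by (simp add: xvar_def)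
qed

lemma act_Y: "act a (Y i k j) = Y i k (Suc j)" "act b (Y i k j) = \<omega> ^ (k + i * j) * Y i k j"
  "act z (Y i k j) = \<omega> ^ i * Y i k j"
proof -
  show "act a (Y i k j) = Y i k (Suc j)" by (simp add: Y_def act_simps act_xvar)
  have "act z (Y i k j) = (\<Sum>r<p. \<theta> ^ (k * r) * (\<Sum>s<p. \<theta> ^ (i * s) * xvar j r (s + 1)))"
    by (simp add: Y_def act_simps act_xvar)
  then show "act z (Y i k j) = \<omega> ^ i * Y i k j"
    unfolding xvar_shift_s by (simp add: Y_def sum_distrib_left mult_ac)
  define f where "f r = (\<Sum>s<p. \<theta> ^ (i * s) * xvar j r s)" for r
  have "act b (Y i k j) = (\<Sum>r<p. \<theta> ^ (k * r) * (\<Sum>s<p. \<theta> ^ (i * s) * xvar j (Suc r) (s + j)))"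
    by (simp add: Y_def act_simps act_xvar)
  also have "\<dots> = (\<Sum>r<p. \<omega> ^ (k + i * j) * (\<theta> ^ (k * (r + 1)) * f (r + 1)))"
    unfolding xvar_shift_s
    by (intro sum.cong refl, subst \<theta>_shift[of _ k]) (simp add: f_def power_add algebra_simps)
  also have "\<dots> = \<omega> ^ (k + i * j) * (\<Sum>r<p. \<theta> ^ (k * (r + 1)) * f (r + 1))"
    by (simp only: sum_distrib_left)
  also have "(\<Sum>r<p. \<theta> ^ (k * (r + 1)) * f (r + 1)) = (\<Sum>r<p. \<theta> ^ (k * r) * f r)"
    by (rule sum_shift_periodic[of "\<lambda>r. \<theta> ^ (k * r) * f r"])
      (use \<theta>_periodic[of "k * r" k for r] in \<open>simp add: f_def xvar_periodic_r distrib_left mult.commute[of k p]\<close>)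
  finally show "act b (Y i k j) = \<omega> ^ (k + i * j) * Y i k j" by (simp add: Y_def f_def)
qed

lemma Y_shift: "Y i k (j + p) = \<omega> ^ (i * c) * Y i k j"
proof -
  have "Y i k (j + p) = (\<Sum>r<p. \<theta> ^ (k * r) * (\<Sum>s<p. \<theta> ^ (i * s) * xvar j r (s + c)))"
    by (simp add: Y_def xvar_periodic)
  then show ?thesis
    unfolding xvar_shift_s by (simp add: Y_def sum_distrib_left mult_ac)
qed

lemma fourier_adjoin:
  assumes "\<And>k. k < p \<Longrightarrow> (\<Sum>s<p. \<theta> ^ (k * s) * f s) \<in> adjoin h S" and "r < p"
  shows "f r \<in> adjoin h S"
  using \<omega> p_nonzero adjoin_subfield[of h S] adjoin_base[of h \<zeta> S] assms by (rule fourier_mem)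

lemma xvar_from_Y:
  assumes "\<And>i k. i < p \<Longrightarrow> k < p \<Longrightarrow> Y i k j \<in> adjoin h S" and "r < p" "s < p"
  shows "xvar j r s \<in> adjoin h S"
proof -
  have "(\<Sum>s<p. \<theta> ^ (i * s) * xvar j r s) \<in> adjoin h S" if "i < p" for i
    by (rule fourier_adjoin[OF _ assms(2)]) (use assms(1)[OF that] in \<open>simp add: Y_def\<close>)
  then show ?thesis by (rule fourier_adjoin[OF _ assms(3)])
qed

lemma B_subset_adjoin_Y:
  assumes "\<And>i k j. i < p \<Longrightarrow> k < p \<Longrightarrow> j < p \<Longrightarrow> Y i k j \<in> adjoin h S"
  shows "B \<subseteq> adjoin h S"
  unfolding B_eq using xvar_from_Y[of _ S] assms by auto

lemma Y_nonzero:
  assumes "i < p" "k < p" "j < p"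
  shows "Y i k j \<noteq> 0"
proof -
  let ?C = "(\<lambda>(i, k, j). Y i k j) ` ({..<p} \<times> {..<p} \<times> {..<p})"
  have "B \<subseteq> adjoin h ?C"
    using adjoin_incl[of ?C h] by (intro B_subset_adjoin_Y) force
  then have "B \<subseteq> acl h ?C" using adjoin_subset_acl by blast
  moreover have "card ?C \<le> card ({..<p} \<times> {..<p} \<times> {..<p})" by (intro card_image_le) simp
  then have "card ?C \<le> card B" by (simp add: card_B card_cartesian_product power3_eq_cube)
  ultimately have "indep (acl h) ?C" by (intro indep_if_generating) auto
  then show ?thesis using assms by (intro nonzero_if_indep) force+
qed

text \<open>
  The basis of a faithful \<open>p\<close>-dimensional representation. The action is monomial: \<open>a\<close> permutes the
  lines and \<open>b\<close>, \<open>z\<close> are diagonal.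
\<close>

definition y :: "nat \<Rightarrow> ('a, 'k) ratfun" where "y j = Y 1 0 j"

lemma act_y: "act a (y j) = y (Suc j)" "act b (y j) = \<omega> ^ j * y j" "act z (y j) = \<omega> * y j"
  by (simp_all add: y_def act_Y)

lemma y_shift: "y (j + p) = \<omega> ^ c * y j"
  using Y_shift[of 1 0 j] by (simp add: y_def)

lemma y_nonzero: "y j \<noteq> 0"
proof (induction j rule: less_induct)
  case (less j)
  show ?case
  proof (cases "j < p")
    case True
    then show ?thesis using Y_nonzero[of 1 0 j] p_gt by (simp add: y_def)
  next
    case False
    then show ?thesis using y_shift[of "j - p"] less.IH[of "j - p"] p_gt \<omega>_nonzero by simp
  qed
qed

text \<open>
  The quotients \<open>u\<close> are fixed by \<open>z\<close>, multiplied by \<open>\<omega>\<close> by \<open>b\<close> and permuted cyclically by \<open>a\<close>. They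
  satisfy the relation that the product of a period is a power of \<open>\<omega>\<close>.
\<close>

definition u :: "nat \<Rightarrow> ('a, 'k) ratfun" where "u j = y (Suc j) / y j"

lemma act_u: "act a (u j) = u (Suc j)" "act b (u j) = \<omega> * u j" "act z (u j) = u j"
  using \<omega>_nonzero by (simp_all add: u_def act_simps act_y)

lemma u_periodic: "u (j + p) = u j"
  using y_shift[of j] y_shift[of "Suc j"] \<omega>_nonzero by (simp add: u_def)

lemma prod_u: "(\<Prod>j<n. u j) = y n / y 0"
  by (induction n) (use y_nonzero in \<open>simp_all add: u_def\<close>)

lemma u_nonzero: "u j \<noteq> 0"
  using y_nonzero by (simp add: u_def)

definition U :: "nat \<Rightarrow> ('a, 'k) ratfun" where "U m = (\<Sum>j<p. \<theta> ^ (m * j) * u j)"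

lemma act_U: "act a (U m) = \<omega> ^ m * U m" "act b (U m) = \<omega> * U m" "act z (U m) = U m"
proof -
  show "act b (U m) = \<omega> * U m" "act z (U m) = U m"
    by (simp_all add: U_def act_simps act_u sum_distrib_left mult_ac)
  have "act a (U m) = (\<Sum>j<p. \<omega> ^ m * (\<theta> ^ (m * (j + 1)) * u (j + 1)))"
    unfolding U_def by (simp add: act_simps act_u, intro sum.cong refl, subst \<theta>_shift[of _ m])
      (simp add: algebra_simps)
  also have "\<dots> = \<omega> ^ m * (\<Sum>j<p. \<theta> ^ (m * (j + 1)) * u (j + 1))" by (simp only: sum_distrib_left)
  also have "(\<Sum>j<p. \<theta> ^ (m * (j + 1)) * u (j + 1)) = U m"
    unfolding U_def by (rule sum_shift_periodic[of "\<lambda>j. \<theta> ^ (m * j) * u j"])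
      (use \<theta>_periodic[of "m * j" m for j] in \<open>simp add: u_periodic distrib_left mult.commute[of m p]\<close>)
  finally show "act a (U m) = \<omega> ^ m * U m" .
qed

text \<open>
  The factor \<open>y\<^sub>j\<^sup>i\<close> transforms under \<open>z\<close> as \<open>Y i k j\<close> does, and under \<open>b\<close> up to \<open>\<omega>\<^sup>k\<close>. After dividing by
  it, \<open>a\<close> permutes the quotients without a twist, so that a Fourier transform diagonalizes the
  whole group.
\<close>

definition f :: "nat \<Rightarrow> nat \<Rightarrow> nat \<Rightarrow> ('a, 'k) ratfun" where "f i k j = Y i k j / y j ^ i"

lemma act_f: "act a (f i k j) = f i k (Suc j)" "act b (f i k j) = \<omega> ^ k * f i k j" "act z (f i k j) = f i k j"
  using \<omega>_nonzero
  by (simp_all add: f_def act_simps act_y act_Y power_mult_distrib power_add mult.commute[of i j] flip: power_mult)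

lemma f_periodic: "f i k (j + p) = f i k j"
  using \<omega>_nonzero
  by (simp add: f_def y_shift Y_shift power_mult_distrib mult.commute[of i c] flip: power_mult)

definition Q :: "nat \<Rightarrow> nat \<Rightarrow> nat \<Rightarrow> ('a, 'k) ratfun" where
  "Q i k m = (\<Sum>j<p. \<theta> ^ (m * j) * f i k j)"

lemma act_Q: "act a (Q i k m) = \<omega> ^ m * Q i k m" "act b (Q i k m) = \<omega> ^ k * Q i k m"
  "act z (Q i k m) = Q i k m"
proof -
  show "act b (Q i k m) = \<omega> ^ k * Q i k m" "act z (Q i k m) = Q i k m"
    by (simp_all add: Q_def act_simps act_f sum_distrib_left mult_ac)
  have "act a (Q i k m) = (\<Sum>j<p. \<omega> ^ m * (\<theta> ^ (m * (j + 1)) * f i k (j + 1)))"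
    unfolding Q_def by (simp add: act_simps act_f, intro sum.cong refl, subst \<theta>_shift[of _ m])
      (simp add: algebra_simps)
  also have "\<dots> = \<omega> ^ m * (\<Sum>j<p. \<theta> ^ (m * (j + 1)) * f i k (j + 1))" by (simp only: sum_distrib_left)
  also have "(\<Sum>j<p. \<theta> ^ (m * (j + 1)) * f i k (j + 1)) = Q i k m"
    unfolding Q_def by (rule sum_shift_periodic[of "\<lambda>j. \<theta> ^ (m * j) * f i k j"])
      (use \<theta>_periodic[of "m * j" m for j] in \<open>simp add: f_periodic distrib_left mult.commute[of m p]\<close>)
  finally show "act a (Q i k m) = \<omega> ^ m * Q i k m" .
qed

text \<open>
  Together these two sets generate the function field, and there are \<open>p\<^sup>3\<close> of them: the last \<open>u\<close> of a
  period is determined by the others, and the pair \<open>(1, 0)\<close> is left out because it belongs to the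
  basis \<open>y\<close> itself, of which only \<open>y 0\<close> is needed.
\<close>

definition Us :: "('a, 'k) ratfun set" where "Us = u ` {..<p - 1}"

definition Qs :: "('a, 'k) ratfun set" where
  "Qs = insert (y 0) ((\<lambda>((i, k), m). Q i k m) ` (({..<p} \<times> {..<p} - {(1, 0)}) \<times> {..<p}))"

lemma card_Us: "finite Us" "card Us \<le> p - 1"
  using card_image_le[of "{..<p - 1}" u] by (auto simp: Us_def)

lemma card_Qs: "finite Qs" "card Qs \<le> Suc ((p * p - 1) * p)"
proof -
  let ?A = "({..<p} \<times> {..<p} - {(1, 0)}) \<times> {..<p}"
  have "(1, 0) \<in> {..<p} \<times> {..<p}" using p_gt by auto
  then have "card ?A = (p * p - 1) * p" by (simp add: card_cartesian_product)
  moreover have "card ((\<lambda>((i, k), m). Q i k m) ` ?A) \<le> card ?A" by (intro card_image_le) simp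
  ultimately have "card ((\<lambda>((i, k), m). Q i k m) ` ?A) \<le> (p * p - 1) * p" by (simp only:)
  then show "finite Qs" "card Qs \<le> Suc ((p * p - 1) * p)"
    unfolding Qs_def by (simp_all only: finite_insert finite_imageI finite_cartesian_product
        finite_Diff finite_lessThan card_insert_if) (auto simp: le_SucI)
qed

lemma card_total: "p - 1 + Suc ((p * p - 1) * p) = p ^ 3"
proof -
  have "p * p \<ge> 1" using p_gt by (simp add: Suc_le_eq)
  then have "(p * p - 1) * p = p ^ 3 - p" by (simp add: diff_mult_distrib power3_eq_cube)
  moreover have "p \<le> p ^ 3" using p_gt by (simp add: self_le_power)
  ultimately show ?thesis using p_gt by simp
qed

lemma u_in: "j < p \<Longrightarrow> u j \<in> adjoin h Us"
proof -
  assume j: "j < p"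
  have *: "u j \<in> adjoin h Us" if "j < p - 1" for j
    using that adjoin_incl[of Us h] by (auto simp: Us_def)
  show ?thesis
  proof (cases "j < p - 1")
    case False
    then have p: "p = Suc j" using j by simp
    have "(\<Prod>i<j. u i) * u j = \<omega> ^ c"
      using prod_u[of p] y_shift[of 0] y_nonzero[of 0] unfolding p by simp
    moreover have "(\<Prod>i<j. u i) \<noteq> 0" using u_nonzero by simp
    ultimately have "u j = \<omega> ^ c / (\<Prod>i<j. u i)" by (simp add: field_simps)
    also have "\<dots> \<in> adjoin h Us" using * p by (intro adjoinD \<omega>_in) auto
    finally show ?thesis .
  qed (use * in blast)
qed

lemma U_in: "U m \<in> adjoin h Us"
  unfolding U_def by (intro adjoinD \<omega>_in u_in) auto

lemma B_subset_adjoin_Us_Qs: "B \<subseteq> adjoin h (Us \<union> Qs)"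
proof (rule B_subset_adjoin_Y)
  let ?F = "adjoin h (Us \<union> Qs)"
  fix i k j assume ikj: "i < p" "k < p" "j < p"
  have uF: "u j \<in> ?F" if "j < p" for j
    using u_in[OF that] adjoin_mono[of Us "Us \<union> Qs" h] by auto
  have Q_in: "q \<in> ?F" if "q \<in> Qs" for q using that adjoin_incl[of "Us \<union> Qs" h] by blast
  have yF: "y j \<in> ?F" if "j < p" for j
    using that
  proof (induction j)
    case 0
    show ?case by (rule Q_in) (simp add: Qs_def)
  next
    case (Suc j)
    have "y (Suc j) = u j * y j" using y_nonzero by (simp add: u_def)
    then show ?case using Suc uF[of j] by (simp add: adjoinD)
  qed
  show "Y i k j \<in> ?F"
  proof (cases "(i, k) = (1, 0)")
    case False
    have "f i k j \<in> ?F"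
    proof (rule fourier_adjoin[OF _ ikj(3)])
      fix m assume "m < p"
      then have "Q i k m \<in> Qs" using False ikj by (force simp: Qs_def)
      then show "(\<Sum>j<p. \<theta> ^ (m * j) * f i k j) \<in> ?F" using Q_in by (simp add: Q_def)
    qed
    moreover have "Y i k j = f i k j * y j ^ i" using y_nonzero by (simp add: f_def)
    ultimately show ?thesis using yF[OF ikj(3)] by (simp add: adjoinD)
  qed (use yF ikj in \<open>simp add: y_def\<close>)
qed

text \<open>
  The Fourier transform is injective, and \<open>u\<close> does not vanish.
\<close>

lemma U_nonzero: "\<exists>m<p. U m \<noteq> 0"
proof (rule ccontr)
  assume "\<not> ?thesis"
  then have "U m \<in> {0}" if "m < p" for m using that by auto
  then have "u 0 = 0"
    using fourier_inversion[OF \<omega> p_nonzero, of 0 u] p_gt by (simp add: U_def)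
  then show False using u_nonzero by blast
qed

text \<open>
  The quotients \<open>e m = U m / U m0\<close> are fixed by \<open>b\<close> and \<open>z\<close>, and \<open>a\<close> multiplies them by constants, so the
  fixed field of \<open>K(e)\<close> has \<open>p - 1\<close> generators. The field \<open>K(u)\<close> is obtained from \<open>K(e)\<close> by adjoining
  \<open>U m0\<close>, whose \<open>p\<close>-th power lies in \<open>K(e)\<close> by the relation between the \<open>u\<close>. As \<open>b\<close> multiplies \<open>U m0\<close>
  by \<open>\<omega>\<close>, this adds no invariants. All further generators are multiplied by elements of \<open>K(u)\<close>.
\<close>

theorem rational_split: "rational_over h (Fix (adjoin h B))"
proof -
  obtain m0 where m0: "m0 < p" "U m0 \<noteq> 0" using U_nonzero by blast
  define e where "e m = U m / U m0" for m
  define Es where "Es = e ` ({..<p} - {m0})"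
  have card_Es: "finite Es" "card Es \<le> p - 1"
    using card_image_le[of "{..<p} - {m0}" e] m0(1) by (auto simp: Es_def)
  have e_in: "e m \<in> adjoin h Es" if "m < p" for m
    using that adjoin_incl[of Es h] m0(2) adjoinD(1)[of h Es]
    by (cases "m = m0") (auto simp: Es_def e_def)
  have act_e: "act a (e m) = \<omega> ^ m / \<omega> ^ m0 * e m" "act b (e m) = e m" "act z (e m) = e m" for m
    using \<omega>_nonzero by (simp_all add: e_def act_simps act_U)
  \<comment> \<open>the numbers \<open>e m\<close> are the Fourier transform of these quotients\<close>
  have l_in: "u j / U m0 \<in> adjoin h Es" if "j < p" for j
  proof (rule fourier_adjoin[OF _ that])
    fix m assume "m < p"
    moreover have "(\<Sum>j<p. \<theta> ^ (m * j) * (u j / U m0)) = e m"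
      by (simp add: e_def U_def sum_divide_distrib)
    ultimately show "(\<Sum>j<p. \<theta> ^ (m * j) * (u j / U m0)) \<in> adjoin h Es" using e_in by simp
  qed
  have U_pow: "U m0 ^ p \<in> adjoin h Es"
  proof -
    have "(\<Prod>j<p. u j / U m0) = \<omega> ^ c / U m0 ^ p"
      using prod_u[of p] y_shift[of 0] y_nonzero[of 0] by (simp add: prod_dividef)
    then have "U m0 ^ p = \<omega> ^ c / (\<Prod>j<p. u j / U m0)" using m0(2) \<omega>_nonzero by simp
    also have "\<dots> \<in> adjoin h Es"
    proof (rule adjoinD(8)[OF \<omega>_in(1)])
      show "(\<Prod>j<p. u j / U m0) \<in> adjoin h Es" by (rule adjoinD(11)) (use l_in in simp)
    qed
    finally show ?thesis .
  qed
  have Us_eq: "adjoin h Us = ext (adjoin h Es) (U m0)"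
    unfolding adjoin_insert[symmetric]
  proof (rule adjoin_eqI)
    have sub: "adjoin h Es \<subseteq> adjoin h (insert (U m0) Es)" by (intro adjoin_mono) auto
    have "u j \<in> adjoin h (insert (U m0) Es)" if "j < p" for j
    proof -
      have "u j = u j / U m0 * U m0" using m0(2) by simp
      also have "\<dots> \<in> adjoin h (insert (U m0) Es)"
        using l_in[OF that] sub adjoin_incl[of "insert (U m0) Es" h] by (intro adjoinD(6)) auto
      finally show ?thesis .
    qed
    then show "Us \<subseteq> adjoin h (insert (U m0) Es)" by (auto simp: Us_def)
    show "insert (U m0) Es \<subseteq> adjoin h Us" using U_in by (auto simp: Es_def e_def intro: adjoinD)
  qed
  \<comment> \<open>the counting principle applies to \<open>Us\<close> and to \<open>Es\<close>, each completed by \<open>Qs\<close>\<close>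
  have card: "card (S \<union> Qs) \<le> card B" if "card S \<le> p - 1" for S
    using card_Un_le[of S Qs] card_Qs(2) that card_total card_B by linarith
  have indep_Us: "indep (acl h) (Us \<union> Qs)"
    using B_subset_adjoin_Us_Qs adjoin_subset_acl[of h "Us \<union> Qs"] card[OF card_Us(2)] card_Us(1) card_Qs(1)
    by (intro indep_if_generating) auto
  have "alg_over (adjoin h Es) (U m0)"
    using U_pow p_gt by (intro alg_over_root adjoin_subfield)
  then have "U m0 \<in> acl h Es" by (simp add: acl_def)
  then have "adjoin h Us \<subseteq> acl h Es"
    unfolding Us_eq using adjoin_subset_acl by (intro ext_least acl_subfield) auto
  moreover have "acl h Es \<subseteq> acl h (Es \<union> Qs)" by (intro acl.cl_mono) auto
  ultimately have "Us \<subseteq> acl h (Es \<union> Qs)" using adjoin_incl[of Us h] by blast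
  then have "Us \<union> Qs \<subseteq> acl h (Es \<union> Qs)" using acl.cl_incl[of "Es \<union> Qs" h] by blast
  then have "acl h (Us \<union> Qs) \<subseteq> acl h (Es \<union> Qs)" by (rule acl.cl_subset)
  then have "B \<subseteq> acl h (Es \<union> Qs)"
    using B_subset_adjoin_Us_Qs adjoin_subset_acl[of h "Us \<union> Qs"] by blast
  then have "indep (acl h) (Es \<union> Qs)"
    using card[OF card_Es(2)] card_Es(1) card_Qs(1) by (intro indep_if_generating) auto
  then have indep_Es: "indep (acl h) Es" by (rule indep_subset) simp
  have "fixed_gens ({} \<union> Es) (card ({} :: ('a, 'k) ratfun set) + card Es)"
  proof (rule fixed_gens_diagonal)
    fix g t assume g: "g \<in> gen" and "t \<in> Es"
    then obtain m where t: "t = e m" by (auto simp: Es_def)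
    have \<alpha>: "\<omega> ^ m / \<omega> ^ m0 \<in> adjoin h {}" "1 \<in> adjoin h {}" by (intro adjoinD \<omega>_in)+
    have "g t = \<omega> ^ m / \<omega> ^ m0 * t \<or> g t = 1 * t"
      using g act_e[of m] unfolding t by (elim insertE) simp_all
    then show "\<exists>\<alpha>\<in>adjoin h {}. g t = \<alpha> * t" using \<alpha> by blast
  qed (use fixed_gens_all_fixed[of "{}"] card_Es indep_Es in auto)
  then have Es: "fixed_gens Es (p - 1)" using card_Es by (auto intro: fixed_gens_mono)
  \<comment> \<open>passing to \<open>K(u)\<close> adds no invariants, since \<open>b\<close> multiplies \<open>U m0\<close> by \<open>\<omega>\<close>\<close>
  have "Fix (adjoin h Us) = Fix (adjoin h Es)"
  proof
    have "adjoin h Es \<subseteq> adjoin h Us" unfolding Us_eq by (intro ext_incl adjoin_subfield)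
    then show "Fix (adjoin h Es) \<subseteq> Fix (adjoin h Us)" by (auto simp: Fix_def)
    show "Fix (adjoin h Us) \<subseteq> Fix (adjoin h Es)"
    proof
      fix x assume x: "x \<in> Fix (adjoin h Us)"
      have "is_subfield {x. act b x = x}"
        by (simp add: is_subfield_def act_simps)
      then have "adjoin h Es \<subseteq> {x. act b x = x}"
        using act_e(2) act_hom(2) by (intro adjoin_least) (auto simp: Es_def)
      then have fixed: "act b x = x" if "x \<in> adjoin h Es" for x using that by blast
      have "x \<in> adjoin h Us" "\<forall>\<sigma>\<in>\<Gamma>. \<sigma> x = x" using x by (simp_all add: Fix_def)
      then have x': "x \<in> ext (adjoin h Es) (U m0)" "act b x = x" using Us_eq by auto
      have "x \<in> adjoin h Es"
        by (rule Kummer_fixed[where \<sigma> = "act b" and \<zeta> = \<omega> and n = p and \<alpha> = "U m0"])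
          (simp_all add: act_hom(1) adjoin_subfield fixed adjoin_base \<omega> p_nonzero act_U(2) U_pow x')
      then show "x \<in> Fix (adjoin h Es)" using x by (simp add: Fix_def)
    qed
  qed
  moreover have "stable (adjoin h Us)"
  proof (rule stable_adjoin)
    fix g s assume "g \<in> gen" "s \<in> Us"
    then show "g s \<in> adjoin h Us"
      using u_in by (auto simp: Us_def act_u intro!: adjoinD adjoin_base)
  qed
  ultimately have Us: "fixed_gens Us (p - 1)" using Es by (simp add: fixed_gens_def)
  have "fixed_gens (Us \<union> Qs) (p - 1 + card Qs)"
  proof (rule fixed_gens_diagonal[OF Us card_Qs(1) indep_Us])
    fix g t assume g: "g \<in> gen" and t: "t \<in> Qs"
    show "\<exists>\<alpha>\<in>adjoin h Us. g t = \<alpha> * t"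
    proof (cases "t = y 0")
      case True
      have "y (Suc 0) = u 0 * y 0" using y_nonzero by (simp add: u_def)
      then have "g t = u 0 * t \<or> g t = 1 * t \<or> g t = \<omega> * t"
        using g act_y[of 0] unfolding True by (elim insertE) simp_all
      moreover have "u 0 \<in> adjoin h Us" "1 \<in> adjoin h Us" "\<omega> \<in> adjoin h Us"
        using u_in[of 0] p_gt adjoinD(1) adjoin_base by auto
      ultimately show ?thesis by blast
    next
      case False
      then obtain i k m where t: "t = Q i k m" using t by (auto simp: Qs_def)
      have "g t = \<omega> ^ m * t \<or> g t = \<omega> ^ k * t \<or> g t = 1 * t"
        using g act_Q[of i k m] unfolding t by (elim insertE) simp_all
      then show ?thesis using \<omega>_in(1) adjoinD(1) by blast
    qed
  qed
  then have "fixed_gens (Us \<union> Qs) (card B)"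
    using card_Qs(2) card_total card_B by (auto intro: fixed_gens_mono)
  moreover have "adjoin h (Us \<union> Qs) = adjoin h B"
  proof (rule adjoin_eqI[OF _ B_subset_adjoin_Us_Qs])
    have xB: "xvar i j k \<in> adjoin h B" for i j k
      using xvar_in_B adjoin_incl[of B h] by blast
    have YB: "Y i k j \<in> adjoin h B" for i k j
      unfolding Y_def by (intro adjoinD \<omega>_in xB)
    show "Us \<union> Qs \<subseteq> adjoin h B"
      by (auto simp: Us_def Qs_def u_def y_def Q_def f_def intro!: adjoinD \<omega>_in YB)
  qed
  ultimately show ?thesis by (rule rational_if_fixed_gens)
qed

end

section \<open>The quaternion group\<close>

lemma card_le_length: "A \<subseteq> set xs \<Longrightarrow> card A \<le> length xs"
  using card_mono[of "set xs" A] card_length[of xs] by simp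

text \<open>
  Without an element of order two outside the center, the group is the quaternion group. Its
  faithful representation need not split over \<open>K\<close>: it is the quaternion algebra, on which the group
  acts by left multiplication, with \<open>a\<close> as the unit \<open>i\<close> and \<open>b\<close> as \<open>j\<close>.
\<close>

locale heisenberg_quaternion = heisenberg_action G p a b z c d K
  for G (structure) and p a b z c d and K :: "'k::field itself" +
  assumes p2: "p = 2"
    and squares: "a [^] p = z" "b [^] p = z"
    and not_char_2: "CHAR('k) \<noteq> 2"
begin

lemma two_nonzero: "(2 :: ('a, 'k) ratfun) \<noteq> 0"
proof -
  have "(2 :: 'k) \<noteq> 0"
  proof
    assume "(2 :: 'k) = 0"
    then have "of_nat 2 = (0 :: 'k)" by simp
    then have "CHAR('k) dvd 2" by (simp only: of_nat_eq_0_iff_char_dvd)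
    then show False using not_char_2 by (auto simp: prime_nat_iff dest: two_is_prime_nat[unfolded prime_nat_iff, THEN conjunct2, rule_format])
  qed
  moreover have "h (1 + 1) = 1 + 1"
    unfolding ring_hom_funD(2)[OF base_hom] ring_hom_funD(1)[OF base_hom] ..
  ultimately show ?thesis using field_hom(5)[OF base_hom] by (metis one_add_one)
qed

lemma primitive_minus_one: "primitive_root_of_unity 2 (- 1 :: ('a, 'k) ratfun)"
proof -
  have "(1 :: ('a, 'k) ratfun) + 1 \<noteq> 0" using two_nonzero by simp
  then have "(- 1 :: ('a, 'k) ratfun) \<noteq> 1" by (metis add.right_inverse)
  then show ?thesis by (auto simp: primitive_root_of_unity_def less_2_cases_iff)
qed

lemmas act_simps = ring_hom_funD[OF act_hom(1)] field_hom[OF act_hom(1)]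

lemma xvar_cycles: "xvar i j (k + 2) = xvar i j k" "xvar i (j + 2) k = xvar i j (k + 1)"
  "xvar (i + 2) j k = xvar i j (k + 1)"
proof -
  show "xvar i j (k + 2) = xvar i j k" using xvar_periodic(1) p2 by simp
  have "z [^] c = z" "z [^] d = z" using powers squares by simp_all
  then have eq: "z [^] (k + c) = z [^] (k + 1)" "z [^] (k + d) = z [^] (k + 1)"
    by (simp_all flip: nat_pow_mult)
  show "xvar i (j + 2) k = xvar i j (k + 1)" "xvar (i + 2) j k = xvar i j (k + 1)"
    using xvar_periodic(2,3)[of i j k] p2 eq by (simp_all add: xvar_def)
qed

text \<open>
  The part of the regular representation on which \<open>z\<close> acts as \<open>-1\<close>.
\<close>

definition D :: "nat \<Rightarrow> nat \<Rightarrow> nat \<Rightarrow> ('a, 'k) ratfun" where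
  "D i j k = xvar i j k - xvar i j (k + 1)"

lemma D_cycles: "D i j (k + 1) = - D i j k" "D i (j + 2) k = - D i j k" "D (i + 2) j k = - D i j k"
  using xvar_cycles(1)[of i j k] xvar_cycles(2)[of i j k] xvar_cycles(2)[of i j "k + 1"]
    xvar_cycles(3)[of i j k] xvar_cycles(3)[of i j "k + 1"]
  by (simp_all add: D_def)

lemma act_D: "act a (D i j k) = D (i + 1) j k" "act b (D i j k) = D i (j + 1) (k + i)"
  "act z (D i j k) = - D i j k"
  using D_cycles(1)[of i j k] by (simp_all add: D_def act_simps act_xvar)

text \<open>
  The coordinates of the quaternion \<open>q = y0 + y1 i + y2 j + y3 k\<close>.
\<close>

definition y0 :: "('a, 'k) ratfun" where "y0 = D 0 0 0"
definition y1 :: "('a, 'k) ratfun" where "y1 = D 1 0 0"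
definition y2 :: "('a, 'k) ratfun" where "y2 = D 0 1 0"
definition y3 :: "('a, 'k) ratfun" where "y3 = D 1 1 0"

lemma act_y:
  "act a y0 = y1" "act a y1 = - y0" "act a y2 = y3" "act a y3 = - y2"
  "act b y0 = y2" "act b y1 = - y3" "act b y2 = - y0" "act b y3 = y1"
  "act z y0 = - y0" "act z y1 = - y1" "act z y2 = - y2" "act z y3 = - y3"
  using D_cycles(3)[of 0 0 0] D_cycles(3)[of 0 1 0] D_cycles(1)[of 1 1 0] D_cycles(2)[of 0 0 0]
    D_cycles(2)[of 1 0 1] D_cycles(1)[of 1 0 0]
  by (simp_all add: y0_def y1_def y2_def y3_def act_D numeral_2_eq_2)

text \<open>
  The part of the regular representation on which \<open>z\<close> acts trivially. It is a sum of the four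
  characters of the Klein four-group, with the eigenvectors \<open>c00\<close>, \<open>c10\<close>, \<open>c01\<close>, \<open>c11\<close> below.
\<close>

definition S :: "nat \<Rightarrow> nat \<Rightarrow> ('a, 'k) ratfun" where
  "S i j = xvar i j 0 + xvar i j 1"

lemma act_S: "act a (S i j) = S (i + 1) j" "act b (S i j) = S i (j + 1)" "act z (S i j) = S i j"
proof -
  show "act a (S i j) = S (i + 1) j" by (simp add: S_def act_simps act_xvar)
  show "act z (S i j) = S i j"
    using xvar_cycles(1)[of i j 0] by (simp add: S_def act_simps act_xvar numeral_2_eq_2)
  have "xvar i' j' k + xvar i' j' (k + 1) = S i' j'" for i' j' k
  proof (induction k)
    case (Suc k)
    then show ?case using xvar_cycles(1)[of i' j' k] by (simp add: add.commute)
  qed (simp add: S_def)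
  from this[of i "j + 1" i] show "act b (S i j) = S i (j + 1)"
    by (simp add: S_def act_simps act_xvar)
qed

lemma S_cycles: "S (i + 2) j = S i j" "S i (j + 2) = S i j"
  using xvar_cycles(3)[of i j 0] xvar_cycles(3)[of i j 1] xvar_cycles(2)[of i j 0]
    xvar_cycles(2)[of i j 1] xvar_cycles(1)[of i j 0]
  by (simp_all add: S_def numeral_2_eq_2 add.commute)

lemma S_2: "S 2 j = S 0 j" "S i 2 = S i 0"
  using S_cycles(1)[of 0 j] S_cycles(2)[of i 0] by (simp_all add: numeral_2_eq_2)

definition c00 :: "('a, 'k) ratfun" where "c00 = S 0 0 + S 1 0 + S 0 1 + S 1 1"
definition c10 :: "('a, 'k) ratfun" where "c10 = S 0 0 - S 1 0 + S 0 1 - S 1 1"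
definition c01 :: "('a, 'k) ratfun" where "c01 = S 0 0 + S 1 0 - S 0 1 - S 1 1"
definition c11 :: "('a, 'k) ratfun" where "c11 = S 0 0 - S 1 0 - S 0 1 + S 1 1"

lemma act_c:
  "act a c00 = c00" "act a c10 = - c10" "act a c01 = c01" "act a c11 = - c11"
  "act b c00 = c00" "act b c10 = c10" "act b c01 = - c01" "act b c11 = - c11"
  "act z c00 = c00" "act z c10 = c10" "act z c01 = c01" "act z c11 = c11"
  using S_2 by (simp_all add: c00_def c10_def c01_def c11_def act_simps act_S numeral_2_eq_2)

abbreviation "cs \<equiv> {c00, c10, c01, c11}"

lemma numeral_in: "numeral n \<in> adjoin h T"
  using adjoinD(12)[of "numeral n" h T] by simp

lemma B_subset_adjoin_y_c:
  assumes T: "{y0, y1, y2, y3} \<subseteq> adjoin h T" "cs \<subseteq> adjoin h T"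
  shows "B \<subseteq> adjoin h T"
proof -
  note I = adjoinD[where h = h and S = T]
  have S_eq: "S 0 0 = (c00 + c10 + c01 + c11) / 4" "S 1 0 = (c00 - c10 + c01 - c11) / 4"
    "S 0 1 = (c00 + c10 - c01 - c11) / 4" "S 1 1 = (c00 - c10 - c01 + c11) / 4"
  proof -
    have "(4 :: ('a, 'k) ratfun) = 2 * 2" by simp
    then have "(4 :: ('a, 'k) ratfun) \<noteq> 0" using two_nonzero by (metis no_zero_divisors)
    then show "S 0 0 = (c00 + c10 + c01 + c11) / 4" "S 1 0 = (c00 - c10 + c01 - c11) / 4"
      "S 0 1 = (c00 + c10 - c01 - c11) / 4" "S 1 1 = (c00 - c10 - c01 + c11) / 4"
      by (simp_all add: c00_def c10_def c01_def c11_def field_simps)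
  qed
  have c: "c00 \<in> adjoin h T" "c10 \<in> adjoin h T" "c01 \<in> adjoin h T" "c11 \<in> adjoin h T"
    using T(2) by auto
  have "S 0 0 \<in> adjoin h T" "S 1 0 \<in> adjoin h T" "S 0 1 \<in> adjoin h T" "S 1 1 \<in> adjoin h T"
    unfolding S_eq by (intro I(3,5,8) c numeral_in)+
  moreover have "D 0 0 0 \<in> adjoin h T" "D 1 0 0 \<in> adjoin h T" "D 0 1 0 \<in> adjoin h T" "D 1 1 0 \<in> adjoin h T"
    using T(1) by (simp_all add: y0_def y1_def y2_def y3_def)
  ultimately have SD: "S i j \<in> adjoin h T \<and> D i j 0 \<in> adjoin h T" if "i < 2" "j < 2" for i j
    using that by (auto simp: less_2_cases_iff)
  have "xvar i j k \<in> adjoin h T" if "i < 2" "j < 2" "k < 2" for i j k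
  proof -
    have "xvar i j 0 = (S i j + D i j 0) / 2" "xvar i j 1 = (S i j - D i j 0) / 2"
      using two_nonzero by (simp_all add: S_def D_def field_simps)
    moreover have "(S i j + D i j 0) / 2 \<in> adjoin h T" "(S i j - D i j 0) / 2 \<in> adjoin h T"
      using SD[OF that(1,2)] by (intro I(3,5,8) numeral_in; simp)+
    ultimately have "xvar i j 0 \<in> adjoin h T" "xvar i j 1 \<in> adjoin h T" by (simp_all only:)
    then show ?thesis using that(3) by (auto simp: less_2_cases_iff)
  qed
  then show ?thesis unfolding B_eq p2 by auto
qed

lemma card_B_8: "card B = 8"
  using card_B p2 by simp

lemma indep_y: "indep (acl h) ({y0, y1, y2, y3} \<union> cs)"
  and card_y: "card ({y0, y1, y2, y3} \<union> cs) = 8"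
proof -
  let ?C = "{y0, y1, y2, y3} \<union> cs"
  have "B \<subseteq> adjoin h ?C" using adjoin_incl[of ?C h] by (intro B_subset_adjoin_y_c) auto
  then have *: "B \<subseteq> acl h ?C" using adjoin_subset_acl by blast
  have "card ?C \<le> card B"
    unfolding card_B_8
    by (rule order_trans[OF card_le_length[of _ "[y0, y1, y2, y3, c00, c10, c01, c11]"]]) auto
  then show "indep (acl h) ?C" "card ?C = 8"
    using indep_if_generating[OF *] card_B_8 by simp_all
qed

lemma y0_transcendental: "\<not> alg_over (adjoin h {y1, y2, y3}) y0"
proof (rule not_alg_if_indep[OF indep_y])
  show "y0 \<notin> {y1, y2, y3}"
  proof
    assume "y0 \<in> {y1, y2, y3}"
    then have "{y0, y1, y2, y3} \<union> cs = {y1, y2, y3} \<union> cs" by blast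
    moreover have "card ({y1, y2, y3} \<union> cs) \<le> 7"
      by (rule order_trans[OF card_le_length[of _ "[y1, y2, y3, c00, c10, c01, c11]"]]) auto
    ultimately show False using card_y by simp
  qed
qed auto

lemma y_nonzero: "y0 \<noteq> 0" "y1 \<noteq> 0" "y2 \<noteq> 0" "y3 \<noteq> 0"
  using nonzero_if_indep[OF indep_y] by auto

text \<open>
  The rows of this matrix are the coordinates of \<open>q' i q\<close>, \<open>q' j q\<close> and \<open>q' k q\<close>, where \<open>q'\<close> is the
  conjugate of \<open>q\<close> and \<open>N\<close> its norm. Divided by \<open>N\<close> it is a rotation, whence the identities between
  the entries. Replacing \<open>q\<close> by \<open>i q\<close> keeps the first row and negates the second, and replacing it by
  \<open>j q\<close> does the opposite.
\<close>

abbreviation r11 where "r11 \<equiv> y0\<^sup>2 + y1\<^sup>2 - y2\<^sup>2 - y3\<^sup>2"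
abbreviation r12 where "r12 \<equiv> 2 * (y1 * y2 - y0 * y3)"
abbreviation r13 where "r13 \<equiv> 2 * (y1 * y3 + y0 * y2)"
abbreviation r21 where "r21 \<equiv> 2 * (y1 * y2 + y0 * y3)"
abbreviation r22 where "r22 \<equiv> y0\<^sup>2 - y1\<^sup>2 + y2\<^sup>2 - y3\<^sup>2"
abbreviation r23 where "r23 \<equiv> 2 * (y2 * y3 - y0 * y1)"
abbreviation r31 where "r31 \<equiv> 2 * (y1 * y3 - y0 * y2)"
abbreviation r32 where "r32 \<equiv> 2 * (y2 * y3 + y0 * y1)"
abbreviation r33 where "r33 \<equiv> y0\<^sup>2 - y1\<^sup>2 - y2\<^sup>2 + y3\<^sup>2"
abbreviation N where "N \<equiv> y0\<^sup>2 + y1\<^sup>2 + y2\<^sup>2 + y3\<^sup>2"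

text \<open>
  If one of these polynomials vanished, then \<open>y0\<close> would be algebraic over \<open>K(y1, y2, y3)\<close>.
\<close>

lemma rotation_nonzero: "r11 \<noteq> 0" "r13 \<noteq> 0" "r21 \<noteq> 0" "N \<noteq> 0"
proof -
  let ?F = "adjoin h {y1, y2, y3}"
  have yF: "y1 \<in> ?F" "y2 \<in> ?F" "y3 \<in> ?F" using adjoin_incl[of "{y1, y2, y3}" h] by auto
  have "y0\<^sup>2 \<noteq> w" if w: "w \<in> ?F" for w
  proof
    assume "y0\<^sup>2 = w"
    then show False using y0_transcendental alg_over_root[OF adjoin_subfield[of h "{y1, y2, y3}"], of y0 2] w by simp
  qed
  moreover have "y2\<^sup>2 + y3\<^sup>2 - y1\<^sup>2 \<in> ?F" "- (y1\<^sup>2 + y2\<^sup>2 + y3\<^sup>2) \<in> ?F"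
    using yF by (auto intro!: adjoinD)
  ultimately have "y0\<^sup>2 \<noteq> y2\<^sup>2 + y3\<^sup>2 - y1\<^sup>2" "y0\<^sup>2 \<noteq> - (y1\<^sup>2 + y2\<^sup>2 + y3\<^sup>2)" by blast+
  then show "r11 \<noteq> 0" "N \<noteq> 0" by (simp_all add: algebra_simps eq_neg_iff_add_eq_0)
  have "y0 \<notin> ?F" using y0_transcendental alg_over_self[OF adjoin_subfield] by blast
  moreover have "- (y1 * y3) / y2 \<in> ?F" "- (y1 * y2) / y3 \<in> ?F"
    using yF by (intro adjoinD; simp)+
  ultimately have ne: "y0 \<noteq> - (y1 * y3) / y2" "y0 \<noteq> - (y1 * y2) / y3" by metis+
  have "y1 * y3 + y0 * y2 \<noteq> 0" "y1 * y2 + y0 * y3 \<noteq> 0"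
    using ne y_nonzero by (auto simp: field_simps add_eq_0_iff)
  then show "r13 \<noteq> 0" "r21 \<noteq> 0" using two_nonzero by (metis mult_eq_0_iff)+
qed

lemma rotation_identities:
  "r11 * r21 + r12 * r22 + r13 * r23 = 0"
  "r11\<^sup>2 + r12\<^sup>2 + r13\<^sup>2 = N\<^sup>2" "r21\<^sup>2 + r22\<^sup>2 + r23\<^sup>2 = N\<^sup>2"
  "r12 * r23 - r13 * r22 = N * r31" "r13 * r21 - r11 * r23 = N * r32"
  "r11 * r22 - r12 * r21 = N * r33"
  by (simp_all add: power2_eq_square algebra_simps)

lemma act_rotation:
  "act a r11 = r11" "act a r12 = r12" "act a r13 = r13"
  "act a r21 = - r21" "act a r22 = - r22" "act a r23 = - r23" "act a N = N"
  "act b r11 = - r11" "act b r12 = - r12" "act b r13 = - r13"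
  "act b r21 = r21" "act b r22 = r22" "act b r23 = r23" "act b N = N"
  "act z r11 = r11" "act z r12 = r12" "act z r13 = r13" "act z r21 = r21" "act z r22 = r22"
proof -
  have two: "act g 2 = 2" if "g \<in> carrier G" for g
    using ring_hom_funD(1,2)[OF act_hom(1)[OF that]] by (metis one_add_one)
  show "act a r11 = r11" "act a r12 = r12" "act a r13 = r13"
    "act a r21 = - r21" "act a r22 = - r22" "act a r23 = - r23" "act a N = N"
    "act b r11 = - r11" "act b r12 = - r12" "act b r13 = - r13"
    "act b r21 = r21" "act b r22 = r22" "act b r23 = r23" "act b N = N"
    "act z r11 = r11" "act z r12 = r12" "act z r13 = r13" "act z r21 = r21" "act z r22 = r22"
    by (simp_all add: act_simps act_y two algebra_simps)
qed

definition q1 :: "('a, 'k) ratfun" where "q1 = y1 / y0"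
definition q2 :: "('a, 'k) ratfun" where "q2 = y2 / y0"
definition q3 :: "('a, 'k) ratfun" where "q3 = y3 / y0"

abbreviation "qs \<equiv> {q1, q2, q3}"

lemma act_q:
  "act a q1 = - (1 / q1)" "act a q2 = q3 / q1" "act a q3 = - (q2 / q1)"
  "act b q1 = - (q3 / q2)" "act b q2 = - (1 / q2)" "act b q3 = q1 / q2"
  "act z q1 = q1" "act z q2 = q2" "act z q3 = q3"
  using y_nonzero by (simp_all add: q1_def q2_def q3_def act_simps act_y)

lemma y_in_adjoin_q: "{y0, y1, y2, y3} \<subseteq> adjoin h (insert y0 qs)"
proof -
  have "y1 = q1 * y0" "y2 = q2 * y0" "y3 = q3 * y0"
    using y_nonzero by (simp_all add: q1_def q2_def q3_def)
  moreover have "q1 \<in> adjoin h (insert y0 qs)" "q2 \<in> adjoin h (insert y0 qs)"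
    "q3 \<in> adjoin h (insert y0 qs)" "y0 \<in> adjoin h (insert y0 qs)"
    using adjoin_incl[of "insert y0 qs" h] by auto
  ultimately show ?thesis by (auto intro: adjoinD)
qed

text \<open>
  The first two rows of the rotation are \<open>\<alpha> (1, s2, s3)\<close> and \<open>\<beta> (1, t2, t3)\<close>. The slopes \<open>s2\<close>, \<open>s3\<close>, \<open>t2\<close>, \<open>t3\<close>
  describe the lines spanned by the rows; they do not see the signs and are therefore invariant.
\<close>

definition \<alpha> :: "('a, 'k) ratfun" where "\<alpha> = r11 / N"
definition \<beta> :: "('a, 'k) ratfun" where "\<beta> = r21 / N"
definition s2 :: "('a, 'k) ratfun" where "s2 = r12 / r11"
definition s3 :: "('a, 'k) ratfun" where "s3 = r13 / r11"
definition t2 :: "('a, 'k) ratfun" where "t2 = r22 / r21"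
definition t3 :: "('a, 'k) ratfun" where "t3 = r23 / r21"

abbreviation "F0 \<equiv> adjoin h {s2, s3, t2}"

lemma act_slopes:
  "act a \<alpha> = \<alpha>" "act a \<beta> = - 1 * \<beta>" "act b \<alpha> = - 1 * \<alpha>" "act b \<beta> = \<beta>"
  "g \<in> gen \<Longrightarrow> s \<in> {s2, s3, t2} \<Longrightarrow> g s = s"
proof -
  have div: "act g (x / y) = act g x / act g y" if "g \<in> carrier G" for g x y
    using field_hom(4)[OF act_hom(1)[OF that]] .
  show "act a \<alpha> = \<alpha>" "act a \<beta> = - 1 * \<beta>" "act b \<alpha> = - 1 * \<alpha>" "act b \<beta> = \<beta>"
    unfolding \<alpha>_def \<beta>_def div[OF ab_closed(1)] div[OF ab_closed(2)] act_rotation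
    by (simp_all only: mult_minus1 minus_divide_left)
  have "act a s2 = s2" "act a s3 = s3" "act a t2 = t2" "act b s2 = s2" "act b s3 = s3" "act b t2 = t2"
    "act z s2 = s2" "act z s3 = s3" "act z t2 = t2"
    unfolding s2_def s3_def t2_def div[OF ab_closed(1)] div[OF ab_closed(2)] div[OF z_closed] act_rotation
    by (simp_all only: minus_divide_divide)
  then show "g \<in> gen \<Longrightarrow> s \<in> {s2, s3, t2} \<Longrightarrow> g s = s" by auto
qed

text \<open>
  The rows are orthogonal.
\<close>

lemma t3_in: "t3 \<in> F0"
proof -
  have quotients: "(u1 * v1 + u2 * v2 + u3 * v3) / (u1 * v1) = 1 + u2 / u1 * (v2 / v1) + u3 / u1 * (v3 / v1)"
    if "u1 \<noteq> 0" "v1 \<noteq> 0" for u1 u2 u3 v1 v2 v3 :: "('a, 'k) ratfun"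
    using that by (simp add: add_divide_distrib)
  have "(r11 * r21 + r12 * r22 + r13 * r23) / (r11 * r21) = 0"
    unfolding rotation_identities(1) by simp
  moreover have "(r11 * r21 + r12 * r22 + r13 * r23) / (r11 * r21) = 1 + s2 * t2 + s3 * t3"
    unfolding s2_def s3_def t2_def t3_def by (rule quotients[OF rotation_nonzero(1,3)])
  ultimately have "1 + s2 * t2 + s3 * t3 = 0" by metis
  then have "s3 * t3 = - (1 + s2 * t2)" by (simp only: add_eq_0_iff)
  moreover have "s3 \<noteq> 0" using rotation_nonzero by (simp only: s3_def divide_eq_0_iff) simp
  ultimately have "t3 = - (1 + s2 * t2) / s3" by (simp add: field_simps)
  moreover have "s2 \<in> F0" "s3 \<in> F0" "t2 \<in> F0" using adjoin_incl[of "{s2, s3, t2}" h] by auto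
  ultimately show ?thesis by (auto intro!: adjoinD)
qed

text \<open>
  The rows of a rotation have length one.
\<close>

lemma squares_in: "\<alpha>\<^sup>2 \<in> F0" "\<beta>\<^sup>2 \<in> F0"
proof -
  have *: "x\<^sup>2 / n\<^sup>2 = 1 / (1 + (y / x)\<^sup>2 + (w / x)\<^sup>2)"
    if "x \<noteq> 0" "n \<noteq> 0" "x\<^sup>2 + y\<^sup>2 + w\<^sup>2 = n\<^sup>2" for x y w n :: "('a, 'k) ratfun"
  proof -
    have "1 + (y / x)\<^sup>2 + (w / x)\<^sup>2 = n\<^sup>2 / x\<^sup>2"
      unfolding that(3)[symmetric] using that(1) by (simp add: power_divide add_divide_distrib)
    then show ?thesis by simp
  qed
  have "\<alpha>\<^sup>2 = 1 / (1 + s2\<^sup>2 + s3\<^sup>2)"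
    unfolding \<alpha>_def s2_def s3_def power_divide[of r11 N]
    by (rule *[OF rotation_nonzero(1,4) rotation_identities(2)])
  moreover have "\<beta>\<^sup>2 = 1 / (1 + t2\<^sup>2 + t3\<^sup>2)"
    unfolding \<beta>_def t2_def t3_def power_divide[of r21 N]
    by (rule *[OF rotation_nonzero(3,4) rotation_identities(3)])
  moreover have "s2 \<in> F0" "s3 \<in> F0" "t2 \<in> F0" using adjoin_incl[of "{s2, s3, t2}" h] by auto
  ultimately show "\<alpha>\<^sup>2 \<in> F0" "\<beta>\<^sup>2 \<in> F0" using t3_in by (auto intro!: adjoinD)
qed

text \<open>
  The third row of a rotation is the cross product of the first two, and a quaternion is determined
  up to a factor by its rotation: \<open>4 y0\<^sup>2\<close>, \<open>4 y0 y1\<close>, \<open>4 y0 y2\<close> and \<open>4 y0 y3\<close> are linear in \<open>N\<close> and the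
  entries of the matrix.
\<close>

lemma q_in: "qs \<subseteq> adjoin h (insert \<alpha> (insert \<beta> {s2, s3, t2}))"
proof -
  let ?F = "adjoin h (insert \<alpha> (insert \<beta> {s2, s3, t2}))"
  have "F0 \<subseteq> ?F" by (intro adjoin_mono) auto
  then have in_F: "\<alpha> \<in> ?F" "\<beta> \<in> ?F" "s2 \<in> ?F" "s3 \<in> ?F" "t2 \<in> ?F" "t3 \<in> ?F"
    using adjoin_incl[of "insert \<alpha> (insert \<beta> {s2, s3, t2})" h] t3_in by auto
  have N0: "N \<noteq> 0" by (rule rotation_nonzero)
  have \<rho>: "r11 / N \<in> ?F" "r12 / N \<in> ?F" "r13 / N \<in> ?F" "r21 / N \<in> ?F" "r22 / N \<in> ?F" "r23 / N \<in> ?F"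
  proof -
    have mul: "y / n = x / n * (y / x)" if "x \<noteq> 0" for x y n :: "('a, 'k) ratfun" using that by simp
    have "r12 / N = \<alpha> * s2" "r13 / N = \<alpha> * s3" unfolding \<alpha>_def s2_def s3_def
      by (rule mul[OF rotation_nonzero(1)])+
    moreover have "r22 / N = \<beta> * t2" "r23 / N = \<beta> * t3" unfolding \<beta>_def t2_def t3_def
      by (rule mul[OF rotation_nonzero(3)])+
    ultimately show "r11 / N \<in> ?F" "r12 / N \<in> ?F" "r13 / N \<in> ?F" "r21 / N \<in> ?F" "r22 / N \<in> ?F" "r23 / N \<in> ?F"
      using in_F by (simp_all only: \<alpha>_def[symmetric] \<beta>_def[symmetric] adjoinD(6))
  qed
  have row3: "w / n \<in> ?F"
    if "x1 / n \<in> ?F" "x2 / n \<in> ?F" "x3 / n \<in> ?F" "x4 / n \<in> ?F" "n \<noteq> 0" "x1 * x2 - x3 * x4 = n * w"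
    for x1 x2 x3 x4 n w
  proof -
    have "w / n = (x1 * x2 - x3 * x4) / (n * n)" using that(5) unfolding that(6) by simp
    also have "\<dots> = x1 / n * (x2 / n) - x3 / n * (x4 / n)" by (simp add: diff_divide_distrib)
    also have "\<dots> \<in> ?F" using that(1-4) by (intro adjoinD(3) adjoinD(6))
    finally show ?thesis .
  qed
  have \<rho>3: "r31 / N \<in> ?F" "r32 / N \<in> ?F" "r33 / N \<in> ?F"
    by (rule row3[OF \<rho>(2,6,3,5) N0 rotation_identities(4)], rule row3[OF \<rho>(3,4,1,6) N0 rotation_identities(5)],
        rule row3[OF \<rho>(1,5,2,4) N0 rotation_identities(6)])
  have "(4 :: ('a, 'k) ratfun) = 2 * 2" by simp
  then have four: "(4 :: ('a, 'k) ratfun) \<noteq> 0" using two_nonzero by (metis no_zero_divisors)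
  have common_denominator: "n \<noteq> 0 \<Longrightarrow> 1 + x / n + x' / n + x'' / n = (n + x + x' + x'') / n"
    for x x' x'' n :: "('a, 'k) ratfun" by (simp add: add_divide_distrib)
  have trace: "1 + r11 / N + r22 / N + r33 / N = 4 * y0\<^sup>2 / N"
  proof -
    have "1 + r11 / N + r22 / N + r33 / N = (N + r11 + r22 + r33) / N"
      by (rule common_denominator[OF N0])
    also have "N + r11 + r22 + r33 = 4 * y0\<^sup>2" by simp
    finally show ?thesis .
  qed
  have quot: "v / y0 = (x / n - w / n) / (4 * y0\<^sup>2 / n)" if "x - w = 4 * y0 * v" "n \<noteq> 0" for x w v n
    unfolding diff_divide_distrib[symmetric] that(1)
    using that(2) four y_nonzero(1) by (simp add: power2_eq_square)
  have q_eq: "q1 = (r32 / N - r23 / N) / (1 + r11 / N + r22 / N + r33 / N)"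
    "q2 = (r13 / N - r31 / N) / (1 + r11 / N + r22 / N + r33 / N)"
    "q3 = (r21 / N - r12 / N) / (1 + r11 / N + r22 / N + r33 / N)"
    unfolding trace q1_def q2_def q3_def
    by (rule quot[OF _ N0], simp add: algebra_simps)+
  have den: "1 + r11 / N + r22 / N + r33 / N \<in> ?F"
    using \<rho> \<rho>3 by (intro adjoinD(5) adjoinD(1))
  have "q1 \<in> ?F" "q2 \<in> ?F" "q3 \<in> ?F"
    unfolding q_eq by (rule adjoinD(8)[OF adjoinD(3) den], rule \<rho> \<rho>3, rule \<rho> \<rho>3)+
  then show ?thesis by blast
qed

lemma slopes_in: "\<alpha> \<in> adjoin h qs" "\<beta> \<in> adjoin h qs" "F0 \<subseteq> adjoin h qs"
proof -
  let ?F = "adjoin h qs"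
  have q: "q1 \<in> ?F" "q2 \<in> ?F" "q3 \<in> ?F" using adjoin_incl[of qs h] by auto
  define m where "m = 1 + q1\<^sup>2 + q2\<^sup>2 + q3\<^sup>2"
  define m11 where "m11 = 1 + q1\<^sup>2 - q2\<^sup>2 - q3\<^sup>2"
  define m12 where "m12 = 2 * (q1 * q2 - q3)"
  define m13 where "m13 = 2 * (q1 * q3 + q2)"
  define m21 where "m21 = 2 * (q1 * q2 + q3)"
  define m22 where "m22 = 1 - q1\<^sup>2 + q2\<^sup>2 - q3\<^sup>2"
  have y: "y1 = y0 * q1" "y2 = y0 * q2" "y3 = y0 * q3"
    using y_nonzero by (simp_all add: q1_def q2_def q3_def)
  have r: "N = y0\<^sup>2 * m" "r11 = y0\<^sup>2 * m11" "r12 = y0\<^sup>2 * m12" "r13 = y0\<^sup>2 * m13" "r21 = y0\<^sup>2 * m21" "r22 = y0\<^sup>2 * m22"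
    unfolding y m_def m11_def m12_def m13_def m21_def m22_def
    by (simp_all add: power2_eq_square algebra_simps)
  have cancel: "y0\<^sup>2 * v / (y0\<^sup>2 * w) = v / w" for v w using y_nonzero(1) by simp
  have "m \<in> ?F" "m11 \<in> ?F" "m12 \<in> ?F" "m13 \<in> ?F" "m21 \<in> ?F" "m22 \<in> ?F"
    unfolding m_def m11_def m12_def m13_def m21_def m22_def
    by (intro adjoinD q numeral_in)+
  then have "\<alpha> \<in> ?F" "\<beta> \<in> ?F" "s2 \<in> ?F" "s3 \<in> ?F" "t2 \<in> ?F"
    unfolding \<alpha>_def \<beta>_def s2_def s3_def t2_def r cancel by (auto intro: adjoinD)
  then show "\<alpha> \<in> ?F" "\<beta> \<in> ?F" "F0 \<subseteq> ?F" by (simp_all add: adjoin_subset_iff)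
qed

text \<open>
  The field \<open>K(q1, q2, q3)\<close> arises from \<open>K(s2, s3, t2)\<close>, whose elements are all fixed, by adjoining the
  two square roots \<open>\<alpha>\<close> and \<open>\<beta>\<close>. Their signs are changed independently by \<open>b\<close> and \<open>a\<close>, so this adds no
  invariants. The remaining five generators are multiplied by elements of that field.
\<close>

theorem rational_quaternion: "rational_over h (Fix (adjoin h B))"
proof -
  have F0: "fixed_gens {s2, s3, t2} (card {s2, s3, t2})"
    using act_slopes(5) by (intro fixed_gens_all_fixed) auto
  have qs_eq: "adjoin h qs = ext (ext F0 \<beta>) \<alpha>"
    unfolding adjoin_insert[symmetric] using q_in slopes_in adjoin_incl[of "{s2, s3, t2}" h]
    by (intro adjoin_eqI) auto
  have fixed_F0: "act g x = x" if "g \<in> {a, b}" "x \<in> F0" for g x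
  proof -
    have g: "g \<in> carrier G" using that(1) by auto
    have "is_subfield {x. act g x = x}" using g by (simp add: is_subfield_def act_simps)
    then have "F0 \<subseteq> {x. act g x = x}"
      using act_slopes(5)[of "act g"] that(1) act_hom(2)[OF g] by (intro adjoin_least) auto
    then show ?thesis using that(2) by blast
  qed
  have fixed_F1: "act b x = x" if "x \<in> ext F0 \<beta>" for x
  proof -
    have "is_subfield {x. act b x = x}" by (simp add: is_subfield_def act_simps)
    then have "ext F0 \<beta> \<subseteq> {x. act b x = x}"
      using fixed_F0[of b] act_slopes(4) by (intro ext_least) auto
    then show ?thesis using that by blast
  qed
  have sub: "F0 \<subseteq> ext F0 \<beta>" by (intro ext_incl adjoin_subfield)
  have m1: "- 1 \<in> F0" by (intro adjoinD)
  have two: "of_nat 2 \<noteq> (0 :: ('a, 'k) ratfun)" using two_nonzero by simp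
  have Fix_eq: "Fix (adjoin h qs) = Fix F0"
  proof
    show "Fix F0 \<subseteq> Fix (adjoin h qs)" using slopes_in(3) by (auto simp: Fix_def)
    show "Fix (adjoin h qs) \<subseteq> Fix F0"
    proof
      fix x assume x: "x \<in> Fix (adjoin h qs)"
      then have "x \<in> adjoin h qs" "\<forall>\<sigma>\<in>\<Gamma>. \<sigma> x = x" by (simp_all add: Fix_def)
      then have x': "x \<in> ext (ext F0 \<beta>) \<alpha>" "act a x = x" "act b x = x" using qs_eq by auto
      \<comment> \<open>\<open>b\<close> changes the sign of \<open>\<alpha>\<close> only, and \<open>a\<close> that of \<open>\<beta>\<close> only\<close>
      have "x \<in> ext F0 \<beta>"
        by (rule Kummer_fixed[where \<sigma> = "act b" and \<zeta> = "- 1" and n = 2 and \<alpha> = \<alpha>])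
          (use sub m1 squares_in act_slopes(3) x' fixed_F1 primitive_minus_one two
            act_hom(1)[of b] ext_subfield[OF adjoin_subfield] in \<open>auto\<close>)
      then have "x \<in> F0"
        by (rule Kummer_fixed[where \<sigma> = "act a" and \<zeta> = "- 1" and n = 2 and \<alpha> = \<beta>, rotated -2])
          (use m1 squares_in act_slopes(2) x' fixed_F0[of a] primitive_minus_one two
            act_hom(1)[of a] adjoin_subfield in \<open>auto\<close>)
      then show "x \<in> Fix F0" using x by (simp add: Fix_def)
    qed
  qed
  have "stable (adjoin h qs)"
  proof (rule stable_adjoin)
    fix g s assume "g \<in> gen" "s \<in> qs"
    moreover have "q1 \<in> adjoin h qs" "q2 \<in> adjoin h qs" "q3 \<in> adjoin h qs"
      using adjoin_incl[of qs h] by auto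
    ultimately show "g s \<in> adjoin h qs" by (auto simp: act_q intro!: adjoinD)
  qed
  then have "fixed_gens qs (card {s2, s3, t2})" using F0 Fix_eq by (simp add: fixed_gens_def)
  moreover have "card {s2, s3, t2} \<le> 3" by (rule order_trans[OF card_le_length[of _ "[s2, s3, t2]"]]) auto
  ultimately have qs: "fixed_gens qs 3" by (rule fixed_gens_mono)
  have gens: "B \<subseteq> adjoin h (qs \<union> insert y0 cs)"
  proof (rule B_subset_adjoin_y_c)
    have "adjoin h (insert y0 qs) \<subseteq> adjoin h (qs \<union> insert y0 cs)" by (intro adjoin_mono) auto
    then show "{y0, y1, y2, y3} \<subseteq> adjoin h (qs \<union> insert y0 cs)" using y_in_adjoin_q by blast
    show "cs \<subseteq> adjoin h (qs \<union> insert y0 cs)"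
      using adjoin_incl[of "qs \<union> insert y0 cs" h] by auto
  qed
  have "card (qs \<union> insert y0 cs) \<le> card B"
    unfolding card_B_8 by (rule order_trans[OF card_le_length[of _ "[q1, q2, q3, y0, c00, c10, c01, c11]"]]) auto
  then have indep: "indep (acl h) (qs \<union> insert y0 cs)"
    using gens adjoin_subset_acl[of h "qs \<union> insert y0 cs"] by (intro indep_if_generating) auto
  have "fixed_gens (qs \<union> insert y0 cs) (3 + card (insert y0 cs))"
  proof (rule fixed_gens_diagonal[OF qs _ indep])
    fix g t assume g: "g \<in> gen" and t: "t \<in> insert y0 cs"
    have "g t = q1 * t \<or> g t = q2 * t \<or> g t = 1 * t \<or> g t = - 1 * t"
      using g t y_nonzero(1) by (elim insertE) (simp_all add: act_c act_y q1_def q2_def)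
    moreover have "q1 \<in> adjoin h qs" "q2 \<in> adjoin h qs" "1 \<in> adjoin h qs" "- 1 \<in> adjoin h qs"
      using adjoin_incl[of qs h] by (auto intro: adjoinD)
    ultimately show "\<exists>\<alpha>\<in>adjoin h qs. g t = \<alpha> * t" by blast
  qed simp
  moreover have "card (insert y0 cs) \<le> 5"
    by (rule order_trans[OF card_le_length[of _ "[y0, c00, c10, c01, c11]"]]) auto
  then have "3 + card (insert y0 cs) \<le> card B" unfolding card_B_8 by simp
  ultimately have "fixed_gens (qs \<union> insert y0 cs) (card B)" by (rule fixed_gens_mono)
  moreover have "adjoin h (qs \<union> insert y0 cs) = adjoin h B"
  proof (rule adjoin_eqI[OF _ gens])
    have "xvar i j k \<in> adjoin h B" for i j k
      using xvar_in_B adjoin_incl[of B h] by blast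
    then have SD: "S i j \<in> adjoin h B" "D i j k \<in> adjoin h B" for i j k
      by (auto simp: S_def D_def intro: adjoinD)
    then have "{y0, y1, y2, y3} \<subseteq> adjoin h B"
      by (auto simp: y0_def y1_def y2_def y3_def)
    then show "qs \<union> insert y0 cs \<subseteq> adjoin h B"
      using SD(1) by (auto simp: q1_def q2_def q3_def c00_def c10_def c01_def c11_def intro!: adjoinD)
  qed
  ultimately show ?thesis by (rule rational_if_fixed_gens)
qed

end

section \<open>All cases together\<close>

theorem theorem1p8:
  fixes G :: "('g, 'm) monoid_scheme" and p :: nat
  assumes "Factorial_Ring.prime p"
    and "group G" and "\<not> comm_group G" and "Coset.order G = p ^ 3"
    and "CHAR('k::field) = p \<or>
      (CHAR('k) \<noteq> p \<and> (\<exists>\<zeta>::'k. primitive_root_of_unity p \<zeta>))"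
  shows "rational_over (rf_const :: 'k \<Rightarrow> ('g, 'k) ratfun) (fixed_field G)"
proof -
  obtain a b z c d where H: "heisenberg_type G p a b z c d"
    and cases: "b [^]\<^bsub>G\<^esub> p = \<one>\<^bsub>G\<^esub> \<or> p = 2 \<and> a [^]\<^bsub>G\<^esub> p = z \<and> b [^]\<^bsub>G\<^esub> p = z"
    using nonabelian_prime_cube[OF assms(2,3,1,4)] by blast
  interpret heisenberg_action G p a b z c d "TYPE('k)" by (intro heisenberg_action.intro H)
  show ?thesis
    unfolding fixed_field_eq
  proof (cases "CHAR('k) = p")
    case True
    then show "rational_over h (Fix (adjoin h B))" by (rule rational_char_p)
  next
    case False
    then obtain \<zeta> :: 'k where \<zeta>: "primitive_root_of_unity p \<zeta>" using assms(5) by blast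
    from cases show "rational_over h (Fix (adjoin h B))"
    proof
      assume "b [^]\<^bsub>G\<^esub> p = \<one>\<^bsub>G\<^esub>"
      then interpret heisenberg_split G p a b z c d "TYPE('k)" \<zeta>
        using \<zeta> False by unfold_locales auto
      show ?thesis by (rule rational_split)
    next
      assume "p = 2 \<and> a [^]\<^bsub>G\<^esub> p = z \<and> b [^]\<^bsub>G\<^esub> p = z"
      then interpret heisenberg_quaternion G p a b z c d "TYPE('k)"
        using False by unfold_locales auto
      show ?thesis by (rule rational_quaternion)
    qed
  qed
qed

end
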